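(* Let $G$ be a compact group with normalized left Haar measure $\lambda$ (so $\lambda(G)=1$) and let $\Phi$ be an $N$-function. Then $(A_\Phi(G),\|\cdot\|_{A_\Phi})$ is a symmetric Segal algebra with respect to $L^1(G)$. In particular, $(A_\Phi(G),\|\cdot\|_{A_\Phi})$ is an abstract Segal algebra with respect to $L^1(G)$.
   Context: Measurable functions on $G$ equal $\lambda$-a.e. are identified. $N$-functions. An $N$-function is a convex even function $\Phi:\mathbb R\to[0,\infty)$ with $\Phi(x)=0$ if and only if $x=0$, $\lim_{x\to0}\Phi(x)/x=0$ and $\lim_{x\to\infty}\Phi(x)/x=\infty$. Its complementary $N$-function is $\Psi(y)=\sup\{x|y|-\Phi(x):x\ge0\}$. Orlicz spaces. For measurable $f:G\to\mathbb C$ put $\rho_\Phi(f)=\int_G\Phi(|f(x)|)\,d\lambda(x)$. Let $M^\Phi(G)=\{f:\rho_\Phi(af)<\infty\text{ for all }a>0\}$ (and similarly $M^\Psi(G)$), $N_\Phi(f)=\inf\{k>0:\rho_\Phi(f/k)\le1\}$, and $\|g\|_\Psi=\sup\{\int_G|fg|\,d\lambda: f\text{ measurable},\ N_\Phi(f)\le1\}$. Convolution: $(f*g)(x)=\int_G f(y)g(y^{-1}x)\,d\lambda(y)$. Write $\check g(x)=g(x^{-1})$. The space $A_\Phi(G)$. It consists of all $u\in C_0(G)$ for which there are sequences $(f_n)\subseteq M^\Phi(G)$, $(g_n)\subseteq M^\Psi(G)$ with $\sum_{n=1}^\infty N_\Phi(f_n)\|g_n\|_\Psi<\infty$ and $u=\sum_{n=1}^\infty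 f_n*\check g_n$. It is a Banach space under the norm $\|u\|_{A_\Phi}=\inf\sum_{n=1}^\infty N_\Phi(f_n)\|g_n\|_\Psi$, the infimum being over all such representations of $u$. Segal algebras. For $t\in G$ let $(\mathcal L_tf)(x)=f(t^{-1}x)$ and $(\mathcal R_tf)(x)=f(xt)$. A linear subspace $S(G)$ of $L^1(G)$ with norm $\|\cdot\|_S$ is a Segal algebra if: (1) $S(G)$ is dense in $L^1(G)$; (2) $(S(G),\|\cdot\|_S)$ is a Banach space and $\|f\|_1\le\|f\|_S$ for all $f\in S(G)$; (3) $\mathcal L_tf\in S(G)$ for all $f\in S(G)$, $t\in G$; (4) for each $f\in S(G)$ the map $G\to S(G)$, $t\mapsto\mathcal L_tf$, is continuous. It is symmetric if moreover $\mathcal R_tf\in S(G)$ for all $f\in S(G)$, $t\in G$, and for each $f\in S(G)$ the map $G\to S(G)$, $t\mapsto\mathcal R_tf$, is continuous. Abstract Segal algebras. A Banach space $(B,\|\cdot\|_B)$ is an abstract Segal algebra with respect to a Banach algebra $(A,\|\cdot\|_A)$ if $B$ is a dense left ideal of $A$, there is $M>0$ with $\|f\|_A\le M\|f\|_B$ for all $f\in B$, and there is $C>0$ with $\|fg\|_B\le C\|f\|_A\|g\|_B$ for all $f,g\in B$. Here $A=L^1(G)$ with convolution. *)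

theory Defs
  imports "HOL-Analysis.Analysis"
begin

text \<open>
  Groups are written additively, with the library class \<open>topological_group_add\<close>; its addition is
  \<^emph>\<open>not\<close> assumed commutative. So \<open>x + y\<close> is the product $xy$, \<open>- x\<close> the inverse and
  \<open>0\<close> the unit.

  Functions that agree almost everywhere are identified as follows. A space of classes of measurable
  functions is represented by the set \<open>S\<close> of all members of its classes, that is, by a set of
  Borel functions closed under equality almost everywhere. A norm on the space of classes is
  represented by a function \<open>N\<close> on \<open>S\<close> satisfying the norm axioms, where definiteness reads
  \<open>N f = 0 \<longleftrightarrow> (AE x in M. f x = 0)\<close>; by the triangle inequality, \<open>N\<close> is then
  constant on classes.
\<close>


section \<open>Haar measure\<close>

definition radon_measure :: "'g::topological_space measure \<Rightarrow> bool" where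
  "radon_measure M \<longleftrightarrow>
     sets M = sets borel \<and>
     (\<forall>K. compact K \<and> K \<in> sets borel \<longrightarrow> emeasure M K < \<infinity>) \<and>
     (\<forall>A \<in> sets borel. emeasure M A = (INF U \<in> {U. open U \<and> A \<subseteq> U}. emeasure M U)) \<and>
     (\<forall>U. open U \<longrightarrow>
        emeasure M U = (SUP K \<in> {K. compact K \<and> K \<in> sets borel \<and> K \<subseteq> U}. emeasure M K))"

definition left_haar_measure :: "'g::{topological_group_add, t2_space} measure \<Rightarrow> bool" where
  "left_haar_measure M \<longleftrightarrow>
     radon_measure M \<and> emeasure M UNIV \<noteq> 0 \<and>
     (\<forall>a. \<forall>A \<in> sets borel. emeasure M ((\<lambda>x. a + x) ` A) = emeasure M A)"


section \<open>N-functions and Orlicz spaces\<close>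

definition N_function :: "(real \<Rightarrow> real) \<Rightarrow> bool" where
  "N_function \<Phi> \<longleftrightarrow>
     convex_on UNIV \<Phi> \<and> (\<forall>x. \<Phi> (- x) = \<Phi> x) \<and> (\<forall>x. \<Phi> x \<ge> 0) \<and>
     (\<forall>x. \<Phi> x = 0 \<longleftrightarrow> x = 0) \<and>
     ((\<lambda>x. \<Phi> x / x) \<longlongrightarrow> 0) (at 0) \<and>
     filterlim (\<lambda>x. \<Phi> x / x) at_top at_top"

definition complementary :: "(real \<Rightarrow> real) \<Rightarrow> real \<Rightarrow> real" where
  "complementary \<Phi> y = (SUP x \<in> {0..}. x * \<bar>y\<bar> - \<Phi> x)"

definition modular :: "(real \<Rightarrow> real) \<Rightarrow> 'g measure \<Rightarrow> ('g \<Rightarrow> complex) \<Rightarrow> ennreal" where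
  "modular \<Phi> M f = (\<integral>\<^sup>+ x. ennreal (\<Phi> (norm (f x))) \<partial>M)"

definition M_space :: "(real \<Rightarrow> real) \<Rightarrow> 'g measure \<Rightarrow> ('g \<Rightarrow> complex) set" where
  "M_space \<Phi> M =
     {f \<in> borel_measurable M. \<forall>a::real. a > 0 \<longrightarrow> modular \<Phi> M (\<lambda>x. of_real a * f x) < \<infinity>}"

text \<open>Both norms take values in \<open>ennreal\<close>, so that an infimum over the empty set is \<open>\<infinity>\<close>.\<close>

definition luxemburg_norm :: "(real \<Rightarrow> real) \<Rightarrow> 'g measure \<Rightarrow> ('g \<Rightarrow> complex) \<Rightarrow> ennreal" where
  "luxemburg_norm \<Phi> M f =
     (INF k \<in> {k::real. k > 0 \<and> modular \<Phi> M (\<lambda>x. f x / of_real k) \<le> 1}. ennreal k)"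

text \<open>The first argument is \<open>\<Phi>\<close>: this is $\|g\|_\Psi$ for \<open>\<Psi> = complementary \<Phi>\<close>.\<close>

definition orlicz_norm :: "(real \<Rightarrow> real) \<Rightarrow> 'g measure \<Rightarrow> ('g \<Rightarrow> complex) \<Rightarrow> ennreal" where
  "orlicz_norm \<Phi> M g =
     (SUP f \<in> {f \<in> borel_measurable M. luxemburg_norm \<Phi> M f \<le> 1}.
        \<integral>\<^sup>+ x. ennreal (norm (f x * g x)) \<partial>M)"


section \<open>Operations on functions on a group\<close>

definition conv ::
    "'g::group_add measure \<Rightarrow> ('g \<Rightarrow> complex) \<Rightarrow> ('g \<Rightarrow> complex) \<Rightarrow> 'g \<Rightarrow> complex" where
  "conv M f g = (\<lambda>x. \<integral>y. f y * g (- y + x) \<partial>M)"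

definition check :: "('g::group_add \<Rightarrow> complex) \<Rightarrow> 'g \<Rightarrow> complex" where
  "check g = (\<lambda>x. g (- x))"

definition left_translate :: "'g::group_add \<Rightarrow> ('g \<Rightarrow> complex) \<Rightarrow> 'g \<Rightarrow> complex" where
  "left_translate t f = (\<lambda>x. f (- t + x))"

definition right_translate :: "'g::group_add \<Rightarrow> ('g \<Rightarrow> complex) \<Rightarrow> 'g \<Rightarrow> complex" where
  "right_translate t f = (\<lambda>x. f (x + t))"


section \<open>The space $A_\Phi(G)$\<close>

definition C0 :: "('g::topological_space \<Rightarrow> complex) set" where
  "C0 = {u. continuous_on UNIV u \<and> (\<forall>e>0. \<exists>K. compact K \<and> (\<forall>x. x \<notin> K \<longrightarrow> norm (u x) < e))}"

text \<open>
  The series is required to converge pointwise. By Hoelder's inequality its \<open>n\<close>-th term is bounded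
  by \<open>luxemburg_norm \<Phi> M (f n) * orlicz_norm \<Phi> M (g n)\<close>, so this is the same as
  convergence in \<open>C0\<close>.
\<close>

definition A_representation ::
    "(real \<Rightarrow> real) \<Rightarrow> 'g::group_add measure \<Rightarrow> ('g \<Rightarrow> complex) \<Rightarrow>
     (nat \<Rightarrow> 'g \<Rightarrow> complex) \<Rightarrow> (nat \<Rightarrow> 'g \<Rightarrow> complex) \<Rightarrow> bool" where
  "A_representation \<Phi> M u f g \<longleftrightarrow>
     (\<forall>n. f n \<in> M_space \<Phi> M) \<and> (\<forall>n. g n \<in> M_space (complementary \<Phi>) M) \<and>
     (\<Sum>n. luxemburg_norm \<Phi> M (f n) * orlicz_norm \<Phi> M (g n)) < \<infinity> \<and>
     (\<forall>x. (\<lambda>n. conv M (f n) (check (g n)) x) sums u x)"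

definition A_space ::
    "(real \<Rightarrow> real) \<Rightarrow> 'g::topological_group_add measure \<Rightarrow> ('g \<Rightarrow> complex) set" where
  "A_space \<Phi> M = {u \<in> C0. \<exists>f g. A_representation \<Phi> M u f g}"

definition A_norm ::
    "(real \<Rightarrow> real) \<Rightarrow> 'g::topological_group_add measure \<Rightarrow> ('g \<Rightarrow> complex) \<Rightarrow> real" where
  "A_norm \<Phi> M u =
     enn2real (INF (f, g) \<in> {(f, g). A_representation \<Phi> M u f g}.
       \<Sum>n. luxemburg_norm \<Phi> M (f n) * orlicz_norm \<Phi> M (g n))"

text \<open>
  A normed space \<open>(S, N)\<close> of continuous functions, regarded as a space of classes of functions:
  the union of the classes of its members, and the transported norm. A Haar measure has full support,
  so the continuous representative of a class is unique and \<open>THE\<close> is well defined.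
\<close>

definition ae_space :: "'g measure \<Rightarrow> ('g \<Rightarrow> complex) set \<Rightarrow> ('g \<Rightarrow> complex) set" where
  "ae_space M S = {f \<in> borel_measurable M. \<exists>u\<in>S. AE x in M. f x = u x}"

definition ae_norm ::
    "'g measure \<Rightarrow> ('g \<Rightarrow> complex) set \<Rightarrow> (('g \<Rightarrow> complex) \<Rightarrow> real) \<Rightarrow>
     ('g \<Rightarrow> complex) \<Rightarrow> real" where
  "ae_norm M S N f = N (THE u. u \<in> S \<and> (AE x in M. f x = u x))"


section \<open>Banach spaces and Banach algebras of classes of functions\<close>

definition ae_subspace :: "'g measure \<Rightarrow> ('g \<Rightarrow> complex) set \<Rightarrow> bool" where
  "ae_subspace M S \<longleftrightarrow>
     S \<subseteq> borel_measurable M \<and>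
     (\<forall>f\<in>S. \<forall>g\<in>borel_measurable M. (AE x in M. f x = g x) \<longrightarrow> g \<in> S) \<and>
     (\<lambda>x. 0) \<in> S \<and>
     (\<forall>f\<in>S. \<forall>g\<in>S. (\<lambda>x. f x + g x) \<in> S) \<and>
     (\<forall>f\<in>S. \<forall>c. (\<lambda>x. c * f x) \<in> S)"

definition ae_banach_space ::
    "'g measure \<Rightarrow> ('g \<Rightarrow> complex) set \<Rightarrow> (('g \<Rightarrow> complex) \<Rightarrow> real) \<Rightarrow> bool" where
  "ae_banach_space M S N \<longleftrightarrow>
     ae_subspace M S \<and>
     (\<forall>f\<in>S. N f \<ge> 0 \<and> (N f = 0 \<longleftrightarrow> (AE x in M. f x = 0))) \<and>
     (\<forall>f\<in>S. \<forall>g\<in>S. N (\<lambda>x. f x + g x) \<le> N f + N g) \<and>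
     (\<forall>f\<in>S. \<forall>c. N (\<lambda>x. c * f x) = norm c * N f) \<and>
     (\<forall>F. (\<forall>n::nat. F n \<in> S) \<and>
          (\<forall>e>0. \<exists>K. \<forall>m\<ge>K. \<forall>n\<ge>K. N (\<lambda>x. F m x - F n x) < e) \<longrightarrow>
          (\<exists>f\<in>S. (\<lambda>n. N (\<lambda>x. F n x - f x)) \<longlonglongrightarrow> 0))"

text \<open>Submultiplicativity and bilinearity imply that the product is well defined on classes.\<close>

definition ae_banach_algebra ::
    "'g measure \<Rightarrow> ('g \<Rightarrow> complex) set \<Rightarrow> (('g \<Rightarrow> complex) \<Rightarrow> real) \<Rightarrow>
     (('g \<Rightarrow> complex) \<Rightarrow> ('g \<Rightarrow> complex) \<Rightarrow> 'g \<Rightarrow> complex) \<Rightarrow> bool" where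
  "ae_banach_algebra M A N m \<longleftrightarrow>
     ae_banach_space M A N \<and>
     (\<forall>f\<in>A. \<forall>g\<in>A. m f g \<in> A \<and> N (m f g) \<le> N f * N g) \<and>
     (\<forall>f\<in>A. \<forall>g\<in>A. \<forall>h\<in>A.
        (AE x in M. m (\<lambda>y. f y + g y) h x = m f h x + m g h x) \<and>
        (AE x in M. m f (\<lambda>y. g y + h y) x = m f g x + m f h x) \<and>
        (AE x in M. m (m f g) h x = m f (m g h) x)) \<and>
     (\<forall>f\<in>A. \<forall>g\<in>A. \<forall>c.
        (AE x in M. m (\<lambda>y. c * f y) g x = c * m f g x) \<and>
        (AE x in M. m f (\<lambda>y. c * g y) x = c * m f g x))"

definition L1 :: "'g measure \<Rightarrow> ('g \<Rightarrow> complex) set" where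
  "L1 M = {f. integrable M f}"

definition L1_norm :: "'g measure \<Rightarrow> ('g \<Rightarrow> complex) \<Rightarrow> real" where
  "L1_norm M f = (\<integral>x. norm (f x) \<partial>M)"

definition dense_wrt ::
    "(('g \<Rightarrow> complex) \<Rightarrow> real) \<Rightarrow> ('g \<Rightarrow> complex) set \<Rightarrow> ('g \<Rightarrow> complex) set \<Rightarrow> bool" where
  "dense_wrt N S A \<longleftrightarrow> S \<subseteq> A \<and> (\<forall>f\<in>A. \<forall>e>0. \<exists>g\<in>S. N (\<lambda>x. f x - g x) < e)"


section \<open>Segal algebras\<close>

definition segal_algebra ::
    "'g::topological_group_add measure \<Rightarrow> ('g \<Rightarrow> complex) set \<Rightarrow>
     (('g \<Rightarrow> complex) \<Rightarrow> real) \<Rightarrow> bool" where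
  "segal_algebra M S N \<longleftrightarrow>
     dense_wrt (L1_norm M) S (L1 M) \<and>
     ae_banach_space M S N \<and> (\<forall>f\<in>S. L1_norm M f \<le> N f) \<and>
     (\<forall>f\<in>S. \<forall>t. left_translate t f \<in> S) \<and>
     (\<forall>f\<in>S. \<forall>t. ((\<lambda>s. N (\<lambda>x. left_translate s f x - left_translate t f x)) \<longlongrightarrow> 0) (nhds t))"

definition symmetric_segal_algebra ::
    "'g::topological_group_add measure \<Rightarrow> ('g \<Rightarrow> complex) set \<Rightarrow>
     (('g \<Rightarrow> complex) \<Rightarrow> real) \<Rightarrow> bool" where
  "symmetric_segal_algebra M S N \<longleftrightarrow>
     segal_algebra M S N \<and>
     (\<forall>f\<in>S. \<forall>t. right_translate t f \<in> S) \<and>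
     (\<forall>f\<in>S. \<forall>t. ((\<lambda>s. N (\<lambda>x. right_translate s f x - right_translate t f x)) \<longlongrightarrow> 0) (nhds t))"

definition abstract_segal_algebra ::
    "'g measure \<Rightarrow> ('g \<Rightarrow> complex) set \<Rightarrow> (('g \<Rightarrow> complex) \<Rightarrow> real) \<Rightarrow>
     (('g \<Rightarrow> complex) \<Rightarrow> ('g \<Rightarrow> complex) \<Rightarrow> 'g \<Rightarrow> complex) \<Rightarrow>
     ('g \<Rightarrow> complex) set \<Rightarrow> (('g \<Rightarrow> complex) \<Rightarrow> real) \<Rightarrow> bool" where
  "abstract_segal_algebra M A NA m B NB \<longleftrightarrow>
     ae_banach_algebra M A NA m \<and> ae_banach_space M B NB \<and>
     dense_wrt NA B A \<and> (\<forall>f\<in>A. \<forall>g\<in>B. m f g \<in> B) \<and>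
     (\<exists>K>0. \<forall>f\<in>B. NA f \<le> K * NB f) \<and>
     (\<exists>C>0. \<forall>f\<in>B. \<forall>g\<in>B. NB (m f g) \<le> C * NA f * NB g)"

end

theory Submission
  imports Defs "HOL-Probability.Probability_Measure"
begin

text \<open>
  If $u = \sum_n f_n * \check g_n$, then a left translate of $u$ is represented by the left translates
  of the $f_n$, a right translate of $u$ by the left translates of the $g_n$, and $h * u$ by the
  $h * f_n$. So invariance, strong continuity and the ideal property reduce to two facts:
  left translation is strongly continuous on $M^\Phi$ and $M^\Psi$, by truncation to bounded functions
  and continuity in $L^1$; and $N_\Phi(h * f) \le N_\Phi(f) \int |h|$, by Jensen's inequality.
  Density in $L^1$ comes from convolving continuous functions with an approximate unit.
\<close>

section \<open>Haar measure on a compact group\<close>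

text \<open>The group need not be metrizable or second countable, and this shapes the measure
  theory. Limits in the group run along neighbourhood filters, so continuity comes from compactness
  (one neighbourhood that is good for all points at once) rather than from sequences. Fubini is
  applied only to functions whose pullback along \<open>(y, x)\<close> to \<open>- y + x\<close> is
  measurable for the product sigma-algebra. Convolving classes also requires null sets to survive
  inversion, which is derived from left invariance, finite mass and regularity. On the Orlicz side,
  finiteness of the modular at every scale lets factors such as 2 and 4 be absorbed into the
  argument of \<open>\<Phi>\<close> and makes the modular of a truncation error tend to 0.
  \<open>A_norm\<close> is a quotient of a projective tensor norm: the triangle inequality and
  completeness both come from merging countably many representations into one, indexed by pairs of
  naturals. The norm dominates the supremum norm, so norm convergence implies uniform convergence,
  and each class is handled through its unique continuous representative.\<close>

locale compact_haar =
  fixes M :: "'g::{topological_group_add, t2_space} measure"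
  assumes compact_UNIV: "compact (UNIV :: 'g set)"
    and haar: "left_haar_measure M"
    and total_mass: "emeasure M UNIV = 1"
begin

lemma sets_M [measurable_cong]: "sets M = sets borel"
  using haar by (simp add: left_haar_measure_def radon_measure_def)

lemma space_M [simp]: "space M = UNIV"
  using sets_eq_imp_space_eq[OF sets_M] by simp

sublocale prob_space M
  by standard (simp add: total_mass)

sublocale MM: pair_prob_space M M ..

lemma prob_UNIV [simp]: "measure M UNIV = 1"
  using prob_space by simp

lemma borel_measurable_M [simp]: "borel_measurable M = borel_measurable borel"
  by (rule measurable_cong_sets[OF sets_M refl])

lemma continuous_imp_measurable:
  fixes f :: "'g \<Rightarrow> 'b::topological_space"
  shows "continuous_on UNIV f \<Longrightarrow> f \<in> borel_measurable M"
  by (simp add: borel_measurable_continuous_onI)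

lemma measurable_translate [measurable]:
  "(\<lambda>x. a + x) \<in> measurable M M" "(\<lambda>x. x + a) \<in> measurable M M" "uminus \<in> measurable M M"
  unfolding measurable_cong_sets[OF sets_M sets_M]
  by (intro borel_measurable_continuous_onI continuous_intros)+

lemma measurable_difference [measurable]: "(\<lambda>y. - y + x) \<in> measurable M M"
  using measurable_compose[OF measurable_translate(3) measurable_translate(2)] by simp

lemma distr_left: "distr M M (\<lambda>x. a + x) = M"
proof (rule measure_eqI)
  fix A assume "A \<in> sets (distr M M (\<lambda>x. a + x))"
  then have A: "A \<in> sets M" by simp
  have "(\<lambda>x. a + x) -` A = (\<lambda>x. - a + x) ` A"
    by (auto simp: image_iff add.assoc[symmetric] intro!: bexI[of _ "a + _"])
  then show "emeasure (distr M M (\<lambda>x. a + x)) A = emeasure M A"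
    using A haar by (simp add: emeasure_distr sets_M left_haar_measure_def)
qed simp

lemma nn_integral_left:
  "f \<in> borel_measurable M \<Longrightarrow> (\<integral>\<^sup>+ x. f (a + x) \<partial>M) = (\<integral>\<^sup>+ x. f x \<partial>M)"
  using nn_integral_distr[OF measurable_translate(1), of f a] unfolding distr_left by simp

lemma integral_left:
  fixes f :: "'g \<Rightarrow> 'b::{banach, second_countable_topology}"
  shows "f \<in> borel_measurable M \<Longrightarrow> (\<integral> x. f (a + x) \<partial>M) = (\<integral> x. f x \<partial>M)"
  using integral_distr[OF measurable_translate(1), of f a] unfolding distr_left by simp

lemma AE_left:
  assumes "AE x in M. P x" shows "AE x in M. P (a + x)"
  using AE_distrD[OF measurable_translate(1), of P a] assms unfolding distr_left by simp

lemma integrable_left: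
  fixes f :: "'g \<Rightarrow> 'b::{banach, second_countable_topology}"
  assumes "integrable M f" shows "integrable M (\<lambda>x. f (a + x))"
  using integrable_distr[OF measurable_translate(1), of a f] assms unfolding distr_left by simp

text \<open>Compactness of the second factor yields one neighbourhood of \<open>t\<close> that
  serves all \<open>z\<close>. In place of a metric or a uniform structure on the group, each later
  estimate writes its quantity as a jointly continuous function of a parameter and a group
  element.\<close>

lemma uniform_continuity:
  fixes F :: "'b::topological_space \<times> 'g \<Rightarrow> 'c::metric_space"
  assumes "continuous_on UNIV F" "e > 0"
  obtains U where "open U" "t \<in> U" "\<And>s z. s \<in> U \<Longrightarrow> dist (F (s, z)) (F (t, z)) \<le> e"
proof -
  have "continuous_on (UNIV \<times> UNIV) F" using assms(1) by simp
  then obtain U where "t \<in> U" "open U" "\<forall>s\<in>U \<inter> UNIV. \<forall>z\<in>UNIV. dist (F (s, z)) (F (t, z)) \<le> e"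
    by (rule continuous_on_prod_compactE[OF _ compact_UNIV UNIV_I assms(2)])
  then show ?thesis by (intro that[of U]) simp_all
qed

lemma continuous_bounded:
  fixes f :: "'g \<Rightarrow> 'b::real_normed_vector"
  assumes "continuous_on UNIV f"
  obtains B where "B > 0" "\<And>x. norm (f x) \<le> B"
proof -
  have "bounded (range f)"
    by (rule compact_imp_bounded[OF compact_continuous_image[OF assms compact_UNIV]])
  then show ?thesis
    using that unfolding bounded_pos by auto
qed

lemma integrable_bounded:
  fixes f :: "'g \<Rightarrow> 'b::{banach, second_countable_topology}"
  assumes "f \<in> borel_measurable M" "\<And>x. norm (f x) \<le> B"
  shows "integrable M f"
  by (rule integrable_const_bound[of _ B]) (use assms in auto)

lemma integrable_indicator [simp]:
  "B \<in> sets M \<Longrightarrow> integrable M (indicator B :: 'g \<Rightarrow> real)"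
  by (intro integrable_bounded[of _ 1]) (auto simp: indicator_def)

lemma continuous_integrable:
  fixes f :: "'g \<Rightarrow> 'b::{banach, second_countable_topology}"
  assumes "continuous_on UNIV f"
  shows "integrable M f"
proof -
  obtain B where "\<And>x. norm (f x) \<le> B" using continuous_bounded[OF assms] by blast
  then show ?thesis by (rule integrable_bounded[OF continuous_imp_measurable[OF assms]])
qed

text \<open>A compact Hausdorff space is normal. These cut-off functions link regularity, which
  speaks of sets, with continuous functions.\<close>

lemma urysohn:
  fixes K U :: "'g set"
  assumes "closed K" "open U" "K \<subseteq> U"
  obtains h :: "'g \<Rightarrow> real" where "continuous_on UNIV h" "\<And>x. h x \<in> {0..1}"
    "\<And>x. x \<in> K \<Longrightarrow> h x = 1" "\<And>x. x \<notin> U \<Longrightarrow> h x = 0"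
proof -
  have Hausdorff: "Hausdorff_space (euclidean :: 'g topology)"
    unfolding Hausdorff_space_def disjnt_def by (metis hausdorff open_openin)
  have "normal_space (euclidean :: 'g topology)"
    by (rule compact_Hausdorff_or_regular_imp_normal_space)
      (simp_all add: compact_space_def compact_UNIV Hausdorff)
  moreover have "closedin euclidean (- U)" "closedin euclidean K" "disjnt (- U) K"
    using assms by (auto simp: closed_closedin[symmetric] disjnt_def)
  ultimately obtain h where h: "continuous_map euclidean (top_of_set {0..1}) h"
    "h ` (- U) \<subseteq> {0::real}" "h ` K \<subseteq> {1}"
    using Urysohn_lemma[of euclidean "- U" K 0 1] by auto
  have "continuous_on UNIV h" "\<And>x. h x \<in> {0..1}"
    using h(1) by (auto simp: continuous_map_in_subtopology Pi_iff image_subset_iff)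
  with h(2,3) show ?thesis
    by (intro that[of h]) auto
qed

section \<open>Regularity and density of the continuous functions in L1\<close>

lemma radon: "radon_measure M"
  using haar by (simp add: left_haar_measure_def)

lemma inner_regular_open:
  assumes "open U" "e > 0"
  obtains K where "closed K" "K \<subseteq> U" "measure M U \<le> measure M K + e"
\<comment> \<open>If \<open>U\<close> is this small, the empty set serves as \<open>K\<close>.
  Otherwise \<open>measure M U - e\<close> is positive and passes to \<open>ennreal\<close>
  unchanged.\<close>
proof (cases "measure M U \<le> e")
  case True
  then show ?thesis by (intro that[of "{}"]) simp_all
next
  case False
  let ?K = "{K. compact K \<and> K \<in> sets borel \<and> K \<subseteq> U}"
  from radon have "\<forall>U. open U \<longrightarrow>
      emeasure M U = (SUP K \<in> {K. compact K \<and> K \<in> sets borel \<and> K \<subseteq> U}. emeasure M K)"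
    unfolding radon_measure_def by (elim conjE)
  then have eq: "emeasure M U = (SUP K \<in> ?K. emeasure M K)"
    using assms(1) by (elim allE impE)
  have "ennreal (measure M U - e) < ennreal (measure M U)"
    using False assms(2) by (subst ennreal_less_iff) simp_all
  then have "ennreal (measure M U - e) < (SUP K \<in> ?K. emeasure M K)"
    unfolding eq[symmetric] unfolding emeasure_eq_measure .
  then obtain K where K: "K \<in> ?K" "ennreal (measure M U - e) < emeasure M K"
    by (subst (asm) less_SUP_iff) (elim bexE)
  have "measure M U - e < measure M K"
    using K(2) False unfolding emeasure_eq_measure by (subst (asm) ennreal_less_iff) simp_all
  with K(1) show ?thesis
    by (intro that[of K] compact_imp_closed) simp_all
qed

lemma outer_regular:
  assumes "A \<in> sets M" "e > 0"
  obtains U where "open U" "A \<subseteq> U" "measure M U \<le> measure M A + e"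
proof -
  from radon have "\<forall>A \<in> sets borel. emeasure M A = (INF U \<in> {U. open U \<and> A \<subseteq> U}. emeasure M U)"
    unfolding radon_measure_def by (elim conjE)
  then have eq: "emeasure M A = (INF U \<in> {U. open U \<and> A \<subseteq> U}. emeasure M U)"
    using assms(1) unfolding sets_M by (rule bspec)
  have "ennreal (measure M A) < ennreal (measure M A + e)"
    using assms(2) by (subst ennreal_less_iff) simp_all
  then have "(INF U \<in> {U. open U \<and> A \<subseteq> U}. emeasure M U) < ennreal (measure M A + e)"
    unfolding eq[symmetric] unfolding emeasure_eq_measure .
  then obtain U where U: "open U" "A \<subseteq> U" "emeasure M U < ennreal (measure M A + e)"
    by (subst (asm) INF_less_iff) auto
  have "measure M U < measure M A + e"
    using U(3) unfolding emeasure_eq_measure by (subst (asm) ennreal_less_iff) simp_all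
  with U show ?thesis
    by (intro that[of U]) simp_all
qed

text \<open>Indicators are approximated by a cut-off function between an inner compact and an outer
  open set; sums and dominated limits then give all integrable functions.\<close>

lemma continuous_dense:
  fixes f :: "'g \<Rightarrow> complex"
  assumes "integrable M f" "e > 0"
  shows "\<exists>g. continuous_on UNIV g \<and> (\<integral>x. norm (f x - g x) \<partial>M) < e"
  using assms
proof (induction arbitrary: e rule: integrable_induct)
  case (base A c)
  \<comment> \<open>The error below is at most \<open>norm c * (2 * d)\<close>, hence at most
    \<open>e / 2\<close>. The summand 1 keeps the denominator positive when
    \<open>c = 0\<close>.\<close>
  define d where "d = e / (4 * (norm c + 1))"
  have "norm c + 1 > 0" by (smt (verit) norm_ge_zero)
  then have d: "d > 0" using base by (simp add: d_def)
  obtain U where U: "open U" "A \<subseteq> U" "measure M U \<le> measure M A + d"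
    using outer_regular[OF base(1) d] .
  obtain K where K: "closed K" "K \<subseteq> U" "measure M U \<le> measure M K + d"
    using inner_regular_open[OF U(1) d] .
  obtain h :: "'g \<Rightarrow> real" where h: "continuous_on UNIV h" "\<And>x. h x \<in> {0..1}"
    "\<And>x. x \<in> K \<Longrightarrow> h x = 1" "\<And>x. x \<notin> U \<Longrightarrow> h x = 0"
    using urysohn[OF K(1) U(1) K(2)] by blast
  have [measurable]: "h \<in> borel_measurable M"
    by (rule continuous_imp_measurable[OF h(1)])
  have [measurable]: "A \<in> sets M" "U \<in> sets M" "K \<in> sets M"
    using base U K by (auto simp: sets_M)
  have "(\<integral>x. norm (indicator A x *\<^sub>R c - h x *\<^sub>R c) \<partial>M)
      \<le> (\<integral>x. norm c * (indicator (U - A) x + indicator (U - K) x) \<partial>M)"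
  proof (rule integral_mono)
    show "integrable M (\<lambda>x. norm (indicator A x *\<^sub>R c - h x *\<^sub>R c))"
    proof (rule integrable_bounded)
      fix x
      have "\<bar>indicator A x - h x\<bar> \<le> 1"
        using h(2)[of x] by (auto simp: indicator_def)
      then show "norm (norm (indicator A x *\<^sub>R c - h x *\<^sub>R c)) \<le> norm c"
        by (simp add: scaleR_diff_left[symmetric] mult_left_le_one_le)
    qed measurable
    fix x
    \<comment> \<open>On \<open>A\<close> the two functions differ only off \<open>K\<close>, that
      is on \<open>U - K\<close>; off \<open>A\<close> they differ only inside \<open>U\<close>,
      that is on \<open>U - A\<close>.\<close>
    have "\<bar>indicator A x - h x\<bar> \<le> indicator (U - A) x + indicator (U - K) x"
      using h(2)[of x] h(3)[of x] h(4)[of x] U(2) K(2) by (auto simp: indicator_def)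
    then show "norm (indicator A x *\<^sub>R c - h x *\<^sub>R c) \<le> norm c * (indicator (U - A) x + indicator (U - K) x)"
      by (simp add: scaleR_diff_left[symmetric] mult.commute[of "norm c"] mult_right_mono)
  qed (intro integrable_mult_right Bochner_Integration.integrable_add integrable_indicator; measurable)
  also have "\<dots> = norm c * (measure M (U - A) + measure M (U - K))"
    by simp
  also have "\<dots> \<le> norm c * (2 * d)"
    using U K by (intro mult_left_mono) (auto simp: finite_measure_Diff)
  also have "\<dots> \<le> (norm c + 1) * (2 * d)"
    using d by (intro mult_right_mono) auto
  also have "\<dots> = e / 2"
    using \<open>norm c + 1 > 0\<close> unfolding d_def by (simp add: divide_simps)
  also have "\<dots> < e" using base by simp
  finally show ?case
    using h(1) by (intro exI[of _ "\<lambda>x. h x *\<^sub>R c"]) (auto intro!: continuous_intros)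
next
  case (add f1 f2)
  obtain g1 where g1: "continuous_on UNIV g1" "(\<integral>x. norm (f1 x - g1 x) \<partial>M) < e / 2"
    using add.IH(1)[of "e/2"] add.prems by auto
  obtain g2 where g2: "continuous_on UNIV g2" "(\<integral>x. norm (f2 x - g2 x) \<partial>M) < e / 2"
    using add.IH(2)[of "e/2"] add.prems by auto
  note [simp] = add.hyps continuous_integrable[OF g1(1)] continuous_integrable[OF g2(1)]
  have "(\<integral>x. norm (f1 x + f2 x - (g1 x + g2 x)) \<partial>M)
      \<le> (\<integral>x. norm (f1 x - g1 x) + norm (f2 x - g2 x) \<partial>M)"
    by (rule integral_mono) (auto intro: norm_diff_triangle_ineq)
  also have "\<dots> < e" using g1 g2 by simp
  finally show ?case
    using g1 g2 by (intro exI[of _ "\<lambda>x. g1 x + g2 x"]) (auto intro!: continuous_intros)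
next
  case (lim f s)
  have "(\<lambda>i. \<integral>x. norm (f x - s i x) \<partial>M) \<longlonglongrightarrow> (\<integral>x. 0 \<partial>M)"
  \<comment> \<open>The induction supplies \<open>norm (s i x) \<le> 2 * norm (f x)\<close>, whence
    the factor 3 in the majorant.\<close>
  proof (rule integral_dominated_convergence[where w="\<lambda>x. 3 * norm (f x)"])
    show "AE x in M. (\<lambda>i. norm (f x - s i x)) \<longlonglongrightarrow> 0"
    proof (rule AE_I2)
      fix x assume "x \<in> space M"
      then show "(\<lambda>i. norm (f x - s i x)) \<longlonglongrightarrow> 0"
        using tendsto_norm[OF tendsto_diff[OF tendsto_const lim.hyps(2)], of x "f x"] by simp
    qed
    show "AE x in M. norm (norm (f x - s i x)) \<le> 3 * norm (f x)" for i
    proof (rule AE_I2)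
      fix x assume "x \<in> space M"
      have "norm (f x - s i x) \<le> norm (f x) + norm (s i x)" by (rule norm_triangle_ineq4)
      also have "\<dots> \<le> 3 * norm (f x)" using lim.hyps(3)[OF \<open>x \<in> space M\<close>, of i] by simp
      finally show "norm (norm (f x - s i x)) \<le> 3 * norm (f x)" by simp
    qed
  qed (use lim.hyps in \<open>auto dest: borel_measurable_integrable\<close>)
  then have "eventually (\<lambda>i. (\<integral>x. norm (f x - s i x) \<partial>M) < e / 2) sequentially"
    using lim.prems by (intro order_tendstoD(2)) auto
  then obtain i where i: "(\<integral>x. norm (f x - s i x) \<partial>M) < e / 2"
    by (auto simp: eventually_sequentially)
  obtain g where g: "continuous_on UNIV g" "(\<integral>x. norm (s i x - g x) \<partial>M) < e / 2"
    using lim.IH[of "e/2" i] lim.prems by auto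
  note [simp] = lim.hyps(1,4) continuous_integrable[OF g(1)]
  have "(\<integral>x. norm (f x - g x) \<partial>M)
      \<le> (\<integral>x. norm (f x - s i x) + norm (s i x - g x) \<partial>M)"
    by (rule integral_mono) (auto intro: norm_triangle_le_diff norm_diff_triangle_le)
  also have "\<dots> < e" using i g by simp
  finally show ?case using g by auto
qed

text \<open>
  The Borel sets of the square need not be generated by rectangles when the group is not second
  countable, so Fubini's theorem does not apply to \<open>f (- y + x)\<close> for an arbitrary Borel function
  \<open>f\<close>. It applies when \<open>f\<close> is a pointwise limit of continuous functions, and every integrable
  function agrees almost everywhere with such a limit.
\<close>

lemma continuous_imp_product_measurable:
  fixes F :: "'g \<times> 'g \<Rightarrow> complex"
  assumes "continuous_on UNIV F"
  shows "F \<in> borel_measurable (M \<Otimes>\<^sub>M M)"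
proof -
  \<comment> \<open>Uniform approximation: the first coordinate is frozen at one of finitely many
    centres, which leaves countably many cases, each measurable in the second coordinate
    alone.\<close>
  have "\<exists>G. G \<in> borel_measurable (M \<Otimes>\<^sub>M M) \<and> (\<forall>p. dist (G p) (F p) \<le> e)" if e: "e > 0" for e
  proof -
    have "\<forall>t. \<exists>U. open U \<and> t \<in> U \<and> (\<forall>s z. s \<in> U \<longrightarrow> dist (F (s, z)) (F (t, z)) \<le> e)"
      using uniform_continuity[OF assms e] by metis
    then obtain U where U: "\<And>t. open (U t)" "\<And>t. t \<in> U t"
      "\<And>t s z. s \<in> U t \<Longrightarrow> dist (F (s, z)) (F (t, z)) \<le> e"
      by metis
    obtain T where T: "finite T" "UNIV \<subseteq> (\<Union>t\<in>T. U t)"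
      using compactE_image[OF compact_UNIV, of UNIV U] U(1,2) by (metis UNIV_I UN_I subsetI)
    define t where "t = from_nat_into T"
    have cover: "\<exists>i. s \<in> U (t i)" for s
      using T from_nat_into_surj[OF countable_finite[OF T(1)]] unfolding t_def by (metis UNIV_I UN_E subsetD)
    \<comment> \<open>Taking the least index makes the choice of a covering set a measurable
      function of \<open>s\<close>. The sequence \<open>t\<close> may repeat points of the finite
      set \<open>T\<close>, which does no harm.\<close>
    define i where "i = (\<lambda>s. LEAST i. s \<in> U (t i))"
    have i: "s \<in> U (t (i s))" for s
      unfolding i_def using cover[of s] by (rule LeastI_ex)
    have [measurable]: "U t \<in> sets M" for t using U(1) by (simp add: sets_M)
    have [measurable]: "i \<in> measurable M (count_space UNIV)"
      unfolding i_def by measurable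
    have [measurable]: "(\<lambda>z. F (s, z)) \<in> borel_measurable M" for s
      by (intro continuous_imp_measurable continuous_on_compose2[OF assms] continuous_intros) auto
    define G where "G = (\<lambda>p. F (t (i (fst p)), snd p))"
    have "G \<in> borel_measurable (M \<Otimes>\<^sub>M M)"
      unfolding G_def by (rule measurable_compose_countable[where f="\<lambda>i p. F (t i, snd p)"]) measurable
    moreover have "dist (G p) (F p) \<le> e" for p
      using U(3)[OF i[of "fst p"], of "snd p"] by (simp add: G_def dist_commute)
    ultimately show ?thesis by blast
  qed
  then have "\<forall>n. \<exists>G. G \<in> borel_measurable (M \<Otimes>\<^sub>M M) \<and> (\<forall>p. dist (G p) (F p) \<le> inverse (real (Suc n)))"
    by simp
  then obtain G where G: "\<And>n. G n \<in> borel_measurable (M \<Otimes>\<^sub>M M)"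
    "\<And>n p. dist (G n p) (F p) \<le> inverse (real (Suc n))"
    by metis
  show ?thesis
  proof (rule borel_measurable_LIMSEQ_metric[OF G(1)])
    fix p
    show "(\<lambda>n. G n p) \<longlonglongrightarrow> F p"
      by (rule metric_tendsto_imp_tendsto[OF LIMSEQ_inverse_real_of_nat])
        (use G(2) in \<open>auto intro!: always_eventually\<close>)
  qed
qed

text \<open>Integrate \<open>h (- y + x)\<close> over both variables. Left invariance in
  \<open>x\<close> gives the integral of \<open>h\<close>; left invariance in \<open>y\<close>,
  after the substitution of \<open>x + y\<close> for \<open>y\<close>, gives the integral of
  \<open>h (- y)\<close>. Each outer integral is then over a constant and has mass 1. This is the
  unimodularity of compact groups; continuity of \<open>h\<close> provides the measurability for
  Fubini.\<close>

lemma integral_uminus_continuous: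
  fixes h :: "'g \<Rightarrow> complex"
  assumes "continuous_on UNIV h"
  shows "(\<integral>y. h (- y) \<partial>M) = (\<integral>y. h y \<partial>M)"
proof -
  have meas [measurable]: "h \<in> borel_measurable M" by (rule continuous_imp_measurable[OF assms])
  have m: "(\<lambda>p. h (- fst p + snd p)) \<in> borel_measurable (M \<Otimes>\<^sub>M M)"
    by (intro continuous_imp_product_measurable continuous_on_compose2[OF assms] continuous_intros) auto
  obtain B where "\<And>x. norm (h x) \<le> B" using continuous_bounded[OF assms] by blast
  then have "integrable (M \<Otimes>\<^sub>M M) (\<lambda>(y, x). h (- y + x))"
    using m by (intro MM.P.integrable_const_bound[of _ B]) (auto simp: case_prod_beta)
  from MM.Fubini_integral[OF this]
  have "(\<integral>x. (\<integral>y. h (- y + x) \<partial>M) \<partial>M) = (\<integral>y. (\<integral>x. h (- y + x) \<partial>M) \<partial>M)" .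
  moreover have "(\<integral>y. h (- y + x) \<partial>M) = (\<integral>y. h (- y) \<partial>M)" for x
    using integral_left[of "\<lambda>w. h (- w + x)" x] by (simp add: minus_add add.assoc)
  moreover have "(\<integral>x. h (- y + x) \<partial>M) = (\<integral>x. h x \<partial>M)" for y
    by (rule integral_left[OF meas])
  ultimately show ?thesis by simp
qed

lemma measure_uminus_open_le:
  assumes "open U"
  shows "measure M U \<le> measure M (uminus ` U)"
proof (rule field_le_epsilon)
  fix e :: real assume "e > 0"
  obtain K where K: "closed K" "K \<subseteq> U" "measure M U \<le> measure M K + e"
    using inner_regular_open[OF assms \<open>e > 0\<close>] .
  obtain h :: "'g \<Rightarrow> real" where h: "continuous_on UNIV h" "\<And>x. h x \<in> {0..1}"
    "\<And>x. x \<in> K \<Longrightarrow> h x = 1" "\<And>x. x \<notin> U \<Longrightarrow> h x = 0"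
    using urysohn[OF K(1) assms K(2)] by blast
  have [measurable]: "U \<in> sets M" "K \<in> sets M" using assms K by (auto simp: sets_M)
  have "uminus ` U = uminus -` U \<inter> space M" by (force simp: image_iff)
  then have mU [measurable]: "uminus ` U \<in> sets M"
    using measurable_sets[OF measurable_translate(3) \<open>U \<in> sets M\<close>] by simp
  have "complex_of_real (\<integral>y. h (- y) \<partial>M) = complex_of_real (\<integral>y. h y \<partial>M)"
    using integral_uminus_continuous[of "\<lambda>x. complex_of_real (h x)"] h(1)
    by (simp add: continuous_on_of_real)
  then have eq: "(\<integral>y. h (- y) \<partial>M) = (\<integral>y. h y \<partial>M)" by simp
  have cont: "continuous_on UNIV (\<lambda>y. h (- y))"
    by (intro continuous_on_compose2[OF h(1)] continuous_intros) auto
  have "measure M K = (\<integral>y. indicator K y \<partial>M)" by simp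
  also have "\<dots> \<le> (\<integral>y. h y \<partial>M)"
    using h(2,3) by (intro integral_mono continuous_integrable[OF h(1)] integrable_indicator) (auto simp: indicator_def)
  also have "\<dots> = (\<integral>y. h (- y) \<partial>M)" by (rule eq[symmetric])
  also have "\<dots> \<le> (\<integral>y. indicator (uminus ` U) y \<partial>M)"
  proof (intro integral_mono continuous_integrable[OF cont])
    fix y show "h (- y) \<le> indicator (uminus ` U) y"
    proof (cases "- y \<in> U")
      case True
      then have "y \<in> uminus ` U" by (force simp: image_iff)
      then show ?thesis using h(2)[of "- y"] by simp
    qed (use h(4) in \<open>simp add: indicator_def\<close>)
  qed simp
  finally show "measure M U \<le> measure M (uminus ` U) + e" using K(3) by simp
qed

text \<open>Outer regularity carries the inequality from open to Borel sets. Inversion is an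
  involution, so applying the inequality to a set and to its inverse gives equality.\<close>

lemma distr_uminus: "distr M M uminus = M"
proof (rule measure_eqI)
  have eq: "uminus -` A = uminus ` A" for A :: "'g set" by (force simp: image_iff)
  have op: "open (uminus ` U)" if "open U" for U :: "'g set"
    unfolding eq[symmetric] by (rule open_vimage[OF that]) (intro continuous_intros)
  have mea: "uminus ` A \<in> sets M" if "A \<in> sets M" for A
    using measurable_sets[OF measurable_translate(3) that] by (simp add: eq)
  have le: "measure M (uminus ` A) \<le> measure M A" if A: "A \<in> sets M" for A
  proof (rule field_le_epsilon)
    fix e :: real assume "e > 0"
    obtain U where U: "open U" "A \<subseteq> U" "measure M U \<le> measure M A + e"
      using outer_regular[OF A \<open>e > 0\<close>] .
    have "measure M (uminus ` A) \<le> measure M (uminus ` U)"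
      using U mea[of U] by (intro finite_measure_mono) (auto simp: sets_M)
    also have "\<dots> \<le> measure M U"
      using measure_uminus_open_le[OF op[OF U(1)]] by (simp add: image_image)
    finally show "measure M (uminus ` A) \<le> measure M A + e" using U(3) by simp
  qed
  fix A assume "A \<in> sets (distr M M uminus)"
  then have A: "A \<in> sets M" by simp
  have "measure M (uminus ` A) = measure M A"
    using le[OF A] le[OF mea[OF A]] by (simp add: image_image)
  then show "emeasure (distr M M uminus) A = emeasure M A"
    using A by (simp add: emeasure_distr eq emeasure_eq_measure)
qed simp

lemma AE_uminus:
  assumes "AE x in M. P x" shows "AE x in M. P (- x)"
  using AE_distrD[OF measurable_translate(3), of P] assms unfolding distr_uminus by simp

text \<open>Right translation is left translation conjugated by inversion.\<close>

lemma AE_right: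
  assumes "AE x in M. P x" shows "AE x in M. P (x + a)"
  using AE_uminus[OF AE_left[OF AE_uminus[OF assms], of "- a"]] by (simp add: minus_add)

text \<open>This makes \<open>conv\<close> independent of the representative of its second factor,
  at every point \<open>x\<close>.\<close>

lemma AE_difference:
  assumes "AE x in M. P x" shows "AE y in M. P (- y + x)"
  using AE_uminus[OF AE_right[OF assms, of x]] by simp

end

section \<open>Convolution on $L^1(G)$\<close>

text \<open>A Cauchy sequence has a subsequence with geometrically decreasing increments. These form
  an absolutely convergent series, so the subsequence converges and takes the whole sequence along.
  The formulation with a bare set \<open>S\<close> and functional \<open>N\<close> serves both L1
  and \<open>A_space\<close>.\<close>

lemma complete_if_absolutely_convergent:
  fixes N :: "('a \<Rightarrow> 'b::ab_group_add) \<Rightarrow> real"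
  assumes add: "\<And>f g. f \<in> S \<Longrightarrow> g \<in> S \<Longrightarrow> (\<lambda>x. f x + g x) \<in> S"
    and diff: "\<And>f g. f \<in> S \<Longrightarrow> g \<in> S \<Longrightarrow> (\<lambda>x. f x - g x) \<in> S"
    and nonneg: "\<And>f. f \<in> S \<Longrightarrow> N f \<ge> 0"
    and triangle: "\<And>f g. f \<in> S \<Longrightarrow> g \<in> S \<Longrightarrow> N (\<lambda>x. f x + g x) \<le> N f + N g"
    and series: "\<And>h. (\<And>k. h k \<in> S) \<Longrightarrow> summable (\<lambda>k. N (h k)) \<Longrightarrow>
      \<exists>s\<in>S. (\<lambda>n. N (\<lambda>x. (\<Sum>k<n. h k x) - s x)) \<longlonglongrightarrow> 0"
    and F: "\<And>n::nat. F n \<in> S"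
    and cauchy: "\<And>e. e > 0 \<Longrightarrow> \<exists>K. \<forall>m\<ge>K. \<forall>n\<ge>K. N (\<lambda>x. F m x - F n x) < e"
  shows "\<exists>f\<in>S. (\<lambda>n. N (\<lambda>x. F n x - f x)) \<longlonglongrightarrow> 0"
proof -
  have "\<forall>k. \<exists>K. \<forall>m\<ge>K. \<forall>n\<ge>K. N (\<lambda>x. F m x - F n x) < (1/2)^k"
    using cauchy by simp
  then obtain K where K: "\<And>k m n. m \<ge> K k \<Longrightarrow> n \<ge> K k \<Longrightarrow> N (\<lambda>x. F m x - F n x) < (1/2)^k"
    by metis
  \<comment> \<open>Summing the thresholds makes the indices monotone while keeping
    \<open>r k \<ge> K k\<close>.\<close>
  define r where "r = (\<lambda>k::nat. \<Sum>i\<le>k. K i)"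
  have rK: "r k \<ge> K k" for k by (simp add: r_def member_le_sum)
  have rSuc: "r (Suc k) \<ge> r k" for k by (simp add: r_def)
  define h where "h = (\<lambda>k x. F (r (Suc k)) x - F (r k) x)"
  have hS: "h k \<in> S" for k unfolding h_def by (intro diff F)
  have "summable (\<lambda>k. N (h k))"
  proof (rule summable_comparison_test')
    show "summable (\<lambda>k. (1/2::real)^k)" by (rule summable_geometric) simp
    show "norm (N (h k)) \<le> (1/2)^k" if "k \<ge> 0" for k
      using K[of k "r (Suc k)" "r k"] rK[of k] rSuc[of k] nonneg[OF hS[of k]] unfolding h_def by simp
  qed
  from series[OF hS this] obtain s where s: "s \<in> S" "(\<lambda>n. N (\<lambda>x. (\<Sum>k<n. h k x) - s x)) \<longlonglongrightarrow> 0"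
    by auto
  define f where "f = (\<lambda>x. F (r 0) x + s x)"
  have fS: "f \<in> S" unfolding f_def by (intro add F s(1))
  have "(\<Sum>k<n. h k x) = F (r n) x - F (r 0) x" for n x
    unfolding h_def by (rule sum_lessThan_telescope)
  then have sub: "(\<lambda>n. N (\<lambda>x. F (r n) x - f x)) \<longlonglongrightarrow> 0"
    using s(2) by (simp add: f_def diff_diff_eq)
  have "(\<lambda>n. N (\<lambda>x. F n x - f x)) \<longlonglongrightarrow> 0"
  proof (rule LIMSEQ_I)
    fix e :: real assume "e > 0"
    then obtain L where L: "\<And>m n. m \<ge> L \<Longrightarrow> n \<ge> L \<Longrightarrow> N (\<lambda>x. F m x - F n x) < e / 2"
      using cauchy[of "e/2"] by auto
    have "eventually (\<lambda>n. N (\<lambda>x. F (r n) x - f x) < e / 2) sequentially"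
      using sub \<open>e > 0\<close> by (intro order_tendstoD(2)) auto
    moreover have "eventually (\<lambda>n. (1/2::real)^n < e / 2) sequentially"
      using order_tendstoD(2)[OF LIMSEQ_realpow_zero[of "1/2"], of "e/2"] \<open>e > 0\<close> by simp
    ultimately have "eventually (\<lambda>n. N (\<lambda>x. F (r n) x - f x) < e / 2 \<and> (1/2::real)^n < e / 2) sequentially"
      by (rule eventually_conj)
    \<comment> \<open>One index is used twice: \<open>F (r k)\<close> is within \<open>e / 2\<close>
      of \<open>f\<close>, and within \<open>(1/2)^k\<close> of every later term.\<close>
    then obtain k where k: "N (\<lambda>x. F (r k) x - f x) < e / 2" "(1/2::real)^k < e / 2"
      unfolding eventually_sequentially by blast
    have "norm (N (\<lambda>x. F n x - f x) - 0) < e" if n: "n \<ge> r k" for n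
    proof -
      have "N (\<lambda>x. F n x - f x) = N (\<lambda>x. (F n x - F (r k) x) + (F (r k) x - f x))" by simp
      also have "\<dots> \<le> N (\<lambda>x. F n x - F (r k) x) + N (\<lambda>x. F (r k) x - f x)"
        by (intro triangle diff F fS)
      also have "\<dots> < e"
        using K[of k n "r k"] rK[of k] n k by simp
      finally show ?thesis using nonneg[OF diff[OF F fS]] by simp
    qed
    then show "\<exists>no. \<forall>n\<ge>no. norm (N (\<lambda>x. F n x - f x) - 0) < e" by blast
  qed
  then show ?thesis using fS by blast
qed

section \<open>Versions measurable on the square, Tonelli and Fubini for convolutions\<close>

context compact_haar
begin

text \<open>What Fubini asks of a convolution kernel. It is a condition on a representative, so
  integrable functions are replaced by suitable versions before integrals are interchanged.\<close>

definition quotient_measurable :: "('g \<Rightarrow> complex) \<Rightarrow> bool" where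
  "quotient_measurable h \<longleftrightarrow> (\<lambda>p. h (- fst p + snd p)) \<in> borel_measurable (M \<Otimes>\<^sub>M M)"

lemma quotient_measurableD:
  assumes "quotient_measurable h" "f \<in> measurable N M" "g \<in> measurable N M"
  shows "(\<lambda>x. h (- f x + g x)) \<in> borel_measurable N"
  using measurable_compose[OF measurable_Pair[OF assms(2,3)] assms(1)[unfolded quotient_measurable_def]]
  by simp

text \<open>Continuous functions converging in L1 have a subsequence converging almost everywhere.
  Its pointwise limit and the pullback of that limit to the square are both limits of continuous
  functions.\<close>

lemma integrable_imp_quotient_measurable_version:
  fixes f :: "'g \<Rightarrow> complex"
  assumes "integrable M f"
  obtains f' where "f' \<in> borel_measurable M" "quotient_measurable f'" "AE x in M. f x = f' x"
proof -
  have "\<forall>n. \<exists>g. continuous_on UNIV g \<and> (\<integral>x. norm (f x - g x) \<partial>M) < inverse (real (Suc n))"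
    using continuous_dense[OF assms] by simp
  then obtain g where g: "\<And>n. continuous_on UNIV (g n)"
    "\<And>n. (\<integral>x. norm (f x - g n x) \<partial>M) < inverse (real (Suc n))"
    by metis
  have "(\<lambda>n. (\<integral>x. norm (f x - g n x) \<partial>M)) \<longlonglongrightarrow> 0"
    by (rule tendsto_sandwich[OF _ _ tendsto_const LIMSEQ_inverse_real_of_nat])
      (use g(2) in \<open>auto intro!: always_eventually less_imp_le\<close>)
  moreover have "integrable M (\<lambda>x. f x - g n x)" for n
    by (intro Bochner_Integration.integrable_diff assms continuous_integrable g)
  ultimately obtain r where r: "AE x in M. (\<lambda>n. f x - g (r n) x) \<longlonglongrightarrow> 0"
    using tendsto_L1_AE_subseq[of M "\<lambda>n x. f x - g n x"] by blast
  \<comment> \<open>\<open>lim\<close> is total and preserves measurability whether or not the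
    sequence converges, so no exceptional null set has to be removed on the square.\<close>
  define f' where "f' = (\<lambda>x. lim (\<lambda>n. g (r n) x))"
  have "AE x in M. f x = f' x"
    using r
  proof eventually_elim
    case (elim x)
    have "(\<lambda>n. f x - (f x - g (r n) x)) \<longlonglongrightarrow> f x - 0"
      by (intro tendsto_diff tendsto_const elim)
    then have "(\<lambda>n. g (r n) x) \<longlonglongrightarrow> f x" by simp
    then show ?case unfolding f'_def by (simp add: limI)
  qed
  moreover have "f' \<in> borel_measurable M"
    unfolding f'_def by (intro borel_measurable_lim_metric continuous_imp_measurable g)
  moreover have "quotient_measurable f'"
    unfolding quotient_measurable_def f'_def
    by (intro borel_measurable_lim_metric continuous_imp_product_measurable
        continuous_on_compose2[OF g(1)] continuous_intros) auto
  ultimately show ?thesis using that by blast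
qed

text \<open>Equality holds at every \<open>x\<close>: for each fixed \<open>x\<close> the integrands
  agree almost everywhere in \<open>y\<close>, in the second factor by
  \<open>AE_difference\<close>.\<close>

lemma conv_cong_AE:
  assumes "f \<in> borel_measurable M" "g \<in> borel_measurable M" "h \<in> borel_measurable M"
    and "AE x in M. g x = h x"
  shows conv_cong_AE_right: "conv M f g = conv M f h"
    and conv_cong_AE_left: "conv M g f = conv M h f"
proof -
  note [measurable] = assms(1-3)
  show "conv M f g = conv M f h"
    unfolding conv_def
  proof (intro ext integral_cong_AE)
    show "AE y in M. f y * g (- y + x) = f y * h (- y + x)" for x
      using AE_difference[OF assms(4), of x] by eventually_elim simp
  qed measurable
  show "conv M g f = conv M h f"
    unfolding conv_def
  proof (intro ext integral_cong_AE)
    show "AE y in M. g y * f (- y + x) = h y * f (- y + x)" for x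
      using assms(4) by eventually_elim simp
  qed measurable
qed

text \<open>After exchanging the integrals for a good version of \<open>h\<close>, left invariance
  removes \<open>y\<close> from the inner one. The function \<open>\<phi>\<close> will be the norm
  for the L1 estimates and a scaled Young function for Jensen's inequality.\<close>

lemma conv_tonelli:
  fixes f :: "'g \<Rightarrow> ennreal" and h :: "'g \<Rightarrow> complex" and \<phi> :: "complex \<Rightarrow> ennreal"
  assumes [measurable]: "f \<in> borel_measurable M" "\<phi> \<in> borel_measurable borel" and h: "integrable M h"
  shows "(\<lambda>x. \<integral>\<^sup>+ y. f y * \<phi> (h (- y + x)) \<partial>M) \<in> borel_measurable M"
    and "(\<integral>\<^sup>+ x. (\<integral>\<^sup>+ y. f y * \<phi> (h (- y + x)) \<partial>M) \<partial>M) = (\<integral>\<^sup>+ y. f y \<partial>M) * (\<integral>\<^sup>+ x. \<phi> (h x) \<partial>M)"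
proof -
  obtain h' where h' [measurable]: "h' \<in> borel_measurable M" and
    q: "quotient_measurable h'" and AE: "AE x in M. h x = h' x"
    using integrable_imp_quotient_measurable_version[OF h] .
  have [measurable]: "h \<in> borel_measurable M" using h by simp
  note [measurable (raw)] = quotient_measurableD[OF q]
  have eq: "(\<integral>\<^sup>+ y. f y * \<phi> (h (- y + x)) \<partial>M) = (\<integral>\<^sup>+ y. f y * \<phi> (h' (- y + x)) \<partial>M)" for x
    by (rule nn_integral_cong_AE) (use AE_difference[OF AE, of x] in auto)
  show "(\<lambda>x. \<integral>\<^sup>+ y. f y * \<phi> (h (- y + x)) \<partial>M) \<in> borel_measurable M"
    unfolding eq by measurable
  have "(\<integral>\<^sup>+ x. (\<integral>\<^sup>+ y. f y * \<phi> (h' (- y + x)) \<partial>M) \<partial>M)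
      = (\<integral>\<^sup>+ y. (\<integral>\<^sup>+ x. f y * \<phi> (h' (- y + x)) \<partial>M) \<partial>M)"
    by (rule MM.Fubini') measurable
  also have "\<dots> = (\<integral>\<^sup>+ y. f y * (\<integral>\<^sup>+ x. \<phi> (h' x) \<partial>M) \<partial>M)"
    by (intro nn_integral_cong) (simp add: nn_integral_cmult nn_integral_left[of "\<lambda>x. \<phi> (h' x)"])
  also have "\<dots> = (\<integral>\<^sup>+ y. f y \<partial>M) * (\<integral>\<^sup>+ x. \<phi> (h' x) \<partial>M)"
    by (rule nn_integral_multc) measurable
  also have "(\<integral>\<^sup>+ x. \<phi> (h' x) \<partial>M) = (\<integral>\<^sup>+ x. \<phi> (h x) \<partial>M)"
    by (rule nn_integral_cong_AE) (use AE in auto)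
  finally show "(\<integral>\<^sup>+ x. (\<integral>\<^sup>+ y. f y * \<phi> (h (- y + x)) \<partial>M) \<partial>M) = (\<integral>\<^sup>+ y. f y \<partial>M) * (\<integral>\<^sup>+ x. \<phi> (h x) \<partial>M)"
    unfolding eq .
qed

lemma conv_norm_tonelli:
  fixes f h :: "'g \<Rightarrow> complex"
  assumes f: "f \<in> borel_measurable M" and h: "integrable M h"
  shows "(\<lambda>x. \<integral>\<^sup>+ y. ennreal (norm (f y * h (- y + x))) \<partial>M) \<in> borel_measurable M"
    and "(\<integral>\<^sup>+ x. (\<integral>\<^sup>+ y. ennreal (norm (f y * h (- y + x))) \<partial>M) \<partial>M)
      = (\<integral>\<^sup>+ y. norm (f y) \<partial>M) * (\<integral>\<^sup>+ x. norm (h x) \<partial>M)"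
  using conv_tonelli[of "\<lambda>y. ennreal (norm (f y))" "\<lambda>z. ennreal (norm z)" h] f h
  by (simp_all add: norm_mult ennreal_mult)

lemma conv_measurable:
  assumes [measurable]: "f \<in> borel_measurable M" and h: "integrable M h"
  shows "conv M f h \<in> borel_measurable M"
proof -
  obtain h' where h' [measurable]: "h' \<in> borel_measurable M" and
    q: "quotient_measurable h'" and AE: "AE x in M. h x = h' x"
    using integrable_imp_quotient_measurable_version[OF h] .
  note [measurable (raw)] = quotient_measurableD[OF q]
  have "conv M f h = conv M f h'"
    using h AE by (intro conv_cong_AE_right) auto
  then show ?thesis unfolding conv_def by simp
qed

lemma AE_conv_integrable:
  fixes f h :: "'g \<Rightarrow> complex"
  assumes f: "integrable M f" and h: "integrable M h"
  shows "AE x in M. integrable M (\<lambda>y. f y * h (- y + x))"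
proof -
  have [measurable]: "f \<in> borel_measurable M" "h \<in> borel_measurable M" using f h by auto
  have "(\<integral>\<^sup>+ x. (\<integral>\<^sup>+ y. ennreal (norm (f y * h (- y + x))) \<partial>M) \<partial>M) \<noteq> \<infinity>"
    using f h by (subst conv_norm_tonelli)
      (simp_all add: nn_integral_eq_integral ennreal_mult[symmetric])
  then have "AE x in M. (\<integral>\<^sup>+ y. ennreal (norm (f y * h (- y + x))) \<partial>M) \<noteq> \<infinity>"
    by (intro nn_integral_PInf_AE conv_norm_tonelli f[THEN borel_measurable_integrable] h)
  then show ?thesis
    by eventually_elim (auto simp: integrable_iff_bounded less_top)
qed

text \<open>Where the integrand fails to be integrable, \<open>conv\<close> takes the default value
  0, so the bound holds at every point.\<close>

lemma conv_norm_le: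
  "ennreal (norm (conv M f h x)) \<le> (\<integral>\<^sup>+ y. ennreal (norm (f y * h (- y + x))) \<partial>M)"
proof (cases "integrable M (\<lambda>y. f y * h (- y + x))")
  case True
  then show ?thesis unfolding conv_def by (rule integral_norm_bound_ennreal)
qed (simp add: conv_def not_integrable_integral_eq)

lemma conv_L1:
  assumes f: "integrable M f" and h: "integrable M h"
  shows conv_integrable: "integrable M (conv M f h)"
    and conv_L1_norm: "L1_norm M (conv M f h) \<le> L1_norm M f * L1_norm M h"
proof -
  have [measurable]: "f \<in> borel_measurable M" "conv M f h \<in> borel_measurable M"
    using f h by (auto intro: conv_measurable simp del: borel_measurable_M)
  have "(\<integral>\<^sup>+ x. ennreal (norm (conv M f h x)) \<partial>M) \<le> (\<integral>\<^sup>+ y. norm (f y) \<partial>M) * (\<integral>\<^sup>+ x. norm (h x) \<partial>M)"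
    unfolding conv_norm_tonelli(2)[OF \<open>f \<in> borel_measurable M\<close> h, symmetric]
    by (intro nn_integral_mono conv_norm_le)
  also have "\<dots> = ennreal (L1_norm M f * L1_norm M h)"
    using f h by (simp add: nn_integral_eq_integral L1_norm_def ennreal_mult)
  finally have le: "(\<integral>\<^sup>+ x. ennreal (norm (conv M f h x)) \<partial>M) \<le> ennreal (L1_norm M f * L1_norm M h)" .
  then show int: "integrable M (conv M f h)"
    by (auto simp: integrable_iff_bounded le_less_trans simp del: borel_measurable_M)
  show "L1_norm M (conv M f h) \<le> L1_norm M f * L1_norm M h"
    using le int by (simp add: nn_integral_eq_integral L1_norm_def)
qed

text \<open>Fubini at a single point \<open>x\<close>, with \<open>fin\<close> as absolute
  integrability of the double integral. The pointwise form serves the almost everywhere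
  associativity of L1 and, at every point, the convolution with an element of
  \<open>A_space\<close>. Only the middle factor depends on both variables, so only it is replaced
  by a version.\<close>

lemma conv_assoc_at:
  assumes f [measurable]: "f \<in> borel_measurable M" and g: "integrable M g"
    and h [measurable]: "h \<in> borel_measurable M"
    and fin: "(\<integral>\<^sup>+ y. ennreal (norm (f y)) * (\<integral>\<^sup>+ z. ennreal (norm (g z * h (- z + (- y + x)))) \<partial>M) \<partial>M) < \<infinity>"
  shows "conv M (conv M f g) h x = conv M f (conv M g h) x"
proof -
  obtain g' where g' [measurable]: "g' \<in> borel_measurable M" and
    q: "quotient_measurable g'" and AE: "AE x in M. g x = g' x"
    using integrable_imp_quotient_measurable_version[OF g] .
  have [measurable]: "g \<in> borel_measurable M" using g by simp
  note [measurable (raw)] = quotient_measurableD[OF q]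
  have c1: "conv M f g = conv M f g'" by (rule conv_cong_AE_right) (use AE in auto)
  have c2: "conv M g h = conv M g' h" by (rule conv_cong_AE_left) (use AE in auto)
  define F where "F = (\<lambda>y w. f y * g' (- y + w) * h (- w + x))"
  \<comment> \<open>The substitution \<open>w = y + z\<close> turns the kernel in \<open>w\<close>
    into that of \<open>conv M g h\<close> at \<open>- y + x\<close>.\<close>
  have shift: "- (y + z) + x = - z + (- y + x)" for y z :: 'g
    by (simp only: minus_add add.assoc)
  have Fshift: "F y (y + z) = f y * (g' z * h (- z + (- y + x)))" for y z
    by (simp only: F_def shift) (simp add: add.assoc[symmetric] mult.assoc)
  have [measurable]: "case_prod F \<in> borel_measurable (M \<Otimes>\<^sub>M M)"
    unfolding F_def by measurable
  have [measurable]: "F y \<in> borel_measurable M" for y unfolding F_def by measurable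
  have "(\<integral>\<^sup>+ w. norm (F y w) \<partial>M)
      = ennreal (norm (f y)) * (\<integral>\<^sup>+ z. ennreal (norm (g z * h (- z + (- y + x)))) \<partial>M)" for y
  proof -
    have "(\<integral>\<^sup>+ w. norm (F y w) \<partial>M) = (\<integral>\<^sup>+ z. norm (F y (y + z)) \<partial>M)"
      by (rule nn_integral_left[symmetric]) measurable
    also have "\<dots> = (\<integral>\<^sup>+ z. ennreal (norm (f y)) * ennreal (norm (g' z * h (- z + (- y + x)))) \<partial>M)"
      by (simp add: Fshift norm_mult ennreal_mult)
    also have "\<dots> = ennreal (norm (f y)) * (\<integral>\<^sup>+ z. ennreal (norm (g' z * h (- z + (- y + x)))) \<partial>M)"
      by (rule nn_integral_cmult) measurable
    also have "(\<integral>\<^sup>+ z. ennreal (norm (g' z * h (- z + (- y + x)))) \<partial>M)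
      = (\<integral>\<^sup>+ z. ennreal (norm (g z * h (- z + (- y + x)))) \<partial>M)"
      by (rule nn_integral_cong_AE) (use AE in auto)
    finally show ?thesis .
  qed
  then have "(\<integral>\<^sup>+ y. (\<integral>\<^sup>+ w. norm (F y w) \<partial>M) \<partial>M) < \<infinity>" using fin by simp
  then have "integrable (M \<Otimes>\<^sub>M M) (case_prod F)"
    unfolding integrable_iff_bounded by (simp add: nn_integral_fst[symmetric])
  from MM.Fubini_integral[OF this]
  have "(\<integral>w. (\<integral>y. F y w \<partial>M) \<partial>M) = (\<integral>y. (\<integral>w. F y w \<partial>M) \<partial>M)" .
  moreover have "(\<integral>y. F y w \<partial>M) = conv M f g' w * h (- w + x)" for w
    by (simp add: F_def conv_def)
  moreover have "(\<integral>w. F y w \<partial>M) = f y * conv M g' h (- y + x)" for y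
  proof -
    have "(\<integral>w. F y w \<partial>M) = (\<integral>z. F y (y + z) \<partial>M)" by (rule integral_left[symmetric]) measurable
    then show ?thesis by (simp add: Fshift conv_def)
  qed
  ultimately show ?thesis unfolding c1 c2 by (subst (1 3) conv_def) simp
qed

lemma conv_assoc_AE:
  assumes f: "integrable M f" and g: "integrable M g" and h: "integrable M h"
  shows "AE x in M. conv M (conv M f g) h x = conv M f (conv M g h) x"
proof -
  have [measurable]: "f \<in> borel_measurable M" "g \<in> borel_measurable M" "h \<in> borel_measurable M"
    using f g h by auto
  \<comment> \<open>The convolution of the absolute values of \<open>g\<close> and \<open>h\<close>.
    The finiteness condition at \<open>x\<close> then says that \<open>f y * k (- y + x)\<close> is
    absolutely integrable, which holds for almost every \<open>x\<close>.\<close>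
  define k where "k = conv M (\<lambda>x. complex_of_real (norm (g x))) (\<lambda>x. complex_of_real (norm (h x)))"
  have k: "integrable M k" unfolding k_def using g h by (intro conv_integrable) auto
  have "AE w in M. (\<integral>\<^sup>+ z. ennreal (norm (g z * h (- z + w))) \<partial>M) = ennreal (norm (k w))"
    using AE_conv_integrable[OF g h]
  proof eventually_elim
    case (elim w)
    have "k w = complex_of_real (\<integral>z. norm (g z * h (- z + w)) \<partial>M)"
      by (simp add: k_def conv_def norm_mult flip: of_real_mult)
    then show ?case
      using elim by (simp add: nn_integral_eq_integral)
  qed
  then have eq: "(\<integral>\<^sup>+ y. ennreal (norm (f y)) * (\<integral>\<^sup>+ z. ennreal (norm (g z * h (- z + (- y + x)))) \<partial>M) \<partial>M)
      = (\<integral>\<^sup>+ y. ennreal (norm (f y * k (- y + x))) \<partial>M)" for x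
  proof (intro nn_integral_cong_AE)
    from AE_difference[OF \<open>AE w in M. _ w\<close>, of x]
    show "AE y in M. ennreal (norm (f y)) * (\<integral>\<^sup>+ z. ennreal (norm (g z * h (- z + (- y + x)))) \<partial>M)
      = ennreal (norm (f y * k (- y + x)))"
      by eventually_elim (simp add: norm_mult ennreal_mult)
  qed
  show ?thesis
    using AE_conv_integrable[OF f k]
  proof eventually_elim
    case (elim x)
    then show ?case
      by (intro conv_assoc_at g) (auto simp: eq integrable_iff_bounded)
  qed
qed

lemma L1_translate_continuous:
  fixes f :: "'g \<Rightarrow> complex"
  assumes f: "integrable M f"
  shows "((\<lambda>s. \<integral>x. norm (f (- s + x) - f (- t + x)) \<partial>M) \<longlongrightarrow> 0) (nhds t)"
proof (rule tendstoI)
  fix e :: real assume "e > 0"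
  obtain g where g: "continuous_on UNIV g" "(\<integral>x. norm (f x - g x) \<partial>M) < e / 3"
    using continuous_dense[OF f, of "e/3"] \<open>e > 0\<close> by auto
  have cont: "continuous_on UNIV (\<lambda>p. g (- fst p + snd p))"
    by (intro continuous_on_compose2[OF g(1)] continuous_intros) auto
  \<comment> \<open>Two approximation errors below \<open>e / 3\<close>, unchanged by translation,
    and a uniform error of at most \<open>e / 4\<close> add up to less than
    \<open>e\<close>.\<close>
  have "e / 4 > 0" using \<open>e > 0\<close> by simp
  from uniform_continuity[OF cont this, of t]
  obtain U where U: "open U" "t \<in> U" "\<And>s z. s \<in> U \<Longrightarrow> norm (g (- s + z) - g (- t + z)) \<le> e / 4"
    unfolding dist_norm fst_conv snd_conv by metis
  have fg: "integrable M (\<lambda>x. norm (f x - g x))"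
    using f continuous_integrable[OF g(1)] by simp
  have "(\<integral>x. norm (f (- s + x) - f (- t + x)) \<partial>M) < e" if "s \<in> U" for s
  proof -
    note i = integrable_left[OF fg, of "- s"] integrable_left[OF fg, of "- t"]
      integrable_left[OF f] integrable_left[OF continuous_integrable[OF g(1)]]
    have "(\<integral>x. norm (f (- s + x) - f (- t + x)) \<partial>M)
        \<le> (\<integral>x. norm (f (- s + x) - g (- s + x)) + e / 4 + norm (f (- t + x) - g (- t + x)) \<partial>M)"
    proof (rule integral_mono)
      fix x
      have "f (- s + x) - f (- t + x) = (f (- s + x) - g (- s + x)) + (g (- s + x) - g (- t + x))
          - (f (- t + x) - g (- t + x))" by simp
      also have "norm \<dots> \<le> norm (f (- s + x) - g (- s + x)) + norm (g (- s + x) - g (- t + x))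
          + norm (f (- t + x) - g (- t + x))"
        by (intro order_trans[OF norm_triangle_ineq4] add_right_mono norm_triangle_ineq)
      finally show "norm (f (- s + x) - f (- t + x))
          \<le> norm (f (- s + x) - g (- s + x)) + e / 4 + norm (f (- t + x) - g (- t + x))"
        using U(3)[OF that, of x] by simp
    qed (use i in auto)
    also have "\<dots> = (\<integral>x. norm (f (- s + x) - g (- s + x)) \<partial>M) + e / 4
        + (\<integral>x. norm (f (- t + x) - g (- t + x)) \<partial>M)"
      using i by simp
    also have "\<dots> = (\<integral>x. norm (f x - g x) \<partial>M) + e / 4 + (\<integral>x. norm (f x - g x) \<partial>M)"
      using fg by (simp add: integral_left[of "\<lambda>x. norm (f x - g x)"])
    also have "\<dots> < e" using g(2) \<open>e > 0\<close> by simp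
    finally show ?thesis .
  qed
  then show "eventually (\<lambda>s. dist (\<integral>x. norm (f (- s + x) - f (- t + x)) \<partial>M) 0 < e) (nhds t)"
    unfolding eventually_nhds using U(1,2) by (auto intro!: exI[of _ U])
qed

text \<open>Riesz-Fischer: the series of norms has a finite integral, hence converges almost
  everywhere, and its sum dominates every remainder.\<close>

lemma L1_series_converges:
  assumes h: "\<And>k::nat. h k \<in> L1 M" and sum: "summable (\<lambda>k. L1_norm M (h k))"
  shows "\<exists>s\<in>L1 M. (\<lambda>n. L1_norm M (\<lambda>x. (\<Sum>k<n. h k x) - s x)) \<longlonglongrightarrow> 0"
proof -
  have int [simp]: "integrable M (h k)" for k using h by (simp add: L1_def)
  then have [measurable]: "h k \<in> borel_measurable M" for k by (rule borel_measurable_integrable)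
  have "(\<integral>\<^sup>+ x. (\<Sum>k. ennreal (norm (h k x))) \<partial>M) = (\<Sum>k. \<integral>\<^sup>+ x. ennreal (norm (h k x)) \<partial>M)"
    by (rule nn_integral_suminf) measurable
  also have "\<dots> = (\<Sum>k. ennreal (L1_norm M (h k)))"
    by (simp add: nn_integral_eq_integral L1_norm_def)
  also have "\<dots> \<noteq> \<infinity>"
    unfolding infinity_ennreal_def by (rule ennreal_suminf_neq_top[OF sum]) (simp add: L1_norm_def)
  finally have "AE x in M. (\<Sum>k. ennreal (norm (h k x))) \<noteq> \<infinity>"
    by (intro nn_integral_PInf_AE) measurable
  then have AE: "AE x in M. summable (\<lambda>k. norm (h k x))"
    by eventually_elim (auto intro: summable_suminf_not_top)
  note * = int AE sum[unfolded L1_norm_def]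
  have s: "integrable M (\<lambda>x. \<Sum>k. h k x)" by (rule integrable_suminf[OF *])
  have w: "integrable M (\<lambda>x. \<Sum>k. norm (h k x))"
    by (rule integrable_suminf) (use * in auto)
  have "(\<lambda>n. \<integral>x. norm ((\<Sum>k<n. h k x) - (\<Sum>k. h k x)) \<partial>M) \<longlonglongrightarrow> (\<integral>x. 0 \<partial>M)"
  proof (rule integral_dominated_convergence[OF _ _ w])
    show "AE x in M. (\<lambda>n. norm ((\<Sum>k<n. h k x) - (\<Sum>k. h k x))) \<longlonglongrightarrow> 0"
      using AE
    proof eventually_elim
      case (elim x)
      have "(\<lambda>n. norm ((\<Sum>k<n. h k x) - (\<Sum>k. h k x))) \<longlonglongrightarrow> norm ((\<Sum>k. h k x) - (\<Sum>k. h k x))"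
        by (intro tendsto_intros summable_LIMSEQ summable_norm_cancel[OF elim])
      then show ?case by simp
    qed
    show "AE x in M. norm (norm ((\<Sum>k<n. h k x) - (\<Sum>k. h k x))) \<le> (\<Sum>k. norm (h k x))" for n
      using AE
    proof eventually_elim
      case (elim x)
      have "(\<Sum>k. h k x) - (\<Sum>k<n. h k x) = (\<Sum>k. h (k + n) x)"
        by (rule suminf_minus_initial_segment[symmetric]) (rule summable_norm_cancel[OF elim])
      then have "norm ((\<Sum>k<n. h k x) - (\<Sum>k. h k x)) = norm (\<Sum>k. h (k + n) x)"
        by (metis norm_minus_commute)
      also have "\<dots> \<le> (\<Sum>k. norm (h (k + n) x))"
        by (rule summable_norm) (rule summable_ignore_initial_segment[OF elim])
      also have "\<dots> = (\<Sum>k. norm (h k x)) - (\<Sum>k<n. norm (h k x))"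
        by (rule suminf_minus_initial_segment[OF elim])
      also have "\<dots> \<le> (\<Sum>k. norm (h k x))" by (simp add: sum_nonneg)
      finally show ?case by simp
    qed
  qed (use s in auto)
  then show ?thesis
    using s by (auto simp: L1_def L1_norm_def intro!: bexI[of _ "\<lambda>x. \<Sum>k. h k x"])
qed

lemma L1_banach_space: "ae_banach_space M (L1 M) (L1_norm M)"
proof -
  have tri: "L1_norm M (\<lambda>x. f x + g x) \<le> L1_norm M f + L1_norm M g" if "f \<in> L1 M" "g \<in> L1 M" for f g
  proof -
    have "L1_norm M (\<lambda>x. f x + g x) \<le> (\<integral>x. norm (f x) + norm (g x) \<partial>M)"
      unfolding L1_norm_def using that by (intro integral_mono norm_triangle_ineq) (auto simp: L1_def)
    then show ?thesis using that by (simp add: L1_def L1_norm_def)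
  qed
  have "ae_subspace M (L1 M)"
    unfolding ae_subspace_def L1_def
    by (auto intro: integrable_cong_AE_imp borel_measurable_integrable simp del: borel_measurable_M)
  moreover have "L1_norm M f = 0 \<longleftrightarrow> (AE x in M. f x = 0)" if "f \<in> L1 M" for f
    using that by (simp add: L1_norm_def L1_def integral_nonneg_eq_0_iff_AE)
  moreover have "\<exists>f\<in>L1 M. (\<lambda>n. L1_norm M (\<lambda>x. F n x - f x)) \<longlonglongrightarrow> 0"
    if "\<And>n. F n \<in> L1 M" "\<And>e. e > 0 \<Longrightarrow> \<exists>K. \<forall>m\<ge>K. \<forall>n\<ge>K. L1_norm M (\<lambda>x. F m x - F n x) < e" for F
    by (rule complete_if_absolutely_convergent[of "L1 M" "L1_norm M" F, OF _ _ _ tri L1_series_converges])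
      (use that in \<open>auto simp: L1_def L1_norm_def\<close>)
  ultimately show ?thesis
    unfolding ae_banach_space_def using tri by (auto simp: L1_norm_def norm_mult)
qed

text \<open>Additivity is an almost everywhere statement, valid where both kernels are integrable.
  Homogeneity holds everywhere, since the default value 0 of an integral respects scalar
  factors.\<close>

lemma L1_banach_algebra: "ae_banach_algebra M (L1 M) (L1_norm M) (conv M)"
proof -
  have "AE x in M. conv M (\<lambda>y. f y + g y) h x = conv M f h x + conv M g h x"
    "AE x in M. conv M f (\<lambda>y. g y + h y) x = conv M f g x + conv M f h x"
    if "integrable M f" "integrable M g" "integrable M h" for f g h
  proof -
    show "AE x in M. conv M (\<lambda>y. f y + g y) h x = conv M f h x + conv M g h x"
      using AE_conv_integrable[OF that(1,3)] AE_conv_integrable[OF that(2,3)]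
      by eventually_elim (simp add: conv_def distrib_right)
    show "AE x in M. conv M f (\<lambda>y. g y + h y) x = conv M f g x + conv M f h x"
      using AE_conv_integrable[OF that(1,2)] AE_conv_integrable[OF that(1,3)]
      by eventually_elim (simp add: conv_def distrib_left)
  qed
  moreover have "conv M (\<lambda>y. c * f y) g x = c * conv M f g x"
    "conv M f (\<lambda>y. c * g y) x = c * conv M f g x" for c f g x
    by (simp_all add: conv_def mult.assoc mult.left_commute[of _ c])
  ultimately show ?thesis
    unfolding ae_banach_algebra_def
    using L1_banach_space conv_integrable conv_L1_norm conv_assoc_AE by (auto simp: L1_def)
qed

end

section \<open>Young functions and the modular\<close>

text \<open>What \<open>\<Phi>\<close> and \<open>complementary \<Phi>\<close> have in common; facts
  on the modular are proved once and applied to both.\<close>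

definition young_function :: "(real \<Rightarrow> real) \<Rightarrow> bool" where
  "young_function \<Phi> \<longleftrightarrow> convex_on UNIV \<Phi> \<and> (\<forall>x. \<Phi> x \<ge> 0) \<and> \<Phi> 0 = 0"

lemma N_function_imp_young: "N_function \<Phi> \<Longrightarrow> young_function \<Phi>"
  by (simp add: N_function_def young_function_def)

lemma young_function_nonneg: "young_function \<Phi> \<Longrightarrow> \<Phi> x \<ge> 0"
  and young_function_zero: "young_function \<Phi> \<Longrightarrow> \<Phi> 0 = 0"
  by (simp_all add: young_function_def)

lemma young_function_scale:
  assumes "young_function \<Phi>" "0 \<le> t" "t \<le> 1"
  shows "\<Phi> (t * x) \<le> t * \<Phi> x"
proof -
  have "convex_on UNIV \<Phi>" using assms(1) by (simp add: young_function_def)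
  from convex_onD[OF this assms(2,3), of 0 x] show ?thesis
    using young_function_zero[OF assms(1)] by simp
qed

lemma young_function_mono:
  assumes "young_function \<Phi>" "0 \<le> x" "x \<le> y"
  shows "\<Phi> x \<le> \<Phi> y"
proof (cases "y = 0")
  case False
  with assms have "y > 0" by simp
  have "\<Phi> ((x / y) * y) \<le> (x / y) * \<Phi> y"
    using assms \<open>y > 0\<close> by (intro young_function_scale[OF assms(1)]) auto
  also have "\<dots> \<le> 1 * \<Phi> y"
    using assms \<open>y > 0\<close> young_function_nonneg[OF assms(1)] by (intro mult_right_mono) auto
  finally show ?thesis using \<open>y > 0\<close> by simp
qed (use assms in simp)

text \<open>\<open>norm z\<close> is at most twice the larger of the two norms. The factor 2 stays
  inside \<open>\<Phi>\<close>, which costs nothing on \<open>M_space\<close>, where the modular is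
  finite at every scale.\<close>

lemma young_function_sum_le:
  assumes "young_function \<Phi>" "a \<ge> 0" "norm z \<le> norm x + norm y"
  shows "\<Phi> (a * norm z) \<le> \<Phi> (2 * a * norm x) + \<Phi> (2 * a * norm y)"
proof (cases "norm x \<le> norm y")
  case True
  then have "norm z \<le> 2 * norm y" using assms(3) by linarith
  from mult_left_mono[OF this assms(2)] have "a * norm z \<le> 2 * a * norm y" by (simp add: mult_ac)
  then have "\<Phi> (a * norm z) \<le> \<Phi> (2 * a * norm y)"
    by (intro young_function_mono[OF assms(1)]) (simp_all add: assms(2))
  then show ?thesis using young_function_nonneg[OF assms(1), of "2 * a * norm x"] by linarith
next
  case False
  then have "norm z \<le> 2 * norm x" using assms(3) by linarith
  from mult_left_mono[OF this assms(2)] have "a * norm z \<le> 2 * a * norm x" by (simp add: mult_ac)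
  then have "\<Phi> (a * norm z) \<le> \<Phi> (2 * a * norm x)"
    by (intro young_function_mono[OF assms(1)]) (simp_all add: assms(2))
  then show ?thesis using young_function_nonneg[OF assms(1), of "2 * a * norm y"] by linarith
qed

lemma young_function_measurable:
  assumes "young_function \<Phi>" shows "\<Phi> \<in> borel_measurable borel"
  using assms convex_on_continuous[of UNIV \<Phi>]
  by (auto simp: young_function_def intro: borel_measurable_continuous_onI)

text \<open>Superlinear growth of \<open>\<Phi>\<close> makes the terms nonpositive from some
  \<open>X\<close> on; before \<open>X\<close> they are at most \<open>X * \<bar>y\<bar>\<close>.
  This makes the real \<open>SUP\<close> in \<open>complementary\<close> meaningful.\<close>

lemma complementary_bdd_above:
  assumes "N_function \<Phi>"
  shows "bdd_above ((\<lambda>x. x * \<bar>y\<bar> - \<Phi> x) ` {0..})"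
proof -
  have "eventually (\<lambda>x. \<bar>y\<bar> \<le> \<Phi> x / x) at_top"
    using assms unfolding N_function_def filterlim_at_top by blast
  then have "eventually (\<lambda>x. \<bar>y\<bar> \<le> \<Phi> x / x \<and> x > 0) at_top"
    by (intro eventually_conj eventually_gt_at_top)
  then obtain X where X: "\<And>x. x \<ge> X \<Longrightarrow> \<bar>y\<bar> \<le> \<Phi> x / x \<and> x > 0"
    unfolding eventually_at_top_linorder by blast
  have "X > 0" using X[of X] by simp
  show ?thesis
  proof (rule bdd_aboveI2)
    fix x :: real assume "x \<in> {0..}"
    have nn: "\<Phi> x \<ge> 0" using assms by (simp add: N_function_def)
    show "x * \<bar>y\<bar> - \<Phi> x \<le> X * \<bar>y\<bar>"
    proof (cases "x \<ge> X")
      case True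
      then have "x * \<bar>y\<bar> \<le> \<Phi> x" using X[OF True] by (auto simp: pos_le_divide_eq mult.commute)
      moreover have "X * \<bar>y\<bar> \<ge> 0" using \<open>X > 0\<close> by simp
      ultimately show ?thesis by linarith
    next
      case False
      then have "x * \<bar>y\<bar> \<le> X * \<bar>y\<bar>" by (intro mult_right_mono) auto
      then show ?thesis using nn by linarith
    qed
  qed
qed

lemma young_inequality:
  assumes "N_function \<Phi>" "x \<ge> 0"
  shows "x * \<bar>y\<bar> \<le> \<Phi> x + complementary \<Phi> y"
  using cSUP_upper[OF _ complementary_bdd_above[OF assms(1), of y], of x] assms(2)
  by (simp add: complementary_def)

text \<open>A supremum of functions convex in \<open>y\<close> is convex. The term
  \<open>x = 0\<close> gives nonnegativity, and at \<open>y = 0\<close> no term is positive.\<close>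

lemma young_function_complementary:
  assumes "N_function \<Phi>"
  shows "young_function (complementary \<Phi>)"
  unfolding young_function_def
proof (intro conjI allI)
  have nn: "\<Phi> x \<ge> 0" and zero: "\<Phi> 0 = 0" for x using assms by (simp_all add: N_function_def)
  show ge: "complementary \<Phi> y \<ge> 0" for y
    using young_inequality[OF assms, of 0 y] zero by simp
  have "complementary \<Phi> 0 \<le> 0"
    unfolding complementary_def by (rule cSUP_least) (use nn in auto)
  with ge[of 0] show "complementary \<Phi> 0 = 0" by simp
  show "convex_on UNIV (complementary \<Phi>)"
  proof (rule convex_onI)
    fix t y z :: real assume t: "0 < t" "t < 1"
    show "complementary \<Phi> ((1 - t) *\<^sub>R y + t *\<^sub>R z) \<le> (1 - t) * complementary \<Phi> y + t * complementary \<Phi> z"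
      unfolding complementary_def[of _ "(1 - t) *\<^sub>R y + t *\<^sub>R z"]
    proof (rule cSUP_least)
      fix x :: real assume "x \<in> {0..}"
      then have x: "x \<ge> 0" by simp
      have "\<bar>(1 - t) * y + t * z\<bar> \<le> (1 - t) * \<bar>y\<bar> + t * \<bar>z\<bar>"
        using t by (intro order_trans[OF abs_triangle_ineq]) (simp add: abs_mult)
      then have "x * \<bar>(1 - t) * y + t * z\<bar> \<le> x * ((1 - t) * \<bar>y\<bar> + t * \<bar>z\<bar>)"
        using x by (rule mult_left_mono)
      also have "\<dots> - \<Phi> x = (1 - t) * (x * \<bar>y\<bar> - \<Phi> x) + t * (x * \<bar>z\<bar> - \<Phi> x)"
        by (simp add: algebra_simps)
      also have "\<dots> \<le> (1 - t) * complementary \<Phi> y + t * complementary \<Phi> z"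
        using young_inequality[OF assms x, of y] young_inequality[OF assms x, of z] t
        by (intro add_mono mult_left_mono) auto
      finally show "x * \<bar>(1 - t) *\<^sub>R y + t *\<^sub>R z\<bar> - \<Phi> x
          \<le> (1 - t) * complementary \<Phi> y + t * complementary \<Phi> z" by simp
    qed simp
  qed simp
qed

section \<open>The modular: bounded functions, translations and convolutions\<close>

context compact_haar
begin

text \<open>Keeping the scale as a separate real parameter turns rescaling a function into
  arithmetic on \<open>a\<close>; the Luxemburg condition for \<open>k\<close> is the case
  \<open>a = 1 / k\<close>.\<close>

definition scaled_modular :: "(real \<Rightarrow> real) \<Rightarrow> real \<Rightarrow> ('g \<Rightarrow> complex) \<Rightarrow> ennreal" where
  "scaled_modular \<Phi> a f = (\<integral>\<^sup>+ x. ennreal (\<Phi> (a * norm (f x))) \<partial>M)"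

lemma modular_eq_scaled:
  "a \<ge> 0 \<Longrightarrow> modular \<Phi> M (\<lambda>x. of_real a * f x) = scaled_modular \<Phi> a f"
  "k > 0 \<Longrightarrow> modular \<Phi> M (\<lambda>x. f x / of_real k) = scaled_modular \<Phi> (1 / k) f"
  by (simp_all add: modular_def scaled_modular_def norm_mult norm_divide)

lemma M_space_iff:
  "f \<in> M_space \<Phi> M \<longleftrightarrow> f \<in> borel_measurable M \<and> (\<forall>a>0. scaled_modular \<Phi> a f < \<infinity>)"
  by (auto simp: M_space_def modular_eq_scaled simp del: borel_measurable_M)

lemma M_space_measurable: "f \<in> M_space \<Phi> M \<Longrightarrow> f \<in> borel_measurable M"
  by (simp add: M_space_def)

context
  fixes \<Phi> :: "real \<Rightarrow> real"
  assumes young: "young_function \<Phi>"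
begin

lemma measurable_young_norm [measurable (raw)]:
  fixes f :: "'b \<Rightarrow> complex"
  shows "f \<in> borel_measurable N \<Longrightarrow> (\<lambda>x. \<Phi> (a * norm (f x))) \<in> borel_measurable N"
  by (rule measurable_compose[OF _ young_function_measurable[OF young]]) measurable

lemma scaled_modular_sum_le:
  assumes [measurable]: "f \<in> borel_measurable M" "g \<in> borel_measurable M"
    and "a \<ge> 0" and "\<And>x. norm (h x) \<le> norm (f x) + norm (g x)"
  shows "scaled_modular \<Phi> a h \<le> scaled_modular \<Phi> (2 * a) f + scaled_modular \<Phi> (2 * a) g"
proof -
  have "scaled_modular \<Phi> a h
      \<le> (\<integral>\<^sup>+ x. ennreal (\<Phi> (2 * a * norm (f x))) + ennreal (\<Phi> (2 * a * norm (g x))) \<partial>M)"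
    unfolding scaled_modular_def
    by (intro nn_integral_mono)
      (use young_function_sum_le[OF young assms(3,4)] young_function_nonneg[OF young] in
        \<open>simp flip: ennreal_plus\<close>)
  also have "\<dots> = scaled_modular \<Phi> (2 * a) f + scaled_modular \<Phi> (2 * a) g"
    unfolding scaled_modular_def by (rule nn_integral_add) measurable
  finally show ?thesis .
qed

lemma scaled_modular_scale:
  assumes [measurable]: "f \<in> borel_measurable M" and "0 \<le> t" "t \<le> 1"
  shows "scaled_modular \<Phi> (t * a) f \<le> ennreal t * scaled_modular \<Phi> a f"
proof -
  have "scaled_modular \<Phi> (t * a) f \<le> (\<integral>\<^sup>+ x. ennreal t * ennreal (\<Phi> (a * norm (f x))) \<partial>M)"
    unfolding scaled_modular_def
    by (intro nn_integral_mono)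
      (use young_function_scale[OF young assms(2,3)] assms(2) young_function_nonneg[OF young] in
        \<open>simp add: mult.assoc flip: ennreal_mult\<close>)
  also have "\<dots> = ennreal t * scaled_modular \<Phi> a f"
    unfolding scaled_modular_def by (rule nn_integral_cmult) measurable
  finally show ?thesis .
qed

lemma scaled_modular_mono:
  assumes "0 \<le> a" "a \<le> b"
  shows "scaled_modular \<Phi> a f \<le> scaled_modular \<Phi> b f"
  unfolding scaled_modular_def
  by (intro nn_integral_mono ennreal_leI young_function_mono[OF young] mult_right_mono) (use assms in auto)

lemma scaled_modular_translate:
  assumes [measurable]: "f \<in> borel_measurable M"
  shows "scaled_modular \<Phi> a (\<lambda>x. f (t + x)) = scaled_modular \<Phi> a f"
  unfolding scaled_modular_def
  by (rule nn_integral_left[of "\<lambda>x. ennreal (\<Phi> (a * norm (f x)))"]) measurable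

text \<open>The integrand is bounded and the total mass is 1. This puts continuous functions and
  normalized indicators into both Orlicz classes.\<close>

lemma M_space_bounded:
  assumes "f \<in> borel_measurable M" "\<And>x. norm (f x) \<le> B"
  shows "f \<in> M_space \<Phi> M"
  unfolding M_space_iff
proof (intro conjI allI impI)
  fix a :: real assume "a > 0"
  have "scaled_modular \<Phi> a f \<le> (\<integral>\<^sup>+ x. ennreal (\<Phi> (a * B)) \<partial>M)"
    unfolding scaled_modular_def
    by (intro nn_integral_mono ennreal_leI young_function_mono[OF young] mult_left_mono)
      (use assms(2) \<open>a > 0\<close> in auto)
  also have "\<dots> < \<infinity>" by (simp add: total_mass)
  finally show "scaled_modular \<Phi> a f < \<infinity>" .
qed fact

lemma M_space_diff:
  assumes "f \<in> M_space \<Phi> M" "g \<in> M_space \<Phi> M"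
  shows "(\<lambda>x. f x - g x) \<in> M_space \<Phi> M"
  unfolding M_space_iff
proof (intro conjI allI impI)
  show "(\<lambda>x. f x - g x) \<in> borel_measurable M"
    using assms[THEN M_space_measurable] by measurable
  fix a :: real assume "a > 0"
  have "scaled_modular \<Phi> a (\<lambda>x. f x - g x) \<le> scaled_modular \<Phi> (2 * a) f + scaled_modular \<Phi> (2 * a) g"
    using \<open>a > 0\<close> by (intro scaled_modular_sum_le assms[THEN M_space_measurable] norm_triangle_ineq4) auto
  also have "\<dots> < \<infinity>" using assms \<open>a > 0\<close> by (simp add: M_space_iff)
  finally show "scaled_modular \<Phi> a (\<lambda>x. f x - g x) < \<infinity>" .
qed

lemma M_space_cmult:
  assumes "f \<in> M_space \<Phi> M"
  shows "(\<lambda>x. c * f x) \<in> M_space \<Phi> M"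
proof (cases "c = 0")
  case True
  then show ?thesis by (intro M_space_bounded[of _ 0]) auto
next
  case False
  have "scaled_modular \<Phi> a (\<lambda>x. c * f x) = scaled_modular \<Phi> (a * norm c) f" for a
    by (simp add: scaled_modular_def norm_mult mult.assoc)
  then show ?thesis using assms False by (auto simp: M_space_iff)
qed

lemma M_space_translate:
  assumes "f \<in> M_space \<Phi> M"
  shows "(\<lambda>x. f (t + x)) \<in> M_space \<Phi> M"
proof -
  have [measurable]: "f \<in> borel_measurable M" using M_space_measurable[OF assms] .
  have "(\<lambda>x. f (t + x)) \<in> borel_measurable M" by measurable
  then show ?thesis using assms scaled_modular_translate[OF M_space_measurable[OF assms]] by (simp add: M_space_iff)
qed

text \<open>Split \<open>f\<close> into a bounded part \<open>g\<close> and a tail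
  \<open>r n\<close>. The tail has small modular at an enlarged scale by dominated convergence,
  which relies on \<open>f\<close> having finite modular at that scale. For the bounded part,
  convexity bounds the modular linearly by the L1 norm, and translation is continuous in L1.\<close>

lemma scaled_modular_translate_continuous:
  assumes f: "f \<in> M_space \<Phi> M" and a: "a > 0"
  shows "((\<lambda>s. scaled_modular \<Phi> a (\<lambda>x. f (- s + x) - f (- t + x))) \<longlongrightarrow> 0) (nhds t)"
proof (rule order_tendstoI)
  fix b :: ennreal assume "0 < b"
  \<comment> \<open>A real number below \<open>b\<close>, which may be infinite.\<close>
  then obtain e where e: "e > 0" "ennreal e < b"
    by (metis dense ennreal_cases ennreal_less_zero_iff not_less_iff_gr_or_eq top_greatest leD)
  have fm [measurable]: "f \<in> borel_measurable M" using M_space_measurable[OF f] .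
  \<comment> \<open>The part of \<open>f\<close> where it is large, so that
    \<open>f x - r n x\<close> is the truncation.\<close>
  define r where "r = (\<lambda>(n::nat) x. if norm (f x) \<le> real n then 0 else f x)"
  have rm [measurable]: "r n \<in> borel_measurable M" for n unfolding r_def by measurable
  \<comment> \<open>The scale is \<open>4 * a\<close> because two splittings follow, each of which
    doubles it: \<open>f\<close> into \<open>g\<close> and tail, and then the difference of the two
    translated tails.\<close>
  have "(\<lambda>n. \<integral>\<^sup>+ x. ennreal (\<Phi> (4 * a * norm (r n x))) \<partial>M) \<longlonglongrightarrow> (\<integral>\<^sup>+ x. 0 \<partial>M)"
  proof (rule nn_integral_dominated_convergence)
    show "(\<integral>\<^sup>+ x. ennreal (\<Phi> (4 * a * norm (f x))) \<partial>M) < \<infinity>"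
      using f a by (simp add: M_space_iff scaled_modular_def)
    show "AE x in M. ennreal (\<Phi> (4 * a * norm (r n x))) \<le> ennreal (\<Phi> (4 * a * norm (f x)))" for n
      using young_function_nonneg[OF young] young_function_zero[OF young] by (auto simp: r_def)
    show "AE x in M. (\<lambda>n. ennreal (\<Phi> (4 * a * norm (r n x)))) \<longlonglongrightarrow> 0"
    proof (rule AE_I2)
      fix x
      obtain N where N: "norm (f x) \<le> real N" using real_arch_simple by blast
      show "(\<lambda>n. ennreal (\<Phi> (4 * a * norm (r n x)))) \<longlonglongrightarrow> 0"
      proof (rule tendsto_eventually, unfold eventually_sequentially, intro exI allI impI)
        fix n assume "n \<ge> N"
        then have "norm (f x) \<le> real n" using N by linarith
        then show "ennreal (\<Phi> (4 * a * norm (r n x))) = 0"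
          using young_function_zero[OF young] by (simp add: r_def)
      qed
    qed
  qed measurable
  then have "(\<lambda>n. scaled_modular \<Phi> (4 * a) (r n)) \<longlonglongrightarrow> 0"
    by (simp add: scaled_modular_def)
  then have "eventually (\<lambda>n. scaled_modular \<Phi> (4 * a) (r n) < ennreal (e / 4)) sequentially"
    using e by (intro order_tendstoD(2)) auto
  then obtain n where n: "scaled_modular \<Phi> (4 * a) (r n) < ennreal (e / 4)"
    unfolding eventually_sequentially by blast
  define g where "g = (\<lambda>x. f x - r n x)"
  have gm [measurable]: "g \<in> borel_measurable M" unfolding g_def by measurable
  define B where "B = real n + 1"
  have B: "B > 0" "norm (g x) \<le> B" for x by (auto simp: B_def g_def r_def)
  \<comment> \<open>The slope of the chord of the map from \<open>s\<close> to
    \<open>\<Phi> (2 * a * s)\<close> between 0 and \<open>2 * B\<close>. A convex function lies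
    below its chord, and differences of values of \<open>g\<close> have norm at most
    \<open>2 * B\<close>.\<close>
  define C where "C = \<Phi> (2 * a * (2 * B)) / (2 * B)"
  have C: "C \<ge> 0" using B young_function_nonneg[OF young] by (simp add: C_def)
  have "((\<lambda>s. C * (\<integral>x. norm (g (- s + x) - g (- t + x)) \<partial>M)) \<longlongrightarrow> C * 0) (nhds t)"
    using gm B(2) by (intro tendsto_intros L1_translate_continuous integrable_bounded[of _ B])
  then have "eventually (\<lambda>s. C * (\<integral>x. norm (g (- s + x) - g (- t + x)) \<partial>M) < e / 4) (nhds t)"
    using e by (intro order_tendstoD(2)) auto
  then show "eventually (\<lambda>s. scaled_modular \<Phi> a (\<lambda>x. f (- s + x) - f (- t + x)) < b) (nhds t)"
  proof eventually_elim
    case (elim s)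
    let ?w = "\<lambda>x. g (- s + x) - g (- t + x)"
    have "scaled_modular \<Phi> (2 * a) ?w \<le> (\<integral>\<^sup>+ x. ennreal (C * norm (?w x)) \<partial>M)"
      unfolding scaled_modular_def
    proof (intro nn_integral_mono ennreal_leI)
      fix x
      have "norm (?w x) \<le> 2 * B"
        using B(2)[of "- s + x"] B(2)[of "- t + x"] norm_triangle_ineq4[of "g (- s + x)" "g (- t + x)"]
        by linarith
      then have "\<Phi> (norm (?w x) / (2 * B) * (2 * a * (2 * B))) \<le> norm (?w x) / (2 * B) * \<Phi> (2 * a * (2 * B))"
        using B(1) by (intro young_function_scale[OF young]) auto
      then show "\<Phi> (2 * a * norm (?w x)) \<le> C * norm (?w x)"
        using B(1) by (simp add: C_def mult_ac)
    qed
    also have "\<dots> = ennreal (\<integral>x. C * norm (?w x) \<partial>M)"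
      using gm B(2) C
      by (intro nn_integral_eq_integral integrable_mult_right integrable_norm
          Bochner_Integration.integrable_diff integrable_left integrable_bounded[of g B]) auto
    also have "\<dots> \<le> ennreal (e / 4)" using elim by (intro ennreal_leI) simp
    finally have w: "scaled_modular \<Phi> (2 * a) ?w \<le> ennreal (e / 4)" .
    have rr: "scaled_modular \<Phi> (2 * a) (\<lambda>x. r n (- s + x) - r n (- t + x)) \<le> ennreal (e / 4) + ennreal (e / 4)"
    proof -
      have "scaled_modular \<Phi> (2 * a) (\<lambda>x. r n (- s + x) - r n (- t + x))
        \<le> scaled_modular \<Phi> (2 * (2 * a)) (\<lambda>x. r n (- s + x)) + scaled_modular \<Phi> (2 * (2 * a)) (\<lambda>x. r n (- t + x))"
        using a by (intro scaled_modular_sum_le norm_triangle_ineq4) auto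
      also have "\<dots> \<le> ennreal (e / 4) + ennreal (e / 4)"
        using n by (intro add_mono) (simp_all add: scaled_modular_translate)
      finally show ?thesis .
    qed
    have "scaled_modular \<Phi> a (\<lambda>x. f (- s + x) - f (- t + x))
      \<le> scaled_modular \<Phi> (2 * a) ?w + scaled_modular \<Phi> (2 * a) (\<lambda>x. r n (- s + x) - r n (- t + x))"
    proof (rule scaled_modular_sum_le)
      fix x
      have "f (- s + x) - f (- t + x) = ?w x + (r n (- s + x) - r n (- t + x))" by (simp add: g_def)
      also have "norm \<dots> \<le> norm (?w x) + norm (r n (- s + x) - r n (- t + x))" by (rule norm_triangle_ineq)
      finally show "norm (f (- s + x) - f (- t + x)) \<le> norm (?w x) + norm (r n (- s + x) - r n (- t + x))" .
    qed (use a in auto)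
    also have "\<dots> \<le> ennreal (e / 4) + (ennreal (e / 4) + ennreal (e / 4))"
      by (intro add_mono w rr)
    also have "\<dots> = ennreal (e / 4 + (e / 4 + e / 4))" using e by (simp flip: ennreal_plus)
    also have "\<dots> < ennreal e" using e by (simp add: ennreal_less_iff)
    also note e(2)
    finally show ?case .
  qed
qed simp

text \<open>Jensen's inequality for the probability measure \<open>|f| / \<parallel>f\<parallel>\<^sub>1\<close>.\<close>

lemma scaled_modular_conv:
  assumes f: "integrable M f" and h: "integrable M h" and c: "L1_norm M f > 0" and a: "a \<ge> 0"
  shows "scaled_modular \<Phi> a (conv M f h) \<le> scaled_modular \<Phi> (a * L1_norm M f) h"
proof -
  have [measurable]: "f \<in> borel_measurable M" "h \<in> borel_measurable M" using f h by auto
  define c where "c = L1_norm M f"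
  have "c > 0" using assms by (simp add: c_def)
  \<comment> \<open>The probability density for Jensen's inequality.\<close>
  define p where "p = (\<lambda>y. norm (f y) / c)"
  have p [measurable]: "p \<in> borel_measurable M" and p0: "\<And>y. p y \<ge> 0"
    using \<open>c > 0\<close> by (auto simp: p_def)
  have p1: "(\<integral>\<^sup>+ y. ennreal (p y) \<partial>M) = 1"
    using f \<open>c > 0\<close> by (subst nn_integral_eq_integral) (auto simp: p_def c_def L1_norm_def)
  interpret D: prob_space "density M (\<lambda>y. ennreal (p y))"
    by (rule prob_spaceI) (simp add: emeasure_density p1)
  have "ennreal (\<Phi> (a * norm (conv M f h x)))
      \<le> (\<integral>\<^sup>+ y. ennreal (p y) * ennreal (\<Phi> (a * c * norm (h (- y + x)))) \<partial>M)" (is "_ \<le> ?R") for x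
  \<comment> \<open>Jensen's inequality requires both integrals to be finite. Otherwise either the
    right side is infinite or \<open>conv\<close> has the default value 0, where
    \<open>\<Phi>\<close> vanishes.\<close>
  proof (cases "integrable M (\<lambda>y. f y * h (- y + x)) \<and> ?R < \<infinity>")
    case True
    let ?D = "density M (\<lambda>y. ennreal (p y))"
    \<comment> \<open>The factor \<open>c\<close> cancels the normalization of \<open>p\<close>, so
      the expectation of \<open>X\<close> is \<open>a\<close> times the integral of the norm of the
      convolution kernel.\<close>
    define X where "X = (\<lambda>y. a * c * norm (h (- y + x)))"
    have [measurable]: "X \<in> borel_measurable M" "(\<lambda>y. \<Phi> (X y)) \<in> borel_measurable M"
      unfolding X_def by measurable
    have eq: "p y * X y = a * norm (f y * h (- y + x))" for y
      using \<open>c > 0\<close> by (simp add: p_def X_def norm_mult)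
    have "integrable M (\<lambda>y. p y * X y)" unfolding eq using True by auto
    then have iX: "integrable (density M (\<lambda>y. ennreal (p y))) X"
      by (subst integrable_real_density) (auto simp: p0)
    have "(\<integral>\<^sup>+ y. ennreal (p y * \<Phi> (X y)) \<partial>M) < \<infinity>"
      using True p0 young_function_nonneg[OF young] by (simp add: X_def ennreal_mult)
    then have ipX: "integrable M (\<lambda>y. p y * \<Phi> (X y))"
      using p0 young_function_nonneg[OF young] by (intro integrableI_nonneg) auto
    then have iPX: "integrable (density M (\<lambda>y. ennreal (p y))) (\<lambda>y. \<Phi> (X y))"
      by (subst integrable_real_density) (auto simp: p0)
    have "norm (conv M f h x) \<le> (\<integral>y. norm (f y * h (- y + x)) \<partial>M)"
      unfolding conv_def by (rule integral_norm_bound)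
    then have "a * norm (conv M f h x) \<le> (\<integral>y. p y * X y \<partial>M)"
      unfolding eq using a by (simp add: mult_left_mono)
    also have "\<dots> = (\<integral>y. X y \<partial>?D)"
      by (subst integral_real_density) (auto simp: p0)
    finally have "\<Phi> (a * norm (conv M f h x)) \<le> \<Phi> ((\<integral>y. X y \<partial>?D))"
      using a by (intro young_function_mono[OF young]) auto
    also have "\<dots> \<le> (\<integral>y. \<Phi> (X y) \<partial>?D)"
      by (rule D.jensens_inequality[of X UNIV]) (use iX iPX young in \<open>auto simp: young_function_def\<close>)
    also have "\<dots> = (\<integral>y. p y * \<Phi> (X y) \<partial>M)"
      by (subst integral_real_density) (auto simp: p0)
    finally have "ennreal (\<Phi> (a * norm (conv M f h x))) \<le> ennreal (\<integral>y. p y * \<Phi> (X y) \<partial>M)"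
      by (rule ennreal_leI)
    also have "\<dots> = (\<integral>\<^sup>+ y. ennreal (p y * \<Phi> (X y)) \<partial>M)"
      using ipX p0 young_function_nonneg[OF young] by (subst nn_integral_eq_integral) auto
    finally show ?thesis
      using p0 young_function_nonneg[OF young] by (simp add: X_def ennreal_mult)
  next
    case False
    then show ?thesis
    proof (cases "integrable M (\<lambda>y. f y * h (- y + x))")
      case True
      with False have "?R = top" by (simp add: not_less top_unique)
      then show ?thesis by simp
    qed (simp add: conv_def not_integrable_integral_eq young_function_zero[OF young])
  qed
  then have "scaled_modular \<Phi> a (conv M f h)
      \<le> (\<integral>\<^sup>+ x. (\<integral>\<^sup>+ y. ennreal (p y) * ennreal (\<Phi> (a * c * norm (h (- y + x)))) \<partial>M) \<partial>M)"
    unfolding scaled_modular_def by (intro nn_integral_mono)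
  also have "\<dots> = (\<integral>\<^sup>+ y. ennreal (p y) \<partial>M) * scaled_modular \<Phi> (a * c) h"
    unfolding scaled_modular_def
    by (rule conv_tonelli(2)[of "\<lambda>y. ennreal (p y)" "\<lambda>z. ennreal (\<Phi> (a * c * norm z))"]) (use h in auto)
  finally show ?thesis by (simp add: p1 c_def)
qed

end

end

section \<open>Luxemburg and Orlicz norms\<close>

locale orlicz_group = compact_haar +
  fixes \<Phi> :: "real \<Rightarrow> real"
  assumes N_function: "N_function \<Phi>"
begin

abbreviation \<Psi> :: "real \<Rightarrow> real" where "\<Psi> \<equiv> complementary \<Phi>"

lemmas young = N_function_imp_young[OF N_function]
lemmas young_\<Psi> = young_function_complementary[OF N_function]

text \<open>A real-valued copy, faithful where the norm is finite, in particular on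
  \<open>M_space\<close>; \<open>enn2real\<close> sends an infinite value to 0. The same applies to
  \<open>orl\<close>.\<close>

definition lux :: "('a \<Rightarrow> complex) \<Rightarrow> real" where "lux f = enn2real (luxemburg_norm \<Phi> M f)"
definition orl :: "('a \<Rightarrow> complex) \<Rightarrow> real" where "orl g = enn2real (orlicz_norm \<Phi> M g)"

lemma lux_nonneg [simp]: "lux f \<ge> 0" and orl_nonneg [simp]: "orl g \<ge> 0"
  by (simp_all add: lux_def orl_def)

lemma luxemburg_norm_le:
  assumes "k > 0" "scaled_modular \<Phi> (1 / k) f \<le> 1"
  shows "luxemburg_norm \<Phi> M f \<le> ennreal k"
  unfolding luxemburg_norm_def by (rule INF_lower) (simp add: assms modular_eq_scaled)

lemma luxemburg_norm_finite:
  assumes f: "f \<in> M_space \<Phi> M"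
  shows "luxemburg_norm \<Phi> M f = ennreal (lux f)"
proof -
  have "scaled_modular \<Phi> 1 f < \<infinity>" using f by (simp add: M_space_iff)
  then obtain m where m: "m \<ge> 0" "scaled_modular \<Phi> 1 f = ennreal m"
    by (auto simp: less_top_ennreal)
  \<comment> \<open>At least 1, so that \<open>1 / k\<close> is a convex weight; at least
    \<open>m\<close>, so that convexity brings the modular down to
    \<open>m / k \<le> 1\<close>.\<close>
  define k where "k = max 1 m"
  have k: "k \<ge> 1" "m \<le> k" by (auto simp: k_def)
  have "scaled_modular \<Phi> (1 / k * 1) f \<le> ennreal (1 / k) * scaled_modular \<Phi> 1 f"
    by (rule scaled_modular_scale[OF young M_space_measurable[OF f]]) (use k in auto)
  also have "\<dots> = ennreal (m / k)" using m k by (simp flip: ennreal_mult)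
  also have "\<dots> \<le> 1" using m k by (simp add: divide_le_eq)
  finally have "luxemburg_norm \<Phi> M f \<le> ennreal k"
    using k by (intro luxemburg_norm_le) auto
  then show ?thesis by (simp add: lux_def ennreal_enn2real le_less_trans[OF _ ennreal_less_top])
qed

lemma lux_le:
  assumes "k > 0" "scaled_modular \<Phi> (1 / k) f \<le> 1"
  shows "lux f \<le> k"
  unfolding lux_def using luxemburg_norm_le[OF assms] assms(1) by (simp add: enn2real_leI)

lemma scaled_modular_le_1:
  assumes "f \<in> M_space \<Phi> M" "lux f < k"
  shows "scaled_modular \<Phi> (1 / k) f \<le> 1"
proof -
  have "luxemburg_norm \<Phi> M f < ennreal k"
    using assms by (simp add: luxemburg_norm_finite ennreal_less_iff)
  then obtain l where l: "l > 0" "modular \<Phi> M (\<lambda>x. f x / of_real l) \<le> 1" "ennreal l < ennreal k"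
    unfolding luxemburg_norm_def INF_less_iff by auto
  then have "l < k" by (simp add: ennreal_less_iff)
  then have "scaled_modular \<Phi> (1 / k) f \<le> scaled_modular \<Phi> (1 / l) f"
    using l(1) by (intro scaled_modular_mono[OF young]) (auto simp: frac_le)
  also have "\<dots> \<le> 1" using l by (simp add: modular_eq_scaled)
  finally show ?thesis .
qed

text \<open>Bounds are first proved with any \<open>k\<close> above the infimum, where the modular
  is at most 1, and then pass to the infimum here. This avoids deciding whether it is attained and
  dividing by \<open>lux f = 0\<close>.\<close>

lemma lux_le_mult:
  assumes f: "f \<in> M_space \<Phi> M" and c: "c \<ge> 0" and le: "\<And>k. k > lux f \<Longrightarrow> lux g \<le> c * k"
  shows "lux g \<le> c * lux f"
proof (rule field_le_epsilon)
  fix e :: real assume "e > 0"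
  have "lux g \<le> c * (lux f + e / (c + 1))" using \<open>e > 0\<close> c by (intro le) auto
  also have "\<dots> = c * lux f + e * (c / (c + 1))" using c by (simp add: field_simps)
  also have "\<dots> \<le> c * lux f + e * 1" using \<open>e > 0\<close> c by (intro add_left_mono mult_left_mono) auto
  finally show "lux g \<le> c * lux f + e" by simp
qed

lemma lux_zero [simp]: "lux (\<lambda>x. 0) = 0"
proof -
  have "lux (\<lambda>x. 0) \<le> e" if "e > 0" for e
    by (rule lux_le[OF that]) (simp add: scaled_modular_def young_function_zero[OF young])
  then have "lux (\<lambda>x. 0) \<le> 0" using dense_ge[of 0] by blast
  then show ?thesis using lux_nonneg[of "\<lambda>x. 0"] by linarith
qed

lemma lux_cmult:
  assumes f: "f \<in> M_space \<Phi> M"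
  shows "lux (\<lambda>x. c * f x) \<le> norm c * lux f"
proof (cases "c = 0")
  case False
  show ?thesis
  proof (rule lux_le_mult[OF f])
    fix k assume k: "lux f < k"
    then have "k > 0" using lux_nonneg[of f] by linarith
    have "scaled_modular \<Phi> (1 / (norm c * k)) (\<lambda>x. c * f x) = scaled_modular \<Phi> (1 / k) f"
      using False by (simp add: scaled_modular_def norm_mult)
    then show "lux (\<lambda>x. c * f x) \<le> norm c * k"
      using scaled_modular_le_1[OF f k] False \<open>k > 0\<close> by (intro lux_le) auto
  qed simp
qed simp

text \<open>The constant only has to give a summable majorant. One factor 2 comes from splitting the
  difference inside \<open>\<Phi>\<close>, the other from convexity, which brings each of the two
  modulars down to 1/2.\<close>

lemma lux_translate_diff:
  assumes f: "f \<in> M_space \<Phi> M"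
  shows "lux (\<lambda>x. f (s + x) - f (t + x)) \<le> 4 * lux f"
proof (rule lux_le_mult[OF f])
  fix k assume k: "lux f < k"
  then have "k > 0" using lux_nonneg[of f] by linarith
  have [measurable]: "f \<in> borel_measurable M" using M_space_measurable[OF f] .
  have half: "scaled_modular \<Phi> (1 / (2 * k)) (\<lambda>x. f (r + x)) \<le> ennreal (1 / 2)" for r
  proof -
    have "scaled_modular \<Phi> (1 / 2 * (1 / k)) f \<le> ennreal (1 / 2) * scaled_modular \<Phi> (1 / k) f"
      by (rule scaled_modular_scale[OF young]) auto
    also have "\<dots> \<le> ennreal (1 / 2) * 1"
      by (intro mult_left_mono scaled_modular_le_1[OF f k]) simp
    finally show ?thesis by (simp add: scaled_modular_translate[OF young])
  qed
  have eq: "2 * (1 / (4 * k)) = 1 / (2 * k)" by simp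
  have "scaled_modular \<Phi> (1 / (4 * k)) (\<lambda>x. f (s + x) - f (t + x))
      \<le> scaled_modular \<Phi> (2 * (1 / (4 * k))) (\<lambda>x. f (s + x)) + scaled_modular \<Phi> (2 * (1 / (4 * k))) (\<lambda>x. f (t + x))"
    using \<open>k > 0\<close> by (intro scaled_modular_sum_le[OF young] norm_triangle_ineq4) auto
  also have "\<dots> \<le> ennreal (1 / 2) + ennreal (1 / 2)"
    unfolding eq by (intro add_mono half)
  also have "\<dots> = 1" by (subst ennreal_plus[symmetric]) simp_all
  finally show "lux (\<lambda>x. f (s + x) - f (t + x)) \<le> 4 * k"
    using \<open>k > 0\<close> by (intro lux_le) auto
qed simp

lemma lux_translate:
  assumes f: "f \<in> M_space \<Phi> M"
  shows "lux (\<lambda>x. f (t + x)) = lux f"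
  using scaled_modular_translate[OF young M_space_measurable[OF f]]
  by (simp add: lux_def luxemburg_norm_def modular_eq_scaled cong: conj_cong)

lemma lux_translate_continuous:
  assumes f: "f \<in> M_space \<Phi> M"
  shows "((\<lambda>s. lux (\<lambda>x. f (- s + x) - f (- t + x))) \<longlongrightarrow> 0) (nhds t)"
proof (rule tendstoI)
  fix e :: real assume "e > 0"
  then have "1 / (e / 2) > 0" by simp
  from order_tendstoD(2)[OF scaled_modular_translate_continuous[OF young f this], of 1]
  have "eventually (\<lambda>s. scaled_modular \<Phi> (1 / (e / 2)) (\<lambda>x. f (- s + x) - f (- t + x)) < 1) (nhds t)"
    by simp
  then show "eventually (\<lambda>s. dist (lux (\<lambda>x. f (- s + x) - f (- t + x))) 0 < e) (nhds t)"
  proof eventually_elim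
    case (elim s)
    then have "lux (\<lambda>x. f (- s + x) - f (- t + x)) \<le> e / 2"
      using \<open>e > 0\<close> by (intro lux_le) auto
    then show ?case using \<open>e > 0\<close> by simp
  qed
qed

text \<open>Convexity gives \<open>\<Phi> 1 \<le> \<Phi> s / s\<close> for \<open>s \<ge> 1\<close>,
  so \<open>norm (f x)\<close> is at most \<open>1 + \<Phi> (norm (f x)) / \<Phi> 1\<close>.\<close>

lemma M_space_integrable:
  assumes f: "f \<in> M_space \<Phi> M" shows "integrable M f"
proof -
  have [measurable]: "f \<in> borel_measurable M" using M_space_measurable[OF f] .
  have p: "\<Phi> 1 > 0" using N_function unfolding N_function_def by (metis less_eq_real_def zero_neq_one)
  have le: "norm (f x) \<le> 1 + \<Phi> (norm (f x)) / \<Phi> 1" for x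
  proof (cases "norm (f x) \<le> 1")
    case True
    then show ?thesis using p young_function_nonneg[OF young] by (simp add: add_increasing2)
  next
    case False
    then have "f x \<noteq> 0" by auto
    from False have "\<Phi> (1 / norm (f x) * norm (f x)) \<le> 1 / norm (f x) * \<Phi> (norm (f x))"
      by (intro young_function_scale[OF young]) (auto simp: divide_le_eq)
    then have "norm (f x) \<le> \<Phi> (norm (f x)) / \<Phi> 1"
      using p False \<open>f x \<noteq> 0\<close> by (simp add: field_simps)
    then show ?thesis by simp
  qed
  have meas: "(\<lambda>x. \<Phi> (1 * norm (f x))) \<in> borel_measurable M"
    by (rule measurable_young_norm[OF young]) measurable
  have "scaled_modular \<Phi> 1 f < \<infinity>" using f by (simp add: M_space_iff)
  then have "integrable M (\<lambda>x. \<Phi> (1 * norm (f x)))"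
    unfolding scaled_modular_def using meas young_function_nonneg[OF young]
    by (intro integrableI_nonneg) auto
  then have "integrable M (\<lambda>x. 1 + \<Phi> (norm (f x)) / \<Phi> 1)" by simp
  then show ?thesis
    by (rule Bochner_Integration.integrable_bound)
      (use le p young_function_nonneg[OF young] in auto)
qed

text \<open>Young's inequality at \<open>x = 1\<close> gives the bound directly and bypasses the
  question whether \<open>\<Psi> 1\<close> is positive.\<close>

lemma M_space_\<Psi>_integrable:
  assumes g: "g \<in> M_space \<Psi> M" shows "integrable M g"
proof -
  have [measurable]: "g \<in> borel_measurable M" using M_space_measurable[OF g] .
  have le: "norm (g x) \<le> \<Phi> 1 + \<Psi> (norm (g x))" for x
    using young_inequality[OF N_function, of 1 "norm (g x)"] by simp
  have meas: "(\<lambda>x. \<Psi> (1 * norm (g x))) \<in> borel_measurable M"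
    by (rule measurable_young_norm[OF young_\<Psi>]) measurable
  have "scaled_modular \<Psi> 1 g < \<infinity>" using g by (simp add: M_space_iff)
  then have "integrable M (\<lambda>x. \<Psi> (1 * norm (g x)))"
    unfolding scaled_modular_def using meas young_function_nonneg[OF young_\<Psi>]
    by (intro integrableI_nonneg) auto
  then have "integrable M (\<lambda>x. \<Phi> 1 + \<Psi> (norm (g x)))" by simp
  then show ?thesis
    by (rule Bochner_Integration.integrable_bound)
      (use le young_function_nonneg[OF young] young_function_nonneg[OF young_\<Psi>] in auto)
qed

lemma integrable_check:
  assumes g: "integrable M g" shows "integrable M (check g)"
  using integrable_distr[OF measurable_translate(3), of g] g unfolding distr_uminus check_def by simp

text \<open>Young's inequality for the product of \<open>norm (f x) / 2\<close> and
  \<open>2 * a * norm (g x)\<close>. Halving \<open>f\<close> leaves room for an admissible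
  \<open>l < 2\<close>, so the infimum in the Luxemburg norm need not be attained. The free
  parameter \<open>a\<close> gives finiteness for \<open>a = 1\<close> and smallness for large
  \<open>a\<close>.\<close>

lemma orlicz_norm_le:
  assumes g: "g \<in> M_space \<Psi> M" and a: "a > 0"
  shows "orlicz_norm \<Phi> M g \<le> ennreal (1 / a) * (1 + scaled_modular \<Psi> (2 * a) g)"
  unfolding orlicz_norm_def
proof (rule SUP_least)
  fix f assume "f \<in> {f \<in> borel_measurable M. luxemburg_norm \<Phi> M f \<le> 1}"
  then have f [measurable]: "f \<in> borel_measurable M" and "luxemburg_norm \<Phi> M f < ennreal 2"
    by (auto intro: le_less_trans simp: one_less_numeral simp del: borel_measurable_M)
  then obtain l where l: "l > 0" "modular \<Phi> M (\<lambda>x. f x / of_real l) \<le> 1" "ennreal l < ennreal 2"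
    unfolding luxemburg_norm_def INF_less_iff by auto
  then have "l < 2" by (simp add: ennreal_less_iff)
  have [measurable]: "g \<in> borel_measurable M" using M_space_measurable[OF g] .
  have "scaled_modular \<Phi> (1 / 2) f \<le> scaled_modular \<Phi> (1 / l) f"
    using l(1) \<open>l < 2\<close> by (intro scaled_modular_mono[OF young]) (auto simp: frac_le)
  also have "\<dots> \<le> 1" using l by (simp add: modular_eq_scaled)
  finally have f1: "scaled_modular \<Phi> (1 / 2) f \<le> 1" .
  have "(\<integral>\<^sup>+ x. ennreal (norm (f x * g x)) \<partial>M)
      \<le> (\<integral>\<^sup>+ x. ennreal (1 / a) * (ennreal (\<Phi> (1 / 2 * norm (f x))) + ennreal (\<Psi> (2 * a * norm (g x)))) \<partial>M)"
  proof (rule nn_integral_mono)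
    fix x
    have "a * norm (f x * g x) = (1 / 2 * norm (f x)) * \<bar>2 * a * norm (g x)\<bar>"
      using a by (simp add: norm_mult)
    also have "\<dots> \<le> \<Phi> (1 / 2 * norm (f x)) + \<Psi> (2 * a * norm (g x))"
      by (rule young_inequality[OF N_function]) simp
    finally have "norm (f x * g x) \<le> 1 / a * (\<Phi> (1 / 2 * norm (f x)) + \<Psi> (2 * a * norm (g x)))"
      using a by (simp add: field_simps)
    then have "ennreal (norm (f x * g x)) \<le> ennreal (1 / a * (\<Phi> (1 / 2 * norm (f x)) + \<Psi> (2 * a * norm (g x))))"
      by (rule ennreal_leI)
    also have "\<dots> = ennreal (1 / a) * (ennreal (\<Phi> (1 / 2 * norm (f x))) + ennreal (\<Psi> (2 * a * norm (g x))))"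
      unfolding ennreal_plus[OF young_function_nonneg[OF young] young_function_nonneg[OF young_\<Psi>], symmetric]
      using a young_function_nonneg[OF young] young_function_nonneg[OF young_\<Psi>]
      by (intro ennreal_mult) auto
    finally show "ennreal (norm (f x * g x))
      \<le> ennreal (1 / a) * (ennreal (\<Phi> (1 / 2 * norm (f x))) + ennreal (\<Psi> (2 * a * norm (g x))))" .
  qed
  also have "\<dots> = ennreal (1 / a) * (scaled_modular \<Phi> (1 / 2) f + scaled_modular \<Psi> (2 * a) g)"
  proof -
    have [measurable]: "(\<lambda>x. \<Phi> (1 / 2 * norm (f x))) \<in> borel_measurable M"
        "(\<lambda>x. \<Psi> (2 * a * norm (g x))) \<in> borel_measurable M"
      using measurable_young_norm[OF young f] measurable_young_norm[OF young_\<Psi> M_space_measurable[OF g]]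
      by blast+
    show ?thesis unfolding scaled_modular_def
      by (rule trans[OF nn_integral_cmult], measurable,
          rule arg_cong[OF nn_integral_add, where f="(*) (ennreal (1 / a))"], measurable)
  qed
  also have "\<dots> \<le> ennreal (1 / a) * (1 + scaled_modular \<Psi> (2 * a) g)"
    by (intro mult_left_mono add_right_mono f1) simp
  finally show "(\<integral>\<^sup>+ x. ennreal (norm (f x * g x)) \<partial>M)
      \<le> ennreal (1 / a) * (1 + scaled_modular \<Psi> (2 * a) g)" .
qed

lemma orlicz_norm_finite:
  assumes g: "g \<in> M_space \<Psi> M"
  shows "orlicz_norm \<Phi> M g = ennreal (orl g)"
proof -
  have "orlicz_norm \<Phi> M g \<le> ennreal (1 / 1) * (1 + scaled_modular \<Psi> (2 * 1) g)"
    by (rule orlicz_norm_le[OF g]) simp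
  also have "\<dots> < \<infinity>" using g by (simp add: M_space_iff)
  finally show ?thesis by (simp add: orl_def)
qed

lemma orlicz_normD:
  assumes "f \<in> borel_measurable M" "luxemburg_norm \<Phi> M f \<le> 1"
  shows "(\<integral>\<^sup>+ x. ennreal (norm (f x * g x)) \<partial>M) \<le> orlicz_norm \<Phi> M g"
  unfolding orlicz_norm_def using assms by (intro SUP_upper) auto

lemma luxemburg_norm_translate:
  assumes "f \<in> borel_measurable M"
  shows "luxemburg_norm \<Phi> M (\<lambda>x. f (t + x)) = luxemburg_norm \<Phi> M f"
  using scaled_modular_translate[OF young assms]
  by (simp add: luxemburg_norm_def modular_eq_scaled cong: conj_cong)

text \<open>Left invariance moves the translation from \<open>g\<close> to the test function, and
  the Luxemburg unit ball is translation invariant.\<close>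

lemma orlicz_norm_translate_le:
  assumes [measurable]: "g \<in> borel_measurable M"
  shows "orlicz_norm \<Phi> M (\<lambda>x. g (t + x)) \<le> orlicz_norm \<Phi> M g"
  unfolding orlicz_norm_def[of _ _ "\<lambda>x. g (t + x)"]
proof (rule SUP_least)
  fix f assume "f \<in> {f \<in> borel_measurable M. luxemburg_norm \<Phi> M f \<le> 1}"
  then have f [measurable]: "f \<in> borel_measurable M" and f1: "luxemburg_norm \<Phi> M f \<le> 1" by auto
  have "(\<integral>\<^sup>+ x. ennreal (norm (f x * g (t + x))) \<partial>M)
      = (\<integral>\<^sup>+ x. ennreal (norm (f (- t + (t + x)) * g (t + x))) \<partial>M)" by simp
  also have "\<dots> = (\<integral>\<^sup>+ x. ennreal (norm (f (- t + x) * g x)) \<partial>M)"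
    by (rule nn_integral_left[of "\<lambda>x. ennreal (norm (f (- t + x) * g x))"]) measurable
  also have "\<dots> \<le> orlicz_norm \<Phi> M g"
    using f1 by (intro orlicz_normD) (simp_all add: luxemburg_norm_translate[OF f] del: borel_measurable_M)
  finally show "(\<integral>\<^sup>+ x. ennreal (norm (f x * g (t + x))) \<partial>M) \<le> orlicz_norm \<Phi> M g" .
qed

lemma orl_translate_le:
  assumes g: "g \<in> M_space \<Psi> M"
  shows "orl (\<lambda>x. g (t + x)) \<le> orl g"
  using orlicz_norm_translate_le[OF M_space_measurable[OF g], of t]
    orlicz_norm_finite[OF g] orlicz_norm_finite[OF M_space_translate[OF young_\<Psi> g], of t] by simp

lemma orl_translate_diff:
  assumes g: "g \<in> M_space \<Psi> M"
  shows "orl (\<lambda>x. g (s + x) - g (t + x)) \<le> 2 * orl g"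
proof -
  have [measurable]: "g \<in> borel_measurable M" using M_space_measurable[OF g] .
  have "orlicz_norm \<Phi> M (\<lambda>x. g (s + x) - g (t + x)) \<le> orlicz_norm \<Phi> M g + orlicz_norm \<Phi> M g"
    unfolding orlicz_norm_def[of _ _ "\<lambda>x. g (s + x) - g (t + x)"]
  proof (rule SUP_least)
    fix f assume "f \<in> {f \<in> borel_measurable M. luxemburg_norm \<Phi> M f \<le> 1}"
    then have f [measurable]: "f \<in> borel_measurable M" and f1: "luxemburg_norm \<Phi> M f \<le> 1" by auto
    have "(\<integral>\<^sup>+ x. ennreal (norm (f x * (g (s + x) - g (t + x)))) \<partial>M)
      \<le> (\<integral>\<^sup>+ x. ennreal (norm (f x * g (s + x))) + ennreal (norm (f x * g (t + x))) \<partial>M)"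
      by (intro nn_integral_mono)
        (simp add: right_diff_distrib norm_triangle_ineq4 flip: ennreal_plus)
    also have "\<dots> = (\<integral>\<^sup>+ x. ennreal (norm (f x * g (s + x))) \<partial>M) + (\<integral>\<^sup>+ x. ennreal (norm (f x * g (t + x))) \<partial>M)"
      by (rule nn_integral_add) measurable
    also have "\<dots> \<le> orlicz_norm \<Phi> M g + orlicz_norm \<Phi> M g"
      by (intro add_mono order_trans[OF orlicz_normD[OF f f1] orlicz_norm_translate_le]) measurable
    finally show "(\<integral>\<^sup>+ x. ennreal (norm (f x * (g (s + x) - g (t + x)))) \<partial>M)
      \<le> orlicz_norm \<Phi> M g + orlicz_norm \<Phi> M g" .
  qed
  then show ?thesis
    using orlicz_norm_finite[OF g]
      orlicz_norm_finite[OF M_space_diff[OF young_\<Psi> M_space_translate[OF young_\<Psi> g, of s] M_space_translate[OF young_\<Psi> g, of t]]]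
    by (simp flip: ennreal_plus)
qed

lemma orl_translate_continuous:
  assumes g: "g \<in> M_space \<Psi> M"
  shows "((\<lambda>s. orl (\<lambda>x. g (- s + x) - g (- t + x))) \<longlongrightarrow> 0) (nhds t)"
proof (rule tendstoI)
  fix e :: real assume "e > 0"
  \<comment> \<open>With modular below 1 the norm is at most \<open>2 / a\<close>, which is two
    thirds of \<open>e\<close>.\<close>
  define a where "a = 3 / e"
  have a: "a > 0" "2 / a < e" using \<open>e > 0\<close> by (auto simp: a_def)
  then have "2 * a > 0" by simp
  from order_tendstoD(2)[OF scaled_modular_translate_continuous[OF young_\<Psi> g this], of 1]
  have "eventually (\<lambda>s. scaled_modular \<Psi> (2 * a) (\<lambda>x. g (- s + x) - g (- t + x)) < 1) (nhds t)"
    by simp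
  then show "eventually (\<lambda>s. dist (orl (\<lambda>x. g (- s + x) - g (- t + x))) 0 < e) (nhds t)"
  proof eventually_elim
    case (elim s)
    have m: "(\<lambda>x. g (- s + x) - g (- t + x)) \<in> M_space \<Psi> M"
      by (intro M_space_diff[OF young_\<Psi>] M_space_translate[OF young_\<Psi> g])
    have "orlicz_norm \<Phi> M (\<lambda>x. g (- s + x) - g (- t + x)) \<le> ennreal (1 / a) * (1 + 1)"
      using elim by (intro order_trans[OF orlicz_norm_le[OF m a(1)]] mult_left_mono add_left_mono) auto
    also have "\<dots> = ennreal (2 / a)" using a by (simp add: ennreal_mult[symmetric] flip: ennreal_numeral)
    finally have "orl (\<lambda>x. g (- s + x) - g (- t + x)) \<le> 2 / a"
      unfolding orlicz_norm_finite[OF m] using a by simp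
    then show ?case using a by simp
  qed
qed

text \<open>The constant is 1 because the Orlicz norm is by definition dual to the Luxemburg norm.
  Dividing \<open>f\<close> by some \<open>k > lux f\<close> puts it into the unit ball, even when
  \<open>lux f = 0\<close>; then \<open>k\<close> decreases to \<open>lux f\<close>.\<close>

lemma hoelder:
  assumes f: "f \<in> M_space \<Phi> M" and g: "g \<in> M_space \<Psi> M"
  shows "(\<integral>\<^sup>+ x. ennreal (norm (f x * g x)) \<partial>M) \<le> ennreal (lux f * orl g)"
proof -
  have [measurable]: "f \<in> borel_measurable M" "g \<in> borel_measurable M"
    using M_space_measurable[OF f] M_space_measurable[OF g] by auto
  let ?I = "\<integral>\<^sup>+ x. ennreal (norm (f x * g x)) \<partial>M"
  have le: "?I \<le> ennreal (k * orl g)" if k: "lux f < k" for k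
  proof -
    have "k > 0" using k lux_nonneg[of f] by linarith
    have "scaled_modular \<Phi> (1 / 1) (\<lambda>x. of_real (1 / k) * f x) = scaled_modular \<Phi> (1 / k) f"
      using \<open>k > 0\<close> by (simp add: scaled_modular_def norm_divide)
    then have "luxemburg_norm \<Phi> M (\<lambda>x. of_real (1 / k) * f x) \<le> ennreal 1"
      using scaled_modular_le_1[OF f k] by (intro luxemburg_norm_le) auto
    then have "(\<integral>\<^sup>+ x. ennreal (norm (of_real (1 / k) * f x * g x)) \<partial>M) \<le> ennreal (orl g)"
      unfolding orlicz_norm_finite[OF g, symmetric] by (intro orlicz_normD) auto
    then have "ennreal k * (\<integral>\<^sup>+ x. ennreal (norm (of_real (1 / k) * f x * g x)) \<partial>M) \<le> ennreal k * ennreal (orl g)"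
      by (rule mult_left_mono) simp
    also have "ennreal k * (\<integral>\<^sup>+ x. ennreal (norm (of_real (1 / k) * f x * g x)) \<partial>M)
      = (\<integral>\<^sup>+ x. ennreal k * ennreal (norm (of_real (1 / k) * f x * g x)) \<partial>M)"
      by (rule nn_integral_cmult[symmetric]) measurable
    also have "\<dots> = ?I"
      using \<open>k > 0\<close> by (intro nn_integral_cong) (simp add: norm_mult norm_divide flip: ennreal_mult)
    finally show ?thesis using \<open>k > 0\<close> by (simp add: ennreal_mult)
  qed
  have "?I < \<infinity>" using le[of "lux f + 1"] by (simp add: le_less_trans)
  then obtain i where i: "i \<ge> 0" "?I = ennreal i" by (auto simp: less_top_ennreal)
  have "i \<le> lux f * orl g"
  proof (rule field_le_epsilon)
    fix e :: real assume "e > 0"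
    have q: "orl g + 1 > 0" using orl_nonneg[of g] by linarith
    have "i \<le> (lux f + e / (orl g + 1)) * orl g"
      using le[of "lux f + e / (orl g + 1)"] i \<open>e > 0\<close> q by (simp add: ennreal_le_iff)
    also have "\<dots> = lux f * orl g + e * (orl g / (orl g + 1))" by (simp add: distrib_right)
    also have "\<dots> \<le> lux f * orl g + e * 1"
      using \<open>e > 0\<close> q by (intro add_left_mono mult_left_mono) auto
    finally show "i \<le> lux f * orl g + e" by simp
  qed
  then show ?thesis using i by (simp add: ennreal_leI)
qed

lemma conv_M_space:
  assumes f: "integrable M f" and h: "h \<in> M_space \<Phi> M"
  shows conv_in_M_space: "conv M f h \<in> M_space \<Phi> M"
    and lux_conv_le: "lux (conv M f h) \<le> L1_norm M f * lux h"
proof -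
  have meas: "f \<in> borel_measurable M" "h \<in> borel_measurable M"
    using f M_space_measurable[OF h] by auto
  have hI: "integrable M h" by (rule M_space_integrable[OF h])
  have c0: "L1_norm M f \<ge> 0" by (simp add: L1_norm_def)
  have cm: "conv M f h \<in> borel_measurable M" by (rule conv_measurable[OF meas(1) hI])
  have "conv M f h \<in> M_space \<Phi> M \<and> lux (conv M f h) \<le> L1_norm M f * lux h"
  proof (cases "L1_norm M f = 0")
    \<comment> \<open>Normalization by \<open>L1_norm M f\<close> breaks down here, but
      \<open>f\<close> vanishes almost everywhere and the convolution is identically 0.\<close>
    case True
    then have "AE x in M. f x = 0"
      using f by (simp add: L1_norm_def integral_nonneg_eq_0_iff_AE)
    then have "conv M f h = conv M (\<lambda>x. 0) h"
      using meas by (intro conv_cong_AE_left) auto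
    then have "conv M f h = (\<lambda>x. 0)" by (simp add: conv_def)
    then show ?thesis using True by (simp add: M_space_bounded[OF young, of _ 0])
  next
    case False
    with c0 have c: "L1_norm M f > 0" by simp
    have m: "conv M f h \<in> M_space \<Phi> M"
      unfolding M_space_iff
    proof (intro conjI cm allI impI)
      fix a :: real assume "a > 0"
      have "scaled_modular \<Phi> a (conv M f h) \<le> scaled_modular \<Phi> (a * L1_norm M f) h"
        using \<open>a > 0\<close> by (intro scaled_modular_conv[OF young f hI c]) simp
      also have "\<dots> < \<infinity>" using h \<open>a > 0\<close> c by (simp add: M_space_iff)
      finally show "scaled_modular \<Phi> a (conv M f h) < \<infinity>" .
    qed
    have "lux (conv M f h) \<le> L1_norm M f * lux h"
    proof (rule lux_le_mult[OF h c0])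
      fix k assume k: "lux h < k"
      then have "k > 0" using lux_nonneg[of h] by linarith
      have "scaled_modular \<Phi> (1 / (L1_norm M f * k)) (conv M f h)
        \<le> scaled_modular \<Phi> (1 / (L1_norm M f * k) * L1_norm M f) h"
        using \<open>k > 0\<close> c by (intro scaled_modular_conv[OF young f hI c]) simp
      also have "1 / (L1_norm M f * k) * L1_norm M f = 1 / k" using c by simp
      also have "scaled_modular \<Phi> (1 / k) h \<le> 1" by (rule scaled_modular_le_1[OF h k])
      finally show "lux (conv M f h) \<le> L1_norm M f * k"
        using \<open>k > 0\<close> c by (intro lux_le) auto
    qed
    with m show ?thesis by simp
  qed
  then show "conv M f h \<in> M_space \<Phi> M" "lux (conv M f h) \<le> L1_norm M f * lux h" by auto
qed

end

section \<open>The space $A_\Phi(G)$\<close>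

context compact_haar
begin

lemma C0_iff: "u \<in> C0 \<longleftrightarrow> continuous_on UNIV u" for u :: "'g \<Rightarrow> complex"
  unfolding C0_def using compact_UNIV by auto

text \<open>Dominated convergence would yield only sequential continuity. Uniform closeness of
  \<open>F (s, y)\<close> to \<open>F (x, y)\<close> over the compact group gives an estimate on a
  whole neighbourhood.\<close>

lemma continuous_integral_kernel:
  fixes F :: "'b::topological_space \<times> 'g \<Rightarrow> complex"
  assumes w: "integrable M w" and F: "continuous_on UNIV F"
  shows "continuous_on UNIV (\<lambda>x. \<integral>y. w y * F (x, y) \<partial>M)"
  unfolding continuous_on_def
proof (intro ballI tendstoI)
  fix x :: 'b and e :: real assume "e > 0"
  define c where "c = L1_norm M w + 1"
  have c: "c > 0" "L1_norm M w < c"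
    by (auto simp: c_def L1_norm_def intro: add_nonneg_pos)
  have Fx: "continuous_on UNIV (\<lambda>y. F (x, y))" for x
    by (intro continuous_on_compose2[OF F] continuous_intros) auto
  have int: "integrable M (\<lambda>y. w y * F (x, y))" for x
  proof -
    obtain B where B: "\<And>y. norm (F (x, y)) \<le> B" using continuous_bounded[OF Fx[of x]] by blast
    have [measurable]: "(\<lambda>y. F (x, y)) \<in> borel_measurable M" "w \<in> borel_measurable M"
      using continuous_imp_measurable[OF Fx] w by auto
    show ?thesis
    proof (rule Bochner_Integration.integrable_bound)
      show "integrable M (\<lambda>y. B * norm (w y))" using w by simp
      show "AE y in M. norm (w y * F (x, y)) \<le> norm (B * norm (w y))"
      proof (rule AE_I2)
        fix y
        have "norm (w y * F (x, y)) \<le> B * norm (w y)"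
          unfolding norm_mult mult.commute[of B] by (intro mult_left_mono B) simp
        then show "norm (w y * F (x, y)) \<le> norm (B * norm (w y))" by simp
      qed
    qed measurable
  qed
  have "e / c > 0" using \<open>e > 0\<close> c by simp
  from uniform_continuity[OF F this, of x]
  obtain U where U: "open U" "x \<in> U" "\<And>s y. s \<in> U \<Longrightarrow> dist (F (s, y)) (F (x, y)) \<le> e / c"
    by blast
  have "dist (\<integral>y. w y * F (s, y) \<partial>M) (\<integral>y. w y * F (x, y) \<partial>M) < e" if "s \<in> U" for s
  proof -
    have "dist (\<integral>y. w y * F (s, y) \<partial>M) (\<integral>y. w y * F (x, y) \<partial>M)
        = norm (\<integral>y. w y * (F (s, y) - F (x, y)) \<partial>M)"
      using int by (simp add: dist_norm right_diff_distrib)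
    also have "\<dots> \<le> (\<integral>y. norm (w y) * (e / c) \<partial>M)"
    proof (rule order_trans[OF integral_norm_bound integral_mono])
      show "integrable M (\<lambda>y. norm (w y * (F (s, y) - F (x, y))))"
        using int by (intro integrable_norm) (simp add: right_diff_distrib)
      show "norm (w y * (F (s, y) - F (x, y))) \<le> norm (w y) * (e / c)" for y
        using U(3)[OF that, of y] by (simp add: norm_mult dist_norm mult_left_mono del: times_divide_eq_right)
    qed (use w in auto)
    also have "\<dots> = L1_norm M w * (e / c)" by (simp add: L1_norm_def)
    also have "\<dots> < c * (e / c)" using c \<open>e > 0\<close> by (intro mult_strict_right_mono) auto
    also have "\<dots> = e" using c by simp
    finally show ?thesis .
  qed
  then show "eventually (\<lambda>s. dist (\<integral>y. w y * F (s, y) \<partial>M) (\<integral>y. w y * F (x, y) \<partial>M) < e) (at x within UNIV)"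
    unfolding eventually_at_topological using U(1,2) by blast
qed

text \<open>Finitely many left translates of \<open>U\<close> cover the compact group, and all have
  the measure of \<open>U\<close>.\<close>

lemma measure_open_pos:
  assumes "open U" "u \<in> U"
  shows "measure M U > 0"
proof -
  have eq: "(\<lambda>x. t + x) ` U = (\<lambda>x. - t + x) -` U" for t
    by (force simp: image_iff add.assoc[symmetric])
  have op: "open ((\<lambda>x. t + x) ` U)" for t
    unfolding eq by (rule open_vimage[OF assms(1)]) (intro continuous_intros)
  \<comment> \<open>The translate by \<open>x - u\<close> carries the given point \<open>u\<close>
    to \<open>x\<close>.\<close>
  have "x \<in> (\<lambda>z. (x - u) + z) ` U" for x using assms(2) by (intro image_eqI[of _ _ u]) simp_all
  then have cover: "UNIV \<subseteq> (\<Union>t\<in>UNIV. (\<lambda>x. t + x) ` U)" by blast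
  obtain T where T: "finite T" "UNIV \<subseteq> (\<Union>t\<in>T. (\<lambda>x. t + x) ` U)"
    by (rule compactE_image[OF compact_UNIV _ cover]) (rule op)
  have meas: "measure M ((\<lambda>x. t + x) ` U) = measure M U" for t
    using haar assms(1) unfolding left_haar_measure_def measure_def by simp
  have "1 = measure M UNIV" by simp
  also have "\<dots> \<le> measure M (\<Union>t\<in>T. (\<lambda>x. t + x) ` U)"
    using T(2) op by (intro finite_measure_mono) (auto simp: sets_M intro!: borel_open open_UN)
  also have "\<dots> \<le> (\<Sum>t\<in>T. measure M ((\<lambda>x. t + x) ` U))"
    using T(1) op by (intro finite_measure_subadditive_finite) (auto simp: sets_M)
  also have "\<dots> = card T * measure M U" by (simp add: meas)
  finally show ?thesis by (cases "measure M U = 0") (simp_all add: zero_less_measure_iff)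
qed

text \<open>Two continuous functions differ on an open set, and a null open set is empty. This makes
  the \<open>THE\<close> in \<open>ae_norm\<close> well defined.\<close>

lemma continuous_AE_eq:
  fixes u v :: "'g \<Rightarrow> complex"
  assumes "continuous_on UNIV u" "continuous_on UNIV v" "AE x in M. u x = v x"
  shows "u = v"
proof (rule ccontr)
  assume "u \<noteq> v"
  then obtain x where x: "u x \<noteq> v x" by blast
  define U where "U = {x. u x \<noteq> v x}"
  have "open U" unfolding U_def using assms(1,2) by (intro open_Collect_neq)
  moreover have "x \<in> U" using x by (simp add: U_def)
  ultimately have pos: "measure M U > 0" by (rule measure_open_pos)
  have "U \<in> sets M" using \<open>open U\<close> by (simp add: sets_M)
  moreover have "AE x in M. x \<notin> U" using assms(3) by (simp add: U_def)
  ultimately have "measure M U = 0" by (simp add: AE_iff_null null_setsD1 AE_iff_measurable measure_def)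
  with pos show False by simp
qed

end

section \<open>Representations, their cost and the infimum norm\<close>

context orlicz_group
begin

text \<open>The value at \<open>x\<close> is the pairing of \<open>f\<close> with the left translate
  of \<open>g\<close> by \<open>x\<close>. This is why a right translation of the convolution
  becomes a left translation of \<open>g\<close>.\<close>

lemma conv_check: "conv M f (check g) x = (\<integral>y. f y * g (- x + y) \<partial>M)"
  by (simp add: conv_def check_def minus_add)

lemma hoelder_conv:
  assumes f: "f \<in> M_space \<Phi> M" and g: "g \<in> M_space \<Psi> M"
  shows "(\<integral>\<^sup>+ y. ennreal (norm (f y * check g (- y + x))) \<partial>M) \<le> ennreal (lux f * orl g)"
proof -
  have "(\<integral>\<^sup>+ y. ennreal (norm (f y * check g (- y + x))) \<partial>M) \<le> ennreal (lux f * orl (\<lambda>y. g (- x + y)))"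
    using hoelder[OF f M_space_translate[OF young_\<Psi> g, of "- x"]] by (simp add: check_def minus_add)
  also have "\<dots> \<le> ennreal (lux f * orl g)"
    by (intro ennreal_leI mult_left_mono orl_translate_le[OF g]) simp
  finally show ?thesis .
qed

lemma norm_conv_check_le:
  assumes f: "f \<in> M_space \<Phi> M" and g: "g \<in> M_space \<Psi> M"
  shows "norm (conv M f (check g) x) \<le> lux f * orl g"
  using order_trans[OF conv_norm_le hoelder_conv[OF f g]] by simp

lemma conv_check_integrable:
  assumes f: "f \<in> M_space \<Phi> M" and g: "g \<in> M_space \<Psi> M"
  shows "integrable M (\<lambda>y. f y * g (- x + y))"
proof -
  have [measurable]: "f \<in> borel_measurable M" "g \<in> borel_measurable M"
    using M_space_measurable[OF f] M_space_measurable[OF g] by auto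
  have "(\<integral>\<^sup>+ y. ennreal (norm (f y * g (- x + y))) \<partial>M) < \<infinity>"
    using hoelder_conv[OF f g, of x] by (simp add: check_def minus_add le_less_trans)
  then show ?thesis by (simp add: integrable_iff_bounded)
qed

abbreviation represents where "represents u f g \<equiv> A_representation \<Phi> M u f g"

definition cost :: "(nat \<Rightarrow> 'a \<Rightarrow> complex) \<Rightarrow> (nat \<Rightarrow> 'a \<Rightarrow> complex) \<Rightarrow> real" where
  "cost f g = (\<Sum>n. lux (f n) * orl (g n))"

lemma represents_iff:
  "represents u f g \<longleftrightarrow> (\<forall>n. f n \<in> M_space \<Phi> M) \<and> (\<forall>n. g n \<in> M_space \<Psi> M) \<and>
     summable (\<lambda>n. lux (f n) * orl (g n)) \<and> (\<forall>x. (\<lambda>n. conv M (f n) (check (g n)) x) sums u x)"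
proof -
  have "(\<Sum>n. luxemburg_norm \<Phi> M (f n) * orlicz_norm \<Phi> M (g n)) < \<infinity> \<longleftrightarrow>
      summable (\<lambda>n. lux (f n) * orl (g n))"
    if "\<And>n. f n \<in> M_space \<Phi> M" "\<And>n. g n \<in> M_space \<Psi> M"
  proof -
    have eq: "luxemburg_norm \<Phi> M (f n) * orlicz_norm \<Phi> M (g n) = ennreal (lux (f n) * orl (g n))" for n
      by (simp add: luxemburg_norm_finite[OF that(1)] orlicz_norm_finite[OF that(2)] ennreal_mult)
    show ?thesis
      unfolding eq infinity_ennreal_def less_top[symmetric]
    proof
      show "summable (\<lambda>n. lux (f n) * orl (g n))"
        if "(\<Sum>n. ennreal (lux (f n) * orl (g n))) \<noteq> top"
        using that by (rule summable_suminf_not_top[rotated]) simp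
      show "(\<Sum>n. ennreal (lux (f n) * orl (g n))) \<noteq> top"
        if "summable (\<lambda>n. lux (f n) * orl (g n))"
        using that by (rule ennreal_suminf_neq_top) simp
    qed
  qed
  then show ?thesis unfolding A_representation_def by blast
qed

lemma representsD:
  assumes "represents u f g"
  shows "\<And>n. f n \<in> M_space \<Phi> M" "\<And>n. g n \<in> M_space \<Psi> M" "summable (\<lambda>n. lux (f n) * orl (g n))"
    "\<And>x. (\<lambda>n. conv M (f n) (check (g n)) x) sums u x"
  using assms by (auto simp: represents_iff)

lemma cost_eq:
  assumes "represents u f g"
  shows "(\<Sum>n. luxemburg_norm \<Phi> M (f n) * orlicz_norm \<Phi> M (g n)) = ennreal (cost f g)"
proof -
  note r = representsD[OF assms]
  have "luxemburg_norm \<Phi> M (f n) * orlicz_norm \<Phi> M (g n) = ennreal (lux (f n) * orl (g n))" for n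
    by (simp add: luxemburg_norm_finite[OF r(1)] orlicz_norm_finite[OF r(2)] ennreal_mult)
  then show ?thesis using r(3) by (simp add: cost_def suminf_ennreal2)
qed

lemma cost_nonneg: "represents u f g \<Longrightarrow> cost f g \<ge> 0"
  unfolding cost_def by (rule suminf_nonneg[OF representsD(3)]) auto

lemma A_norm_nonneg [simp]: "A_norm \<Phi> M u \<ge> 0"
  by (simp add: A_norm_def)

lemma A_norm_le:
  assumes r: "represents u f g"
  shows "A_norm \<Phi> M u \<le> cost f g"
  unfolding A_norm_def
proof (rule enn2real_leI)
  have "(f, g) \<in> {(f, g). represents u f g}" using r by simp
  then have "(INF (f, g) \<in> {(f, g). represents u f g}.
      \<Sum>n. luxemburg_norm \<Phi> M (f n) * orlicz_norm \<Phi> M (g n))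
      \<le> (\<Sum>n. luxemburg_norm \<Phi> M (f n) * orlicz_norm \<Phi> M (g n))"
    by (rule INF_lower2) simp
  then show "(INF (f, g) \<in> {(f, g). represents u f g}.
      \<Sum>n. luxemburg_norm \<Phi> M (f n) * orlicz_norm \<Phi> M (g n)) \<le> ennreal (cost f g)"
    by (simp only: cost_eq[OF r])
qed (rule cost_nonneg[OF r])

text \<open>A representation of finite cost exists, so the infimum is finite and
  \<open>enn2real\<close> loses nothing.\<close>

lemma A_norm_approx:
  assumes u: "u \<in> A_space \<Phi> M" and e: "e > 0"
  obtains f g where "represents u f g" "cost f g < A_norm \<Phi> M u + e"
proof -
  obtain f0 g0 where r0: "represents u f0 g0" using u by (auto simp: A_space_def)
  let ?I = "INF (f, g) \<in> {(f, g). represents u f g}.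
      \<Sum>n. luxemburg_norm \<Phi> M (f n) * orlicz_norm \<Phi> M (g n)"
  have "(f0, g0) \<in> {(f, g). represents u f g}" using r0 by simp
  then have "?I \<le> (\<Sum>n. luxemburg_norm \<Phi> M (f0 n) * orlicz_norm \<Phi> M (g0 n))"
    by (rule INF_lower2) simp
  then have "?I \<le> ennreal (cost f0 g0)" by (simp only: cost_eq[OF r0])
  then have "?I < top" by (rule le_less_trans) simp
  then have "?I = ennreal (A_norm \<Phi> M u)" by (simp add: A_norm_def)
  also have "\<dots> < ennreal (A_norm \<Phi> M u + e)" using e by (simp add: ennreal_less_iff)
  finally obtain f g where fg: "represents u f g"
    "(\<Sum>n. luxemburg_norm \<Phi> M (f n) * orlicz_norm \<Phi> M (g n)) < ennreal (A_norm \<Phi> M u + e)"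
    unfolding INF_less_iff by auto
  then have "cost f g < A_norm \<Phi> M u + e"
    using cost_nonneg[OF fg(1)] by (simp add: cost_eq[OF fg(1)] ennreal_less_iff)
  with fg(1) show ?thesis by (rule that)
qed

lemma A_space_iff: "u \<in> A_space \<Phi> M \<longleftrightarrow> continuous_on UNIV u \<and> (\<exists>f g. represents u f g)"
  by (simp add: A_space_def C0_iff)

text \<open>Hoelder's inequality bounds each term of a representation. The estimate yields
  definiteness of the norm, uniform convergence of norm-summable series and the comparison with the
  L1 norm.\<close>

lemma norm_le_A_norm:
  assumes "u \<in> A_space \<Phi> M"
  shows "norm (u x) \<le> A_norm \<Phi> M u"
proof (rule field_le_epsilon)
  fix e :: real assume "e > 0"
  obtain f g where fg: "represents u f g" "cost f g < A_norm \<Phi> M u + e"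
    using A_norm_approx[OF assms \<open>e > 0\<close>] .
  note r = representsD[OF fg(1)]
  have le: "norm (conv M (f n) (check (g n)) x) \<le> lux (f n) * orl (g n)" for n
    by (rule norm_conv_check_le[OF r(1,2)])
  have s: "summable (\<lambda>n. norm (conv M (f n) (check (g n)) x))"
    by (rule summable_comparison_test'[OF r(3)]) (use le in auto)
  have "norm (u x) \<le> (\<Sum>n. norm (conv M (f n) (check (g n)) x))"
    unfolding sums_unique[OF r(4)] by (rule summable_norm[OF s])
  also have "\<dots> \<le> cost f g" unfolding cost_def by (rule suminf_le[OF le s r(3)])
  finally show "norm (u x) \<le> A_norm \<Phi> M u + e" using fg(2) by simp
qed

lemma A_spaceI:
  assumes "continuous_on UNIV u" "represents u f g" "cost f g \<le> c"
  shows "u \<in> A_space \<Phi> M" "A_norm \<Phi> M u \<le> c"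
  using assms A_norm_le[OF assms(2)] by (auto simp: A_space_iff)

text \<open>Countably many representations merge into one along the bijection
  \<open>prod_decode\<close>. The costs add by Tonelli for nonnegative double series, and the values
  add by absolute convergence.\<close>

lemma represents_series:
  assumes r: "\<And>k::nat. represents (u k) (f k) (g k)" and s: "summable (\<lambda>k. cost (f k) (g k))"
  shows "\<exists>F G. represents (\<lambda>x. \<Sum>k. u k x) F G \<and> cost F G = (\<Sum>k. cost (f k) (g k))"
proof -
  define a where "a = (\<lambda>(k, n). lux (f k n) * orl (g k n))"
  have a0: "a p \<ge> 0" for p by (auto simp: a_def split: prod.split)
  define F where "F = (\<lambda>i. case prod_decode i of (k, n) \<Rightarrow> f k n)"
  define G where "G = (\<lambda>i. case prod_decode i of (k, n) \<Rightarrow> g k n)"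
  have aFG: "lux (F i) * orl (G i) = a (prod_decode i)" for i
    by (simp add: F_def G_def a_def split: prod.split)
  have inner: "(\<Sum>n. ennreal (a (k, n))) = ennreal (cost (f k) (g k))" for k
    unfolding a_def cost_def prod.case by (rule suminf_ennreal2) (use representsD(3)[OF r] in auto)
  have "(\<Sum>i. ennreal (a (prod_decode i))) = (\<Sum>k. ennreal (cost (f k) (g k)))"
    by (rule suminf_ennreal_2dimen[of _ "\<lambda>p. ennreal (a p)"]) (simp add: inner)
  also have "\<dots> = ennreal (\<Sum>k. cost (f k) (g k))"
    by (rule suminf_ennreal2[OF cost_nonneg[OF r] s])
  finally have tot: "(\<Sum>i. ennreal (a (prod_decode i))) = ennreal (\<Sum>k. cost (f k) (g k))" .
  have sa: "summable (\<lambda>i. a (prod_decode i))"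
    by (rule summable_suminf_not_top) (use a0 tot in auto)
  have c: "cost F G = (\<Sum>k. cost (f k) (g k))"
  proof -
    have "ennreal (cost F G) = ennreal (\<Sum>k. cost (f k) (g k))"
      using tot unfolding cost_def aFG by (simp add: suminf_ennreal2[OF a0 sa])
    moreover have "cost F G \<ge> 0" unfolding cost_def aFG by (rule suminf_nonneg[OF sa a0])
    moreover have "(\<Sum>k. cost (f k) (g k)) \<ge> 0" by (rule suminf_nonneg[OF s cost_nonneg[OF r]])
    ultimately show ?thesis by simp
  qed
  have "(\<lambda>i. conv M (F i) (check (G i)) x) sums (\<Sum>k. u k x)" for x
  proof -
    define b where "b = (\<lambda>(k, n). conv M (f k n) (check (g k n)) x)"
    have bFG: "conv M (F i) (check (G i)) x = b (prod_decode i)" for i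
      by (simp add: F_def G_def b_def split: prod.split)
    have ba: "norm (b p) \<le> a p" for p
      using norm_conv_check_le[OF representsD(1,2)[OF r]] by (auto simp: a_def b_def split: prod.split)
    have nb: "summable (\<lambda>i. norm (b (prod_decode i)))"
      by (rule summable_comparison_test'[OF sa]) (use ba in auto)
    define S where "S = (\<Sum>i. b (prod_decode i))"
    have S: "(\<lambda>i. b (prod_decode i)) sums S"
      unfolding S_def by (rule summable_sums[OF summable_norm_cancel[OF nb]])
    \<comment> \<open>Absolute convergence makes the sum independent of the order, so it can be
      reindexed by pairs and then summed over \<open>n\<close> first.\<close>
    have "((\<lambda>i. b (prod_decode i)) has_sum S) UNIV"
      by (rule norm_summable_imp_has_sum[OF nb S])
    then have "(b has_sum S) (UNIV \<times> UNIV)"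
      using has_sum_reindex_bij_betw[OF bij_prod_decode, of b S] by simp
    then have "((\<lambda>k. u k x) has_sum S) UNIV"
    proof (rule has_sum_SigmaD)
      fix k :: nat
      have "summable (\<lambda>n. norm (b (k, n)))"
        by (rule summable_comparison_test'[OF representsD(3)[OF r[of k]]]) (use ba[of "(k, _)"] in \<open>simp add: a_def\<close>)
      then show "((\<lambda>n. b (k, n)) has_sum u k x) UNIV"
        by (rule norm_summable_imp_has_sum) (use representsD(4)[OF r[of k], of x] in \<open>simp add: b_def\<close>)
    qed
    then have "(\<lambda>k. u k x) sums S" by (rule has_sum_imp_sums)
    then have "S = (\<Sum>k. u k x)" by (rule sums_unique)
    then show ?thesis unfolding bFG using S by simp
  qed
  moreover have "F i \<in> M_space \<Phi> M" "G i \<in> M_space \<Psi> M" for i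
    using representsD(1,2)[OF r] by (auto simp: F_def G_def split: prod.split)
  ultimately have "represents (\<lambda>x. \<Sum>k. u k x) F G"
    unfolding represents_iff aFG using sa by blast
  with c show ?thesis by blast
qed

text \<open>Nearly optimal representations of the terms are merged. The sum stays continuous because
  the norm dominates the supremum norm, so the series converges uniformly.\<close>

lemma A_series:
  assumes h: "\<And>k::nat. h k \<in> A_space \<Phi> M" and s: "summable (\<lambda>k. A_norm \<Phi> M (h k))"
  shows A_series_space: "(\<lambda>x. \<Sum>k. h k x) \<in> A_space \<Phi> M"
    and A_series_norm: "A_norm \<Phi> M (\<lambda>x. \<Sum>k. h k x) \<le> (\<Sum>k. A_norm \<Phi> M (h k))"
    and A_series_summable: "summable (\<lambda>k. h k x)"
proof -
  have "continuous_on UNIV (\<lambda>x. \<Sum>k. h k x)"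
  proof (rule uniform_limit_theorem)
    show "uniform_limit UNIV (\<lambda>n x. \<Sum>k<n. h k x) (\<lambda>x. \<Sum>k. h k x) sequentially"
      by (rule Weierstrass_m_test[OF _ s]) (use norm_le_A_norm[OF h] in auto)
    show "\<forall>\<^sub>F n in sequentially. continuous_on UNIV (\<lambda>x. \<Sum>k<n. h k x)"
      using h by (intro always_eventually allI continuous_on_sum) (simp add: A_space_iff)
  qed simp
  moreover have ex: "\<exists>F G. represents (\<lambda>x. \<Sum>k. h k x) F G \<and> cost F G \<le> (\<Sum>k. A_norm \<Phi> M (h k)) + e"
    if "e > 0" for e
  proof -
    \<comment> \<open>The permitted excesses form a geometric series with sum
      \<open>e\<close>.\<close>
    have "\<forall>k. \<exists>f g. represents (h k) f g \<and> cost f g < A_norm \<Phi> M (h k) + e * (1/2) ^ Suc k"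
      using A_norm_approx[OF h] \<open>e > 0\<close> by (metis half_gt_zero_iff mult_pos_pos zero_less_one zero_less_power)
    then obtain f g where fg: "\<And>k. represents (h k) (f k) (g k)"
      "\<And>k. cost (f k) (g k) < A_norm \<Phi> M (h k) + e * (1/2) ^ Suc k" by metis
    have geo: "(\<lambda>k. e * (1/2) ^ Suc k) sums (e * 1)"
      by (intro sums_mult power_half_series)
    have s2: "summable (\<lambda>k. A_norm \<Phi> M (h k) + e * (1/2) ^ Suc k)"
      by (intro summable_add s sums_summable[OF geo])
    have sc: "summable (\<lambda>k. cost (f k) (g k))"
      by (rule summable_comparison_test'[OF s2]) (use fg cost_nonneg[OF fg(1)] in \<open>auto intro: less_imp_le\<close>)
    have "(\<Sum>k. cost (f k) (g k)) \<le> (\<Sum>k. A_norm \<Phi> M (h k) + e * (1/2) ^ Suc k)"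
      by (rule suminf_le[OF less_imp_le[OF fg(2)] sc s2])
    also have "\<dots> = (\<Sum>k. A_norm \<Phi> M (h k)) + e"
      using suminf_add[OF s sums_summable[OF geo]] sums_unique[OF geo] by simp
    finally have le: "(\<Sum>k. cost (f k) (g k)) \<le> (\<Sum>k. A_norm \<Phi> M (h k)) + e" .
    obtain F G where "represents (\<lambda>x. \<Sum>k. h k x) F G" "cost F G = (\<Sum>k. cost (f k) (g k))"
      using represents_series[OF fg(1) sc] by blast
    with le show ?thesis by (intro exI[of _ F] exI[of _ G]) simp
  qed
  ultimately show "(\<lambda>x. \<Sum>k. h k x) \<in> A_space \<Phi> M"
    unfolding A_space_iff using zero_less_one by blast
  show "A_norm \<Phi> M (\<lambda>x. \<Sum>k. h k x) \<le> (\<Sum>k. A_norm \<Phi> M (h k))"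
  proof (rule field_le_epsilon)
    fix e :: real assume "e > 0"
    then obtain F G where "represents (\<lambda>x. \<Sum>k. h k x) F G" "cost F G \<le> (\<Sum>k. A_norm \<Phi> M (h k)) + e"
      using ex by blast
    then show "A_norm \<Phi> M (\<lambda>x. \<Sum>k. h k x) \<le> (\<Sum>k. A_norm \<Phi> M (h k)) + e"
      using A_norm_le by (metis order_trans)
  qed
  show "summable (\<lambda>k. h k x)"
    by (rule summable_comparison_test'[OF s]) (use norm_le_A_norm[OF h] in auto)
qed

section \<open>Vector space structure and completeness\<close>

lemma A_zero: "(\<lambda>x. 0) \<in> A_space \<Phi> M" and A_norm_zero: "A_norm \<Phi> M (\<lambda>x. 0) = 0"
proof -
  have r: "represents (\<lambda>x. 0) (\<lambda>n x. 0) (\<lambda>n x. 0)"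
    using M_space_bounded[OF young, of "\<lambda>x. 0" 0] M_space_bounded[OF young_\<Psi>, of "\<lambda>x. 0" 0]
    by (simp add: represents_iff conv_def)
  have "cost (\<lambda>n x. 0) (\<lambda>n x. 0) \<le> 0" by (simp add: cost_def)
  from A_spaceI[OF _ r this] show "(\<lambda>x. 0) \<in> A_space \<Phi> M" "A_norm \<Phi> M (\<lambda>x. 0) = 0"
    by (auto intro: antisym)
qed

text \<open>A sum of two functions is read as a series that continues with zeros, so that
  \<open>A_series\<close> applies.\<close>

lemma A_add:
  assumes u: "u \<in> A_space \<Phi> M" and v: "v \<in> A_space \<Phi> M"
  shows A_add_space: "(\<lambda>x. u x + v x) \<in> A_space \<Phi> M"
    and A_norm_triangle: "A_norm \<Phi> M (\<lambda>x. u x + v x) \<le> A_norm \<Phi> M u + A_norm \<Phi> M v"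
proof -
  define h where "h = (\<lambda>k::nat. if k = 0 then u else if k = 1 then v else (\<lambda>x. 0))"
  have h: "h k \<in> A_space \<Phi> M" for k using u v A_zero by (simp add: h_def)
  have sums2: "(\<lambda>k::nat. if k = 0 then a else if k = 1 then b else 0) sums (a + b)"
    for a b :: "'b::real_normed_vector"
    using sums_finite[of "{0, 1::nat}" "\<lambda>k::nat. if k = 0 then a else if k = 1 then b else 0"] by simp
  have "(\<lambda>k. A_norm \<Phi> M (h k)) = (\<lambda>k. if k = 0 then A_norm \<Phi> M u else if k = 1 then A_norm \<Phi> M v else 0)"
    by (auto simp: h_def A_norm_zero)
  then have s: "(\<lambda>k. A_norm \<Phi> M (h k)) sums (A_norm \<Phi> M u + A_norm \<Phi> M v)"
    using sums2[of "A_norm \<Phi> M u" "A_norm \<Phi> M v"] by simp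
  have "(\<lambda>k. h k x) = (\<lambda>k. if k = 0 then u x else if k = 1 then v x else 0)" for x
    by (auto simp: h_def)
  then have "(\<lambda>x. \<Sum>k. h k x) = (\<lambda>x. u x + v x)"
    using sums_unique[OF sums2[of "u _" "v _"]] by (intro ext) simp
  then show "(\<lambda>x. u x + v x) \<in> A_space \<Phi> M" "A_norm \<Phi> M (\<lambda>x. u x + v x) \<le> A_norm \<Phi> M u + A_norm \<Phi> M v"
    using A_series_space[OF h sums_summable[OF s]] A_series_norm[OF h sums_summable[OF s]] sums_unique[OF s]
    by simp_all
qed

lemma A_cmult:
  assumes u: "u \<in> A_space \<Phi> M"
  shows A_cmult_space: "(\<lambda>x. c * u x) \<in> A_space \<Phi> M"
    and A_norm_cmult_le: "A_norm \<Phi> M (\<lambda>x. c * u x) \<le> norm c * A_norm \<Phi> M u"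
proof -
  have cont: "continuous_on UNIV (\<lambda>x. c * u x)"
    using u by (intro continuous_intros) (simp add: A_space_iff)
  have ex: "(\<lambda>x. c * u x) \<in> A_space \<Phi> M \<and> A_norm \<Phi> M (\<lambda>x. c * u x) \<le> norm c * (A_norm \<Phi> M u + e)"
    if e: "e > 0" for e
  proof -
    obtain f g where fg: "represents u f g" "cost f g < A_norm \<Phi> M u + e"
      using A_norm_approx[OF u e] .
    note r = representsD[OF fg(1)]
    have le: "lux (\<lambda>x. c * f n x) * orl (g n) \<le> norm c * (lux (f n) * orl (g n))" for n
      using mult_right_mono[OF lux_cmult[OF r(1)], of "orl (g n)" c n] by (simp add: mult.assoc)
    have s: "summable (\<lambda>n. lux (\<lambda>x. c * f n x) * orl (g n))"
      by (rule summable_comparison_test'[OF summable_mult[OF r(3), of "norm c"]]) (use le in auto)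
    have "conv M (\<lambda>x. c * f n x) (check (g n)) x = c * conv M (f n) (check (g n)) x" for n x
      by (simp add: conv_def mult.assoc)
    then have rc: "represents (\<lambda>x. c * u x) (\<lambda>n x. c * f n x) g"
      unfolding represents_iff using r s M_space_cmult[OF young r(1)] by (auto intro: sums_mult)
    have "cost (\<lambda>n x. c * f n x) g \<le> norm c * cost f g"
      unfolding cost_def suminf_mult[OF r(3), symmetric] by (rule suminf_le[OF le s summable_mult[OF r(3)]])
    also have "\<dots> \<le> norm c * (A_norm \<Phi> M u + e)" using fg(2) by (intro mult_left_mono) auto
    finally show ?thesis using A_spaceI[OF cont rc] by blast
  qed
  then show "(\<lambda>x. c * u x) \<in> A_space \<Phi> M" using zero_less_one by blast
  show "A_norm \<Phi> M (\<lambda>x. c * u x) \<le> norm c * A_norm \<Phi> M u"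
  proof (rule field_le_epsilon)
    fix e :: real assume "e > 0"
    have "A_norm \<Phi> M (\<lambda>x. c * u x) \<le> norm c * (A_norm \<Phi> M u + e / (norm c + 1))"
      using ex[of "e / (norm c + 1)"] \<open>e > 0\<close> by (simp add: add_nonneg_pos)
    also have "\<dots> = norm c * A_norm \<Phi> M u + e * (norm c / (norm c + 1))" by (simp add: distrib_left)
    also have "\<dots> \<le> norm c * A_norm \<Phi> M u + e * 1"
      using \<open>e > 0\<close> by (intro add_left_mono mult_left_mono) (auto simp: divide_le_eq add_nonneg_pos)
    finally show "A_norm \<Phi> M (\<lambda>x. c * u x) \<le> norm c * A_norm \<Phi> M u + e" by simp
  qed
qed

text \<open>The reverse inequality comes from \<open>A_norm_cmult_le\<close> with the scalar
  \<open>inverse c\<close>.\<close>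

lemma A_norm_cmult:
  assumes u: "u \<in> A_space \<Phi> M"
  shows "A_norm \<Phi> M (\<lambda>x. c * u x) = norm c * A_norm \<Phi> M u"
proof (cases "c = 0")
  case True
  then show ?thesis by (simp add: A_norm_zero)
next
  case False
  have "A_norm \<Phi> M (\<lambda>x. inverse c * (c * u x)) \<le> norm (inverse c) * A_norm \<Phi> M (\<lambda>x. c * u x)"
    by (rule A_norm_cmult_le[OF A_cmult_space[OF u]])
  then have "norm c * A_norm \<Phi> M u \<le> A_norm \<Phi> M (\<lambda>x. c * u x)"
    using False by (simp add: norm_inverse norm_divide field_simps flip: mult.assoc)
  with A_norm_cmult_le[OF u, of c] show ?thesis by simp
qed

lemma A_diff_space:
  assumes u: "u \<in> A_space \<Phi> M" and v: "v \<in> A_space \<Phi> M"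
  shows "(\<lambda>x. u x - v x) \<in> A_space \<Phi> M"
  using A_add_space[OF u A_cmult_space[OF v, of "- 1"]] by simp

lemma A_series_converges:
  assumes h: "\<And>k::nat. h k \<in> A_space \<Phi> M" and s: "summable (\<lambda>k. A_norm \<Phi> M (h k))"
  shows "\<exists>u\<in>A_space \<Phi> M. (\<lambda>n. A_norm \<Phi> M (\<lambda>x. (\<Sum>k<n. h k x) - u x)) \<longlonglongrightarrow> 0"
proof
  show "(\<lambda>x. \<Sum>k. h k x) \<in> A_space \<Phi> M" by (rule A_series_space[OF h s])
  have le: "A_norm \<Phi> M (\<lambda>x. (\<Sum>k<n. h k x) - (\<Sum>k. h k x)) \<le> (\<Sum>k. A_norm \<Phi> M (h (k + n)))" for n
  proof -
    have sn: "summable (\<lambda>k. A_norm \<Phi> M (h (k + n)))" by (rule summable_ignore_initial_segment[OF s])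
    have "(\<Sum>k<n. h k x) - (\<Sum>k. h k x) = - 1 * (\<Sum>k. h (k + n) x)" for x
      using suminf_minus_initial_segment[OF A_series_summable[OF h s], of n x] by simp
    then have "A_norm \<Phi> M (\<lambda>x. (\<Sum>k<n. h k x) - (\<Sum>k. h k x)) = A_norm \<Phi> M (\<lambda>x. \<Sum>k. h (k + n) x)"
      using A_norm_cmult[OF A_series_space[OF h sn], of "- 1"] by simp
    then show ?thesis using A_series_norm[OF h sn] by simp
  qed
  have lim: "(\<lambda>n. \<Sum>k. A_norm \<Phi> M (h (k + n))) \<longlonglongrightarrow> 0"
    by (rule suminf_exist_split2[OF s])
  show "(\<lambda>n. A_norm \<Phi> M (\<lambda>x. (\<Sum>k<n. h k x) - (\<Sum>k. h k x))) \<longlonglongrightarrow> 0"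
    by (rule tendsto_sandwich[OF _ _ tendsto_const lim]) (use le in auto)
qed

lemma A_complete:
  assumes F: "\<And>n. F n \<in> A_space \<Phi> M"
    and cauchy: "\<And>e. e > 0 \<Longrightarrow> \<exists>K. \<forall>m\<ge>K. \<forall>n\<ge>K. A_norm \<Phi> M (\<lambda>x. F m x - F n x) < e"
  shows "\<exists>u\<in>A_space \<Phi> M. (\<lambda>n. A_norm \<Phi> M (\<lambda>x. F n x - u x)) \<longlonglongrightarrow> 0"
  by (rule complete_if_absolutely_convergent[of "A_space \<Phi> M" "A_norm \<Phi> M" F,
        OF A_add_space A_diff_space _ A_norm_triangle A_series_converges F cauchy]) simp_all

section \<open>Translations and convolution with integrable functions\<close>

lemma representsI:
  assumes "\<And>n. f n \<in> M_space \<Phi> M" "\<And>n. g n \<in> M_space \<Psi> M"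
    and "\<And>n. lux (f n) * orl (g n) \<le> b n" "summable b"
    and "\<And>x. (\<lambda>n. conv M (f n) (check (g n)) x) sums u x"
  shows "represents u f g" "cost f g \<le> suminf b"
proof -
  have s: "summable (\<lambda>n. lux (f n) * orl (g n))"
    by (rule summable_comparison_test'[OF assms(4)]) (use assms(3) in simp)
  then show "represents u f g" using assms by (simp add: represents_iff)
  show "cost f g \<le> suminf b" unfolding cost_def by (rule suminf_le[OF assms(3) s assms(4)])
qed

text \<open>Tannery's theorem, that is dominated convergence for series along the filter
  \<open>nhds t\<close>: each term tends to 0 under a majorant \<open>b\<close> independent of
  \<open>s\<close>. The cost tends to 0, and the norm lies below it.\<close>

lemma A_norm_tendsto_zero:
  assumes rep: "\<And>s n. f s n \<in> M_space \<Phi> M" "\<And>s n. g s n \<in> M_space \<Psi> M"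
    and bound: "\<And>s n. lux (f s n) * orl (g s n) \<le> b n" and b: "summable b"
    and sums: "\<And>s x. (\<lambda>n. conv M (f s n) (check (g s n)) x) sums v s x"
    and lim: "\<And>n. ((\<lambda>s. lux (f s n) * orl (g s n)) \<longlongrightarrow> 0) (nhds t)"
  shows "((\<lambda>s. A_norm \<Phi> M (v s)) \<longlongrightarrow> 0) (nhds t)"
proof -
  have "((\<lambda>s. \<Sum>n. lux (f s n) * orl (g s n)) \<longlongrightarrow> (\<Sum>n. 0)) (nhds t)"
    by (rule tannerys_theorem[THEN conjunct2, THEN conjunct2, OF lim _ b])
      (use bound in \<open>auto intro!: always_eventually\<close>)
  then have lim0: "((\<lambda>s. cost (f s) (g s)) \<longlongrightarrow> 0) (nhds t)"
    by (simp add: cost_def)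
  show ?thesis
    by (rule tendsto_sandwich[OF _ _ tendsto_const lim0])
      (use A_norm_le[OF representsI(1)[OF rep bound b sums]] in \<open>auto intro!: always_eventually\<close>)
qed

lemma conv_left_translate:
  assumes [measurable]: "f \<in> borel_measurable M" "g \<in> borel_measurable M"
  shows "conv M (\<lambda>y. f (- s + y)) (check g) x = conv M f (check g) (- s + x)"
proof -
  have "(\<integral>y. f (- s + y) * g (- x + y) \<partial>M) = (\<integral>y. f (- s + (s + y)) * g (- x + (s + y)) \<partial>M)"
    by (rule integral_left[symmetric]) measurable
  then show ?thesis by (simp add: conv_check minus_add add.assoc)
qed

lemma conv_right_translate: "conv M f (check (\<lambda>y. g (- s + y))) x = conv M f (check g) (x + s)"
proof -
  have "- (x + s) + y = - s + (- x + y)" for y :: 'a by (simp only: minus_add add.assoc)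
  then show ?thesis by (simp only: conv_check)
qed

lemma conv_check_diff_left:
  assumes "f \<in> M_space \<Phi> M" "f' \<in> M_space \<Phi> M" "g \<in> M_space \<Psi> M"
  shows "conv M (\<lambda>y. f y - f' y) (check g) x = conv M f (check g) x - conv M f' (check g) x"
  using conv_check_integrable[OF assms(1,3)] conv_check_integrable[OF assms(2,3)]
  by (simp add: conv_check left_diff_distrib)

lemma conv_check_diff_right:
  assumes "f \<in> M_space \<Phi> M" "g \<in> M_space \<Psi> M" "g' \<in> M_space \<Psi> M"
  shows "conv M f (check (\<lambda>y. g y - g' y)) x = conv M f (check g) x - conv M f (check g') x"
  using conv_check_integrable[OF assms(1,2)] conv_check_integrable[OF assms(1,3)]
  by (simp add: conv_check right_diff_distrib)

lemma A_left_translate: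
  assumes u: "u \<in> A_space \<Phi> M"
  shows A_left_translate_space: "left_translate s u \<in> A_space \<Phi> M"
    and A_left_translate_continuous:
      "((\<lambda>s. A_norm \<Phi> M (\<lambda>x. left_translate s u x - left_translate t u x)) \<longlongrightarrow> 0) (nhds t)"
proof -
  obtain f g where "represents u f g" using u by (auto simp: A_space_iff)
  note r = representsD[OF this]
  note meas = M_space_measurable[OF r(1)] M_space_measurable[OF r(2)]
  note fM = M_space_translate[OF young r(1)]
  have sums: "(\<lambda>n. conv M (\<lambda>y. f n (- s + y)) (check (g n)) x) sums left_translate s u x" for s x
    using r(4)[of "- s + x"] by (simp add: conv_left_translate[OF meas] left_translate_def)
  have "continuous_on UNIV u" using u by (simp add: A_space_iff)
  then have "continuous_on UNIV (left_translate s u)"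
    unfolding left_translate_def by (rule continuous_on_compose2) (auto intro!: continuous_intros)
  moreover have "represents (left_translate s u) (\<lambda>n y. f n (- s + y)) g"
    by (rule representsI(1)[OF fM r(2) _ r(3) sums]) (simp add: lux_translate[OF r(1)])
  ultimately show "left_translate s u \<in> A_space \<Phi> M" by (auto simp: A_space_iff)
  show "((\<lambda>s. A_norm \<Phi> M (\<lambda>x. left_translate s u x - left_translate t u x)) \<longlongrightarrow> 0) (nhds t)"
  proof (rule A_norm_tendsto_zero)
    show "(\<lambda>y. f n (- s + y) - f n (- t + y)) \<in> M_space \<Phi> M" for s n
      by (rule M_space_diff[OF young fM fM])
    show "lux (\<lambda>y. f n (- s + y) - f n (- t + y)) * orl (g n) \<le> 4 * (lux (f n) * orl (g n))" for s n
      using mult_right_mono[OF lux_translate_diff[OF r(1)] orl_nonneg] by (simp add: mult.assoc)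
    show "summable (\<lambda>n. 4 * (lux (f n) * orl (g n)))" by (rule summable_mult[OF r(3)])
    show "(\<lambda>n. conv M (\<lambda>y. f n (- s + y) - f n (- t + y)) (check (g n)) x) sums
        (left_translate s u x - left_translate t u x)" for s x
      unfolding conv_check_diff_left[OF fM fM r(2)] by (rule sums_diff[OF sums sums])
    show "((\<lambda>s. lux (\<lambda>y. f n (- s + y) - f n (- t + y)) * orl (g n)) \<longlongrightarrow> 0) (nhds t)" for n
      by (rule tendsto_mult_left_zero[OF lux_translate_continuous[OF r(1)]])
  qed (rule r(2))
qed

lemma A_right_translate:
  assumes u: "u \<in> A_space \<Phi> M"
  shows A_right_translate_space: "right_translate s u \<in> A_space \<Phi> M"
    and A_right_translate_continuous:
      "((\<lambda>s. A_norm \<Phi> M (\<lambda>x. right_translate s u x - right_translate t u x)) \<longlongrightarrow> 0) (nhds t)"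
proof -
  obtain f g where "represents u f g" using u by (auto simp: A_space_iff)
  note r = representsD[OF this]
  note gM = M_space_translate[OF young_\<Psi> r(2)]
  have sums: "(\<lambda>n. conv M (f n) (check (\<lambda>y. g n (- s + y))) x) sums right_translate s u x" for s x
    using r(4)[of "x + s"] by (simp add: conv_right_translate right_translate_def)
  have "continuous_on UNIV u" using u by (simp add: A_space_iff)
  then have "continuous_on UNIV (right_translate s u)"
    unfolding right_translate_def by (rule continuous_on_compose2) (auto intro!: continuous_intros)
  moreover have "represents (right_translate s u) f (\<lambda>n y. g n (- s + y))"
    by (rule representsI(1)[OF r(1) gM _ r(3) sums]) (intro mult_left_mono orl_translate_le r(2) lux_nonneg)
  ultimately show "right_translate s u \<in> A_space \<Phi> M" by (auto simp: A_space_iff)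
  show "((\<lambda>s. A_norm \<Phi> M (\<lambda>x. right_translate s u x - right_translate t u x)) \<longlongrightarrow> 0) (nhds t)"
  proof (rule A_norm_tendsto_zero)
    show "(\<lambda>y. g n (- s + y) - g n (- t + y)) \<in> M_space \<Psi> M" for s n
      by (rule M_space_diff[OF young_\<Psi> gM gM])
    show "lux (f n) * orl (\<lambda>y. g n (- s + y) - g n (- t + y)) \<le> 2 * (lux (f n) * orl (g n))" for s n
      using mult_left_mono[OF orl_translate_diff[OF r(2)] lux_nonneg] by (simp add: mult.left_commute)
    show "summable (\<lambda>n. 2 * (lux (f n) * orl (g n)))" by (rule summable_mult[OF r(3)])
    show "(\<lambda>n. conv M (f n) (check (\<lambda>y. g n (- s + y) - g n (- t + y))) x) sums
        (right_translate s u x - right_translate t u x)" for s x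
      unfolding conv_check_diff_right[OF r(1) gM gM] by (rule sums_diff[OF sums sums])
    show "((\<lambda>s. lux (f n) * orl (\<lambda>y. g n (- s + y) - g n (- t + y))) \<longlongrightarrow> 0) (nhds t)" for n
      by (rule tendsto_mult_right_zero[OF orl_translate_continuous[OF r(2)]])
  qed (rule r(1))
qed

text \<open>The representation has to hold at every point. Hoelder's inequality makes the double
  integrals finite for each \<open>x\<close>, so associativity holds everywhere, and a summable
  uniform bound on the terms lets the integral against \<open>h\<close> pass through the
  series.\<close>

lemma A_conv:
  assumes h: "integrable M h" and u: "u \<in> A_space \<Phi> M"
  shows A_conv_space: "conv M h u \<in> A_space \<Phi> M"
    and A_norm_conv: "A_norm \<Phi> M (conv M h u) \<le> L1_norm M h * A_norm \<Phi> M u"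
proof -
  have [measurable]: "h \<in> borel_measurable M" using h by simp
  have h0: "L1_norm M h \<ge> 0" by (simp add: L1_norm_def)
  have cu: "continuous_on UNIV u" using u by (simp add: A_space_iff)
  have "continuous_on UNIV (\<lambda>p. u (- snd p + fst p))"
    by (intro continuous_on_compose2[OF cu] continuous_intros) auto
  from continuous_integral_kernel[OF h this]
  have cont: "continuous_on UNIV (conv M h u)" by (simp add: conv_def[abs_def])
  have ex: "conv M h u \<in> A_space \<Phi> M \<and> A_norm \<Phi> M (conv M h u) \<le> L1_norm M h * (A_norm \<Phi> M u + e)"
    if e: "e > 0" for e
  proof -
    obtain f g where fg: "represents u f g" "cost f g < A_norm \<Phi> M u + e"
      using A_norm_approx[OF u e] .
    note r = representsD[OF fg(1)]
    define b where "b = (\<lambda>n. conv M (f n) (check (g n)))"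
    have fm: "f n \<in> borel_measurable M" for n using M_space_measurable[OF r(1)] .
    have gi: "integrable M (check (g n))" for n
      by (rule integrable_check[OF M_space_\<Psi>_integrable[OF r(2)]])
    have [measurable]: "b n \<in> borel_measurable M" for n
      unfolding b_def by (rule conv_measurable[OF fm gi])
    have nb: "norm (b n x) \<le> lux (f n) * orl (g n)" for n x
      unfolding b_def by (rule norm_conv_check_le[OF r(1,2)])
    have assoc: "conv M h (b n) x = conv M (conv M h (f n)) (check (g n)) x" for n x
      unfolding b_def
    \<comment> \<open>The inner integral is bounded by a constant independent of \<open>y\<close>,
      so integrability of \<open>h\<close> suffices for the outer one.\<close>
    proof (rule conv_assoc_at[symmetric])
      show "check (g n) \<in> borel_measurable M" using gi by (rule borel_measurable_integrable)
      have "(\<integral>\<^sup>+ y. ennreal (norm (h y)) * (\<integral>\<^sup>+ z. ennreal (norm (f n z * check (g n) (- z + (- y + x)))) \<partial>M) \<partial>M)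
          \<le> (\<integral>\<^sup>+ y. ennreal (norm (h y)) * ennreal (lux (f n) * orl (g n)) \<partial>M)"
        by (intro nn_integral_mono mult_left_mono hoelder_conv[OF r(1,2)]) simp
      also have "\<dots> = (\<integral>\<^sup>+ y. ennreal (norm (h y)) \<partial>M) * ennreal (lux (f n) * orl (g n))"
        by (rule nn_integral_multc) measurable
      also have "\<dots> < \<infinity>" using h by (simp add: nn_integral_eq_integral ennreal_mult_less_top)
      finally show "(\<integral>\<^sup>+ y. ennreal (norm (h y)) * (\<integral>\<^sup>+ z. ennreal (norm (f n z * check (g n) (- z + (- y + x)))) \<partial>M) \<partial>M) < \<infinity>" .
    qed (use M_space_integrable[OF r(1)] in \<open>auto simp del: borel_measurable_M\<close>)
    have sums: "(\<lambda>n. conv M (conv M h (f n)) (check (g n)) x) sums conv M h u x" for x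
    proof -
      have le: "norm (h y * b n (- y + x)) \<le> norm (h y) * (lux (f n) * orl (g n))" for n y
        unfolding norm_mult by (intro mult_left_mono nb) simp
      have int: "integrable M (\<lambda>y. h y * b n (- y + x))" for n
      proof (rule Bochner_Integration.integrable_bound)
        show "integrable M (\<lambda>y. norm (h y) * (lux (f n) * orl (g n)))" using h by simp
        show "AE y in M. norm (h y * b n (- y + x)) \<le> norm (norm (h y) * (lux (f n) * orl (g n)))"
          using le by (auto intro!: AE_I2 order_trans[OF le abs_ge_self])
      qed measurable
      have s1: "summable (\<lambda>n. norm (h y * b n (- y + x)))" for y
        by (rule summable_comparison_test'[OF summable_mult[OF r(3)]]) (use le in auto)
      have s2: "summable (\<lambda>n. \<integral>y. norm (h y * b n (- y + x)) \<partial>M)"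
      proof (rule summable_comparison_test'[OF summable_mult[OF r(3), of "L1_norm M h"]])
        fix n :: nat
        have "(\<integral>y. norm (h y * b n (- y + x)) \<partial>M) \<le> (\<integral>y. norm (h y) * (lux (f n) * orl (g n)) \<partial>M)"
          using int h le by (intro integral_mono) auto
        then show "norm (\<integral>y. norm (h y * b n (- y + x)) \<partial>M) \<le> L1_norm M h * (lux (f n) * orl (g n))"
          by (simp add: L1_norm_def)
      qed
      have "(\<Sum>n. h y * b n (- y + x)) = h y * u (- y + x)" for y
        using sums_unique[OF sums_mult[OF r(4)[of "- y + x"], of "h y"]] by (simp add: b_def)
      then have "(\<lambda>n. conv M h (b n) x) sums conv M h u x"
        using sums_integral[OF int AE_I2[OF s1] s2] by (simp add: conv_def)
      then show ?thesis unfolding assoc .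
    qed
    have le: "lux (conv M h (f n)) * orl (g n) \<le> L1_norm M h * (lux (f n) * orl (g n))" for n
      using mult_right_mono[OF lux_conv_le[OF h r(1)] orl_nonneg] by (simp add: mult.assoc)
    note rep = representsI[OF conv_in_M_space[OF h r(1)] r(2) le summable_mult[OF r(3)] sums]
    have "cost (\<lambda>n. conv M h (f n)) g \<le> L1_norm M h * cost f g"
      using rep(2) unfolding cost_def suminf_mult[OF r(3)] .
    also have "\<dots> \<le> L1_norm M h * (A_norm \<Phi> M u + e)"
      using fg(2) h0 by (intro mult_left_mono) auto
    finally show ?thesis using A_spaceI[OF cont rep(1)] by blast
  qed
  then show "conv M h u \<in> A_space \<Phi> M" using zero_less_one by blast
  show "A_norm \<Phi> M (conv M h u) \<le> L1_norm M h * A_norm \<Phi> M u"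
  proof (rule field_le_epsilon)
    fix e :: real assume "e > 0"
    have pos: "L1_norm M h + 1 > 0" using h0 by linarith
    have "A_norm \<Phi> M (conv M h u) \<le> L1_norm M h * (A_norm \<Phi> M u + e / (L1_norm M h + 1))"
      using ex[of "e / (L1_norm M h + 1)"] \<open>e > 0\<close> pos by simp
    also have "\<dots> = L1_norm M h * A_norm \<Phi> M u + e * (L1_norm M h / (L1_norm M h + 1))"
      by (simp add: distrib_left)
    also have "\<dots> \<le> L1_norm M h * A_norm \<Phi> M u + e * 1"
      using \<open>e > 0\<close> pos by (intro add_left_mono mult_left_mono) auto
    finally show "A_norm \<Phi> M (conv M h u) \<le> L1_norm M h * A_norm \<Phi> M u + e" by simp
  qed
qed

section \<open>Position inside L1: norm comparison and density\<close>

lemma A_space_L1: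
  assumes u: "u \<in> A_space \<Phi> M"
  shows A_space_integrable: "integrable M u" and L1_norm_le_A_norm: "L1_norm M u \<le> A_norm \<Phi> M u"
proof -
  show int: "integrable M u" using u by (intro continuous_integrable) (simp add: A_space_iff)
  have "L1_norm M u \<le> (\<integral>x. A_norm \<Phi> M u \<partial>M)"
    unfolding L1_norm_def using int norm_le_A_norm[OF u] by (intro integral_mono) auto
  then show "L1_norm M u \<le> A_norm \<Phi> M u" by simp
qed

text \<open>
  For continuous \<open>h\<close> and the normalized indicator \<open>w\<close> of a small neighbourhood of the unit,
  \<open>conv M h (check w) x\<close> is the average of \<open>h\<close> over a small neighbourhood of \<open>x\<close>.
\<close>

lemma A_space_dense:
  assumes f: "integrable M f" and e: "e > 0"
  shows "\<exists>u\<in>A_space \<Phi> M. L1_norm M (\<lambda>x. f x - u x) < e"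
proof -
  obtain h where h: "continuous_on UNIV h" "(\<integral>x. norm (f x - h x) \<partial>M) < e / 2"
    using continuous_dense[OF f, of "e/2"] e by auto
  have hm [measurable]: "h \<in> borel_measurable M" by (rule continuous_imp_measurable[OF h(1)])
  obtain B where B: "\<And>x. norm (h x) \<le> B" using continuous_bounded[OF h(1)] by blast
  have cont2: "continuous_on UNIV (\<lambda>p. h (snd p + fst p))"
    by (intro continuous_on_compose2[OF h(1)] continuous_intros) auto
  have "e / 4 > 0" using e by simp
  \<comment> \<open>The displacement is the parameter and the base point is the compact variable, so
    one neighbourhood of the unit serves all \<open>x\<close>.\<close>
  from uniform_continuity[OF cont2 this, of 0]
  obtain U where U: "open U" "0 \<in> U" "\<And>z x. z \<in> U \<Longrightarrow> norm (h (x + z) - h (x + 0)) \<le> e / 4"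
    unfolding dist_norm fst_conv snd_conv by metis
  have pos: "measure M U > 0" by (rule measure_open_pos[OF U(1,2)])
  have [measurable]: "U \<in> sets M" using U(1) by (simp add: sets_M)
  define v where "v = (\<lambda>z. indicator U z / measure M U)"
  have vm [measurable]: "v \<in> borel_measurable M" unfolding v_def by measurable
  have v0: "v z \<ge> 0" for z using pos by (simp add: v_def)
  have v1: "integrable M v" "(\<integral>z. v z \<partial>M) = 1" using pos by (auto simp: v_def)
  define w where "w = (\<lambda>z. complex_of_real (v z))"
  have wm [measurable]: "w \<in> borel_measurable M" unfolding w_def by measurable
  have wI: "integrable M w" unfolding w_def using v1(1) by (rule integrable_of_real)
  have w1: "(\<integral>z. w z \<partial>M) = 1" using v1(2) by (simp add: w_def)
  have wM: "w \<in> M_space \<Psi> M"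
    by (rule M_space_bounded[OF young_\<Psi> wm, of "1 / measure M U"])
      (use pos in \<open>auto simp: w_def v_def indicator_def norm_divide\<close>)
  have hM: "h \<in> M_space \<Phi> M" by (rule M_space_bounded[OF young hm B])
  define u where "u = conv M h (check w)"
  have u_eq: "u x = (\<integral>z. w z * h (x + z) \<partial>M)" for x
  proof -
    have "u x = (\<integral>z. h (x + z) * w (- x + (x + z)) \<partial>M)"
      unfolding u_def conv_check by (rule integral_left[symmetric]) measurable
    then show ?thesis by (simp add: mult.commute add.assoc[symmetric])
  qed
  have "continuous_on UNIV (\<lambda>p. h (fst p + snd p))"
    by (intro continuous_on_compose2[OF h(1)] continuous_intros) auto
  from continuous_integral_kernel[OF wI this]
  have cont: "continuous_on UNIV u" by (simp add: u_eq[abs_def])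
  \<comment> \<open>A single convolution is read as a series whose later terms vanish.\<close>
  have "conv M (if n = 0 then h else (\<lambda>x. 0)) (check (if n = 0 then w else (\<lambda>x. 0))) x
      = (if n = 0 then u x else 0)" for n :: nat and x
    by (cases "n = 0") (simp_all add: u_def conv_def)
  then have sums: "(\<lambda>n::nat. conv M (if n = 0 then h else (\<lambda>x. 0)) (check (if n = 0 then w else (\<lambda>x. 0))) x)
      sums u x" for x
    using sums_single[of 0 "\<lambda>_. u x"] by (simp only:)
  have "represents u (\<lambda>n. if n = 0 then h else (\<lambda>x. 0)) (\<lambda>n. if n = 0 then w else (\<lambda>x. 0))"
  proof (rule representsI(1)[OF _ _ order_refl _ sums])
    show "(if n = 0 then h else (\<lambda>x. 0)) \<in> M_space \<Phi> M" "(if n = 0 then w else (\<lambda>x. 0)) \<in> M_space \<Psi> M" for n :: nat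
      using hM wM M_space_bounded[OF young, of "\<lambda>x. 0" 0] M_space_bounded[OF young_\<Psi>, of "\<lambda>x. 0" 0] by auto
    show "summable (\<lambda>n::nat. lux (if n = 0 then h else (\<lambda>x. 0)) * orl (if n = 0 then w else (\<lambda>x. 0)))"
      by (rule summable_finite[of "{0}"]) auto
  qed
  with cont have uA: "u \<in> A_space \<Phi> M" by (auto simp: A_space_iff)
  have close: "norm (h x - u x) \<le> e / 4" for x
  proof -
    have int: "integrable M (\<lambda>z. w z * h (x + z))"
    proof (rule Bochner_Integration.integrable_bound)
      show "integrable M (\<lambda>z. B * norm (w z))" using wI by simp
      show "AE z in M. norm (w z * h (x + z)) \<le> norm (B * norm (w z))"
      proof (rule AE_I2)
        fix z
        have "norm (w z * h (x + z)) \<le> B * norm (w z)"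
          unfolding norm_mult mult.commute[of B] by (intro mult_left_mono B) simp
        then show "norm (w z * h (x + z)) \<le> norm (B * norm (w z))" by simp
      qed
    qed measurable
    have "h x - u x = (\<integral>z. w z * h x - w z * h (x + z) \<partial>M)"
      using wI int by (simp add: u_eq w1)
    also have "norm \<dots> \<le> (\<integral>z. v z * (e / 4) \<partial>M)"
    proof (rule order_trans[OF integral_norm_bound integral_mono])
      show "integrable M (\<lambda>z. norm (w z * h x - w z * h (x + z)))" using wI int by simp
      show "integrable M (\<lambda>z. v z * (e / 4))" using v1 by simp
      fix z
      show "norm (w z * h x - w z * h (x + z)) \<le> v z * (e / 4)"
      proof (cases "z \<in> U")
        case True
        have "norm (h x - h (x + z)) \<le> e / 4"
          using U(3)[OF True, of x] by (simp add: norm_minus_commute)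
        then have "v z * norm (h x - h (x + z)) \<le> v z * (e / 4)"
          by (intro mult_left_mono v0)
        then show ?thesis using v0[of z] by (simp add: w_def norm_mult flip: right_diff_distrib)
      qed (simp add: w_def v_def)
    qed
    also have "\<dots> = e / 4" using v1 by simp
    finally show ?thesis .
  qed
  have int: "integrable M (\<lambda>x. norm (f x - h x))" using f continuous_integrable[OF h(1)] by simp
  have "L1_norm M (\<lambda>x. f x - u x) \<le> (\<integral>x. norm (f x - h x) + e / 4 \<partial>M)"
    unfolding L1_norm_def
  proof (rule integral_mono)
    show "integrable M (\<lambda>x. norm (f x - u x))" using f A_space_integrable[OF uA] by simp
    fix x
    have "f x - u x = (f x - h x) + (h x - u x)" by simp
    also have "norm \<dots> \<le> norm (f x - h x) + norm (h x - u x)" by (rule norm_triangle_ineq)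
    also have "\<dots> \<le> norm (f x - h x) + e / 4" using close by simp
    finally show "norm (f x - u x) \<le> norm (f x - h x) + e / 4" .
  qed (use int in simp)
  also have "\<dots> = (\<integral>x. norm (f x - h x) \<partial>M) + e / 4" using int by simp
  also have "\<dots> < e" using h(2) e by simp
  finally show ?thesis using uA by blast
qed

section \<open>Passage from continuous functions to classes\<close>

abbreviation "S \<equiv> ae_space M (A_space \<Phi> M)"
abbreviation "N \<equiv> ae_norm M (A_space \<Phi> M) (A_norm \<Phi> M)"

lemma A_space_measurable: "u \<in> A_space \<Phi> M \<Longrightarrow> u \<in> borel_measurable M"
  by (intro continuous_imp_measurable) (simp add: A_space_iff)

lemma S_I:
  "f \<in> borel_measurable M \<Longrightarrow> u \<in> A_space \<Phi> M \<Longrightarrow> AE x in M. f x = u x \<Longrightarrow> f \<in> S"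
  unfolding ae_space_def by blast

lemma S_E:
  assumes "f \<in> S"
  obtains u where "f \<in> borel_measurable M" "u \<in> A_space \<Phi> M" "AE x in M. f x = u x"
  using assms unfolding ae_space_def by blast

text \<open>The norm of a class can be computed from any member of \<open>A_space\<close> in it,
  since there is only one. All properties of \<open>N\<close> reduce to those of
  \<open>A_norm\<close> through this.\<close>

lemma N_eq:
  assumes u: "u \<in> A_space \<Phi> M" and eq: "AE x in M. f x = u x"
  shows "N f = A_norm \<Phi> M u"
proof -
  have "(THE v. v \<in> A_space \<Phi> M \<and> (AE x in M. f x = v x)) = u"
  proof (rule the_equality)
    fix v assume v: "v \<in> A_space \<Phi> M \<and> (AE x in M. f x = v x)"
    then have "AE x in M. f x = v x" by simp
    with eq have "AE x in M. v x = u x" by eventually_elim simp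
    then show "v = u" using u v by (intro continuous_AE_eq) (auto simp: A_space_iff)
  qed (use u eq in simp)
  then show ?thesis by (simp add: ae_norm_def)
qed

lemma S_banach_space: "ae_banach_space M S N"
  unfolding ae_banach_space_def
proof (intro conjI ballI allI impI)
  show "ae_subspace M S"
    unfolding ae_subspace_def
  proof (intro conjI ballI allI impI)
    show "S \<subseteq> borel_measurable M" by (auto simp: ae_space_def)
    show "(\<lambda>x. 0) \<in> S" by (rule S_I[OF _ A_zero]) auto
    fix f assume "f \<in> S"
    then obtain u where u: "f \<in> borel_measurable M" "u \<in> A_space \<Phi> M" "AE x in M. f x = u x" by (rule S_E)
    show "g \<in> S" if g: "g \<in> borel_measurable M" "AE x in M. f x = g x" for g
      by (rule S_I[OF g(1) u(2)]) (use g(2) u(3) in eventually_elim, simp)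
    show "(\<lambda>x. c * f x) \<in> S" for c
    proof (rule S_I[OF _ A_cmult_space[OF u(2)]])
      show "(\<lambda>x. c * f x) \<in> borel_measurable M" using u(1) by measurable
      show "AE x in M. c * f x = c * u x" using u(3) by eventually_elim simp
    qed
    fix g assume "g \<in> S"
    then obtain v where v: "g \<in> borel_measurable M" "v \<in> A_space \<Phi> M" "AE x in M. g x = v x" by (rule S_E)
    show "(\<lambda>x. f x + g x) \<in> S"
    proof (rule S_I[OF _ A_add_space[OF u(2) v(2)]])
      show "(\<lambda>x. f x + g x) \<in> borel_measurable M" using u(1) v(1) by measurable
      show "AE x in M. f x + g x = u x + v x" using u(3) v(3) by eventually_elim simp
    qed
  qed
next
  fix f assume "f \<in> S"
  then obtain u where u: "f \<in> borel_measurable M" "u \<in> A_space \<Phi> M" "AE x in M. f x = u x" by (rule S_E)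
  note Nf = N_eq[OF u(2,3)]
  show "N f \<ge> 0" by (simp add: Nf)
  show "N f = 0 \<longleftrightarrow> (AE x in M. f x = 0)"
  proof
    assume "N f = 0"
    then have "u x = 0" for x using norm_le_A_norm[OF u(2), of x] by (simp add: Nf)
    then show "AE x in M. f x = 0" using u(3) by simp
  next
    assume "AE x in M. f x = 0"
    then show "N f = 0" using N_eq[OF A_zero] by (simp add: A_norm_zero)
  qed
  show "N (\<lambda>x. c * f x) = norm c * N f" for c
  proof -
    have "AE x in M. c * f x = c * u x" using u(3) by eventually_elim simp
    from N_eq[OF A_cmult_space[OF u(2)] this] show ?thesis by (simp add: Nf A_norm_cmult[OF u(2)])
  qed
  fix g assume "g \<in> S"
  then obtain v where v: "g \<in> borel_measurable M" "v \<in> A_space \<Phi> M" "AE x in M. g x = v x" by (rule S_E)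
  have "AE x in M. f x + g x = u x + v x" using u(3) v(3) by eventually_elim simp
  from N_eq[OF A_add_space[OF u(2) v(2)] this]
  show "N (\<lambda>x. f x + g x) \<le> N f + N g"
    by (simp add: Nf N_eq[OF v(2,3)] A_norm_triangle[OF u(2) v(2)])
next
  fix F :: "nat \<Rightarrow> 'a \<Rightarrow> complex"
  assume F: "(\<forall>n. F n \<in> S) \<and> (\<forall>e>0. \<exists>K. \<forall>m\<ge>K. \<forall>n\<ge>K. N (\<lambda>x. F m x - F n x) < e)"
  then have "\<forall>n. \<exists>u. u \<in> A_space \<Phi> M \<and> (AE x in M. F n x = u x)" by (metis S_E)
  then obtain u where u: "\<And>n. u n \<in> A_space \<Phi> M" "\<And>n. AE x in M. F n x = u n x" by metis
  have eq: "N (\<lambda>x. F m x - F n x) = A_norm \<Phi> M (\<lambda>x. u m x - u n x)" for m n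
    by (rule N_eq[OF A_diff_space[OF u(1) u(1)]])
      (use u(2)[of m] u(2)[of n] in eventually_elim, simp)
  have "\<exists>v\<in>A_space \<Phi> M. (\<lambda>n. A_norm \<Phi> M (\<lambda>x. u n x - v x)) \<longlonglongrightarrow> 0"
    by (rule A_complete[OF u(1)]) (use F in \<open>simp add: eq\<close>)
  then obtain v where v: "v \<in> A_space \<Phi> M" "(\<lambda>n. A_norm \<Phi> M (\<lambda>x. u n x - v x)) \<longlonglongrightarrow> 0" by blast
  have "N (\<lambda>x. F n x - v x) = A_norm \<Phi> M (\<lambda>x. u n x - v x)" for n
    by (rule N_eq[OF A_diff_space[OF u(1) v(1)]]) (use u(2)[of n] in eventually_elim, simp)
  moreover have "v \<in> S" by (rule S_I[OF A_space_measurable[OF v(1)] v(1)]) simp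
  ultimately show "\<exists>f\<in>S. (\<lambda>n. N (\<lambda>x. F n x - f x)) \<longlonglongrightarrow> 0"
    using v(2) by (intro bexI[of _ v]) simp_all
qed

lemma L1_norm_le_N:
  assumes "f \<in> S" shows "L1_norm M f \<le> N f"
proof -
  obtain u where u: "f \<in> borel_measurable M" "u \<in> A_space \<Phi> M" "AE x in M. f x = u x"
    using assms by (rule S_E)
  have [measurable]: "f \<in> borel_measurable M" "u \<in> borel_measurable M"
    using u(1) A_space_measurable[OF u(2)] by auto
  have "L1_norm M f = L1_norm M u"
    unfolding L1_norm_def by (rule integral_cong_AE) (use u(3) in auto)
  then show ?thesis using L1_norm_le_A_norm[OF u(2)] by (simp add: N_eq[OF u(2,3)])
qed

lemma S_dense: "dense_wrt (L1_norm M) S (L1 M)"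
  unfolding dense_wrt_def
proof (intro conjI ballI allI impI)
  show "S \<subseteq> L1 M"
  proof
    fix f assume "f \<in> S"
    then obtain u where u: "f \<in> borel_measurable M" "u \<in> A_space \<Phi> M" "AE x in M. f x = u x" by (rule S_E)
    have "AE x in M. u x = f x" using u(3) by eventually_elim simp
    from integrable_cong_AE_imp[OF A_space_integrable[OF u(2)] u(1) this]
    show "f \<in> L1 M" by (simp add: L1_def)
  qed
  fix f and e :: real assume "f \<in> L1 M" "e > 0"
  then obtain u where u: "u \<in> A_space \<Phi> M" "L1_norm M (\<lambda>x. f x - u x) < e"
    using A_space_dense unfolding L1_def by blast
  then show "\<exists>g\<in>S. L1_norm M (\<lambda>x. f x - g x) < e"
    by (intro bexI[of _ u] S_I[OF A_space_measurable]) auto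
qed

lemma S_left_translate:
  assumes "f \<in> S"
  shows "left_translate t f \<in> S"
    and "((\<lambda>s. N (\<lambda>x. left_translate s f x - left_translate t f x)) \<longlongrightarrow> 0) (nhds t)"
proof -
  obtain u where u: "f \<in> borel_measurable M" "u \<in> A_space \<Phi> M" "AE x in M. f x = u x"
    using assms by (rule S_E)
  have [measurable]: "f \<in> borel_measurable M" by (rule u(1))
  have eq: "AE x in M. left_translate s f x = left_translate s u x" for s
    unfolding left_translate_def by (rule AE_left[OF u(3)])
  show "left_translate t f \<in> S"
    by (rule S_I[OF _ A_left_translate_space[OF u(2)] eq]) (simp add: left_translate_def[abs_def])
  have "N (\<lambda>x. left_translate s f x - left_translate t f x)
      = A_norm \<Phi> M (\<lambda>x. left_translate s u x - left_translate t u x)" for s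
    by (rule N_eq[OF A_diff_space[OF A_left_translate_space[OF u(2)] A_left_translate_space[OF u(2)]]])
      (use eq[of s] eq[of t] in eventually_elim, simp)
  then show "((\<lambda>s. N (\<lambda>x. left_translate s f x - left_translate t f x)) \<longlongrightarrow> 0) (nhds t)"
    using A_left_translate_continuous[OF u(2)] by simp
qed

lemma S_right_translate:
  assumes "f \<in> S"
  shows "right_translate t f \<in> S"
    and "((\<lambda>s. N (\<lambda>x. right_translate s f x - right_translate t f x)) \<longlongrightarrow> 0) (nhds t)"
proof -
  obtain u where u: "f \<in> borel_measurable M" "u \<in> A_space \<Phi> M" "AE x in M. f x = u x"
    using assms by (rule S_E)
  have [measurable]: "f \<in> borel_measurable M" by (rule u(1))
  have eq: "AE x in M. right_translate s f x = right_translate s u x" for s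
    unfolding right_translate_def by (rule AE_right[OF u(3)])
  show "right_translate t f \<in> S"
    by (rule S_I[OF _ A_right_translate_space[OF u(2)] eq]) (simp add: right_translate_def[abs_def])
  have "N (\<lambda>x. right_translate s f x - right_translate t f x)
      = A_norm \<Phi> M (\<lambda>x. right_translate s u x - right_translate t u x)" for s
    by (rule N_eq[OF A_diff_space[OF A_right_translate_space[OF u(2)] A_right_translate_space[OF u(2)]]])
      (use eq[of s] eq[of t] in eventually_elim, simp)
  then show "((\<lambda>s. N (\<lambda>x. right_translate s f x - right_translate t f x)) \<longlongrightarrow> 0) (nhds t)"
    using A_right_translate_continuous[OF u(2)] by simp
qed

lemma S_conv:
  assumes h: "h \<in> L1 M" and f: "f \<in> S"
  shows "conv M h f \<in> S" "N (conv M h f) \<le> L1_norm M h * N f"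
proof -
  obtain u where u: "f \<in> borel_measurable M" "u \<in> A_space \<Phi> M" "AE x in M. f x = u x"
    using f by (rule S_E)
  have hI: "integrable M h" using h by (simp add: L1_def)
  have eq: "conv M h f = conv M h u"
    by (rule conv_cong_AE_right[OF borel_measurable_integrable[OF hI] u(1) A_space_measurable[OF u(2)] u(3)])
  note A = A_conv_space[OF hI u(2)]
  show "conv M h f \<in> S" unfolding eq by (rule S_I[OF A_space_measurable[OF A] A]) simp
  have "N (conv M h u) = A_norm \<Phi> M (conv M h u)" by (rule N_eq[OF A]) simp
  then show "N (conv M h f) \<le> L1_norm M h * N f"
    unfolding eq N_eq[OF u(2,3)] using A_norm_conv[OF hI u(2)] by simp
qed

lemma symmetric_segal: "symmetric_segal_algebra M S N"
  unfolding symmetric_segal_algebra_def segal_algebra_def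
  using S_dense S_banach_space L1_norm_le_N S_left_translate S_right_translate by blast

text \<open>Both constants are 1. The norm estimate for convolutions is available for every first
  factor in L1, in particular for one in \<open>S\<close>.\<close>

lemma abstract_segal: "abstract_segal_algebra M (L1 M) (L1_norm M) (conv M) S N"
  unfolding abstract_segal_algebra_def
proof (intro conjI exI[of _ "1::real"])
  show "\<forall>f\<in>S. L1_norm M f \<le> 1 * N f" using L1_norm_le_N by simp
  show "\<forall>f\<in>L1 M. \<forall>g\<in>S. conv M f g \<in> S" using S_conv by simp
  show "\<forall>f\<in>S. \<forall>g\<in>S. N (conv M f g) \<le> 1 * L1_norm M f * N g"
    using S_conv(2) S_dense unfolding dense_wrt_def by auto
qed (use L1_banach_algebra S_banach_space S_dense in auto)

end

theorem theorem3p5: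
  fixes \<Phi> :: "real \<Rightarrow> real"
    and M :: "'g::{topological_group_add, t2_space} measure"
  assumes "compact (UNIV :: 'g set)"
    and "left_haar_measure M"
    and "emeasure M UNIV = 1"
    and "N_function \<Phi>"
  shows "symmetric_segal_algebra M
           (ae_space M (A_space \<Phi> M)) (ae_norm M (A_space \<Phi> M) (A_norm \<Phi> M)) \<and>
         abstract_segal_algebra M (L1 M) (L1_norm M) (conv M)
           (ae_space M (A_space \<Phi> M)) (ae_norm M (A_space \<Phi> M) (A_norm \<Phi> M))"
proof -
  interpret orlicz_group M \<Phi>
    by unfold_locales (use assms in auto)
  show ?thesis
    using symmetric_segal abstract_segal by blast
qed

end
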